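(* Let $\mathcal{X}$ be an absolutely irreducible, smooth, projective algebraic curve over a finite field $\mathbb{F}$ with $|\mathbb{F}|>3$, let $P,Q,R$ be pairwise distinct $\mathbb{F}$-rational points of $\mathcal{X}$, and let $(a,b,c)\in\mathbb{N}^3$. The following are equivalent: (1) $(a,b,c)$ is in the Weierstrass gap set $G(P,Q,R)$; (2) the divisor $aP+bQ+cR$ has a basepoint at one of $P$, $Q$, or $R$; (3) $\sigma_{cR,P,Q}(a)>b$, or $\sigma_{aP,Q,R}(b)>c$, or $\sigma_{bQ,R,P}(c)>a$.
   Context: $\mathbb{N}$ denotes the nonnegative integers. For a divisor $A$ on $\mathcal{X}$, $L(A)=\{f\in\mathbb{F}(\mathcal{X})^\times : \operatorname{div}(f)\ge -A\}\cup\{0\}$. A divisor $D$ has a basepoint at a rational point $S$ if $L(D)=L(D-S)$. The Weierstrass semigroup is $H(P,Q,R)=\{(a,b,c)\in\mathbb{N}^3 : aP+bQ+cR=(f)_\infty\text{ for some } f\in\mathbb{F}(\mathcal{X})\}$, with $(f)_\infty$ the pole divisor of $f$, and the Weierstrass gap set is $G(P,Q,R)=\mathbb{N}^3\setminus H(P,Q,R)$. For distinct rational points $S,S'$, $\Delta(S,S')$ is the set of divisors $D$ such that $L(D)\neq L(D-S)$ and $L(D-S')=L(D-S-S')$. For a divisor $B$ and $i\in\mathbb{Z}$, it is known (Duursma--Park) that there is a unique integer, denoted $\sigma_{B,S,S'}(i)$, such that $B+iS+\sigma_{B,S,S'}(i)S'\in\Delta(S,S')$. *)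

theory Defs
  imports "HOL-Algebra.Algebraic_Closure_Type" "HOL-Library.Poly_Mapping"
begin

section \<open>Polynomials and forms\<close>

text \<open>Polynomials in variables \<open>'v\<close> with coefficients in \<open>'a\<close>; the finitely supported maps
  \<open>'v \<Rightarrow>\<^sub>0 nat\<close> are the monomials.\<close>

type_synonym ('v, 'a) mpoly = "('v \<Rightarrow>\<^sub>0 nat) \<Rightarrow>\<^sub>0 'a"

text \<open>The map \<open>h\<close> carries the coefficients into the ring where the value is taken.\<close>

definition mpoly_eval ::
    "('a::zero \<Rightarrow> 'b::comm_semiring_1) \<Rightarrow> ('v, 'a) mpoly \<Rightarrow> ('v \<Rightarrow> 'b) \<Rightarrow> 'b" where
  "mpoly_eval h g x =
    (\<Sum>m\<in>Poly_Mapping.keys g. h (Poly_Mapping.lookup g m) *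
       (\<Prod>i\<in>Poly_Mapping.keys m. x i ^ Poly_Mapping.lookup m i))"

definition is_form :: "nat \<Rightarrow> ('v, 'a::zero) mpoly \<Rightarrow> bool" where
  "is_form d g \<longleftrightarrow>
    (\<forall>m\<in>Poly_Mapping.keys g. (\<Sum>i\<in>Poly_Mapping.keys m. Poly_Mapping.lookup m i) = d)"

definition forms :: "('v, 'a::zero) mpoly set" where
  "forms = {g. \<exists>d. is_form d g}"

definition field_embedding :: "('a::field \<Rightarrow> 'b::field) \<Rightarrow> bool" where
  "field_embedding h \<longleftrightarrow>
    h 1 = 1 \<and> (\<forall>x y. h (x + y) = h x + h y) \<and> (\<forall>x y. h (x * y) = h x * h y)"

section \<open>Transcendence bases\<close>

text \<open>The elements of \<open>B\<close> serve as names of the variables.\<close>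

definition alg_independent :: "('k::field \<Rightarrow> 'f::field) \<Rightarrow> 'f set \<Rightarrow> bool" where
  "alg_independent h B \<longleftrightarrow>
    (\<forall>g :: ('f, 'k) mpoly.
       (\<forall>m\<in>Poly_Mapping.keys g. Poly_Mapping.keys m \<subseteq> B) \<and> mpoly_eval h g (\<lambda>b. b) = 0
       \<longrightarrow> g = 0)"

definition transcendence_basis :: "('k::field \<Rightarrow> 'f::field) \<Rightarrow> 'f set \<Rightarrow> bool" where
  "transcendence_basis h B \<longleftrightarrow>
    alg_independent h B \<and> (\<forall>B'. alg_independent h B' \<and> B \<subseteq> B' \<longrightarrow> B' = B)"

section \<open>Discrete valuation rings\<close>

text \<open>All rings here are subrings of a field \<open>'f\<close> that is their field of fractions.\<close>

definition ring_units :: "'f::field set \<Rightarrow> 'f set" where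
  "ring_units A = {u\<in>A. u \<noteq> 0 \<and> inverse u \<in> A}"

definition uniformizer :: "'f::field set \<Rightarrow> 'f \<Rightarrow> bool" where
  "uniformizer A t \<longleftrightarrow> t \<in> A \<and> t \<noteq> 0 \<and> t \<notin> ring_units A \<and>
    (\<forall>f. f \<noteq> 0 \<longrightarrow> (\<exists>u\<in>ring_units A. \<exists>n::int. f = u * t powi n))"

definition discrete_valuation_ring :: "'f::field set \<Rightarrow> bool" where
  "discrete_valuation_ring A \<longleftrightarrow>
    1 \<in> A \<and> (\<forall>a\<in>A. \<forall>b\<in>A. a - b \<in> A \<and> a * b \<in> A) \<and> (\<exists>t. uniformizer A t)"

text \<open>The normalized valuation; the value at \<open>0\<close> is meaningless.\<close>

definition valuation :: "'f::field set \<Rightarrow> 'f \<Rightarrow> int" where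
  "valuation A f =
    (THE n. \<exists>t u. uniformizer A t \<and> u \<in> ring_units A \<and> f = u * t powi n)"

section \<open>Projective curves and their function fields\<close>

text \<open>
  Projective space over the algebraic closure of \<open>'k\<close>, with coordinates indexed by \<open>'n\<close> (so of
  dimension \<open>card (UNIV :: 'n set) - 1\<close>). A subset of it is given by the set of all nonzero vectors of
  homogeneous coordinates of its points.
\<close>

definition zero_locus ::
    "('a::zero \<Rightarrow> 'b::comm_semiring_1) \<Rightarrow> ('n, 'a) mpoly set \<Rightarrow> ('n \<Rightarrow> 'b) set" where
  "zero_locus h S = {x. x \<noteq> (\<lambda>_. 0) \<and> (\<forall>g\<in>S. mpoly_eval h g x = 0)}"

definition closed_over_base :: "('n \<Rightarrow> 'k::field alg_closure) set \<Rightarrow> bool" where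
  "closed_over_base C \<longleftrightarrow> (\<exists>S :: ('n, 'k) mpoly set. S \<subseteq> forms \<and> C = zero_locus to_ac S)"

text \<open>Irreducibility is tested with closed sets over the algebraic closure, not over \<open>'k\<close>.\<close>

definition absolutely_irreducible :: "('n \<Rightarrow> 'k::field alg_closure) set \<Rightarrow> bool" where
  "absolutely_irreducible C \<longleftrightarrow> C \<noteq> {} \<and>
    (\<forall>S T :: ('n, 'k alg_closure) mpoly set. S \<subseteq> forms \<and> T \<subseteq> forms \<longrightarrow>
       C \<subseteq> zero_locus (\<lambda>c. c) S \<union> zero_locus (\<lambda>c. c) T \<longrightarrow>
       C \<subseteq> zero_locus (\<lambda>c. c) S \<or> C \<subseteq> zero_locus (\<lambda>c. c) T)"

text \<open>
  A projective variety over \<open>'k\<close> together with its function field \<open>'f\<close>: \<open>locus\<close> is the set of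
  geometric points, \<open>const\<close> embeds the constants into \<open>'f\<close>, and \<open>gen\<close> is a vector of homogeneous
  coordinates in \<open>'f\<close> of the generic point. The field \<open>'f\<close> is a function field of the variety if
  \<open>g / h \<mapsto> g (gen) / h (gen)\<close>, for forms \<open>g\<close>, \<open>h\<close> over \<open>'k\<close> of equal degree with \<open>h\<close> not vanishing
  identically on \<open>locus\<close>, identifies it with the field of rational functions.
\<close>

record (overloaded) ('k, 'f, 'n) variety =
  locus :: "('n \<Rightarrow> 'k alg_closure) set"
  const :: "'k \<Rightarrow> 'f"
  gen :: "'n \<Rightarrow> 'f"

definition is_function_field :: "('k::field, 'f::field, 'n) variety \<Rightarrow> bool" where
  "is_function_field C \<longleftrightarrow>
    field_embedding (const C) \<and>
    (\<forall>g\<in>forms. mpoly_eval (const C) g (gen C) = 0 \<longleftrightarrow>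
       (\<forall>x\<in>locus C. mpoly_eval to_ac g x = 0)) \<and>
    (\<forall>f. \<exists>d g h. is_form d g \<and> is_form d h \<and> mpoly_eval (const C) h (gen C) \<noteq> 0 \<and>
       f = mpoly_eval (const C) g (gen C) / mpoly_eval (const C) h (gen C))"

text \<open>
  The closed points of the variety are represented, as in the Proj construction, by their
  homogeneous prime ideals (more precisely by the sets of forms in these): the forms over \<open>'k\<close>
  vanishing at a geometric point. Two geometric points give the same closed point iff they are
  conjugate over \<open>'k\<close>. The rational points are those given by coordinates in \<open>'k\<close>.
\<close>

definition forms_at :: "('n \<Rightarrow> 'k::field alg_closure) \<Rightarrow> ('n, 'k) mpoly set" where
  "forms_at x = {g\<in>forms. mpoly_eval to_ac g x = 0}"

definition closed_points :: "('k::field, 'f, 'n) variety \<Rightarrow> ('n, 'k) mpoly set set" where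
  "closed_points C = forms_at ` locus C"

definition rational_points :: "('k::field, 'f, 'n) variety \<Rightarrow> ('n, 'k) mpoly set set" where
  "rational_points C = {forms_at (\<lambda>i. to_ac (v i)) | v. (\<lambda>i. to_ac (v i)) \<in> locus C}"

definition local_ring ::
    "('k::field, 'f::field, 'n) variety \<Rightarrow> ('n, 'k) mpoly set \<Rightarrow> 'f set" where
  "local_ring C p = {mpoly_eval (const C) g (gen C) / mpoly_eval (const C) h (gen C) | g h.
     \<exists>d. is_form d g \<and> is_form d h \<and> h \<notin> p}"

text \<open>
  Dimension is transcendence degree of the function field. Smoothness: all local rings at closed
  points are regular, i.e. discrete valuation rings since the dimension is one (over a perfect
  base field, e.g. a finite one, regular and smooth are the same).
\<close>

definition smooth_projective_curve :: "('k::field, 'f::field, 'n) variety \<Rightarrow> bool" where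
  "smooth_projective_curve C \<longleftrightarrow>
    closed_over_base (locus C) \<and> absolutely_irreducible (locus C) \<and>
    is_function_field C \<and>
    (\<exists>B. transcendence_basis (const C) B \<and> card B = 1) \<and>
    (\<forall>p\<in>closed_points C. discrete_valuation_ring (local_ring C p))"

section \<open>Divisors\<close>

type_synonym ('n, 'k) divisor = "('n, 'k) mpoly set \<Rightarrow>\<^sub>0 int"

definition divisors :: "('k::field, 'f, 'n) variety \<Rightarrow> ('n, 'k) divisor set" where
  "divisors C = {D. Poly_Mapping.keys D \<subseteq> closed_points C}"

definition ord_at ::
    "('k::field, 'f::field, 'n) variety \<Rightarrow> ('n, 'k) mpoly set \<Rightarrow> 'f \<Rightarrow> int" where
  "ord_at C p f = valuation (local_ring C p) f"

text \<open>\<open>D\<close> is the pole divisor of the nonzero rational function \<open>f\<close>.\<close>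

definition is_pole_divisor ::
    "('k::field, 'f::field, 'n) variety \<Rightarrow> 'f \<Rightarrow> ('n, 'k) divisor \<Rightarrow> bool" where
  "is_pole_divisor C f D \<longleftrightarrow> D \<in> divisors C \<and>
    (\<forall>p\<in>closed_points C. Poly_Mapping.lookup D p = max 0 (- ord_at C p f))"

definition RR_space ::
    "('k::field, 'f::field, 'n) variety \<Rightarrow> ('n, 'k) divisor \<Rightarrow> 'f set" where
  "RR_space C A =
    {f. f \<noteq> 0 \<and> (\<forall>p\<in>closed_points C. ord_at C p f \<ge> - Poly_Mapping.lookup A p)} \<union> {0}"

definition has_basepoint_at ::
    "('k::field, 'f::field, 'n) variety \<Rightarrow> ('n, 'k) divisor \<Rightarrow> ('n, 'k) mpoly set \<Rightarrow> bool" where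
  "has_basepoint_at C D S \<longleftrightarrow> RR_space C D = RR_space C (D - frag_of S)"

definition weierstrass_semigroup ::
    "('k::field, 'f::field, 'n) variety \<Rightarrow> ('n, 'k) mpoly set \<Rightarrow> ('n, 'k) mpoly set \<Rightarrow>
     ('n, 'k) mpoly set \<Rightarrow> (nat \<times> nat \<times> nat) set" where
  "weierstrass_semigroup C P Q R = {(a, b, c). \<exists>f. f \<noteq> 0 \<and> is_pole_divisor C f
     (frag_cmul (int a) (frag_of P) + frag_cmul (int b) (frag_of Q) + frag_cmul (int c) (frag_of R))}"

definition weierstrass_gaps ::
    "('k::field, 'f::field, 'n) variety \<Rightarrow> ('n, 'k) mpoly set \<Rightarrow> ('n, 'k) mpoly set \<Rightarrow>
     ('n, 'k) mpoly set \<Rightarrow> (nat \<times> nat \<times> nat) set" where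
  "weierstrass_gaps C P Q R = UNIV - weierstrass_semigroup C P Q R"

definition Delta ::
    "('k::field, 'f::field, 'n) variety \<Rightarrow> ('n, 'k) mpoly set \<Rightarrow> ('n, 'k) mpoly set \<Rightarrow>
     ('n, 'k) divisor set" where
  "Delta C S S' = {D\<in>divisors C. RR_space C D \<noteq> RR_space C (D - frag_of S) \<and>
     RR_space C (D - frag_of S') = RR_space C (D - frag_of S - frag_of S')}"

definition sigma ::
    "('k::field, 'f::field, 'n) variety \<Rightarrow> ('n, 'k) divisor \<Rightarrow> ('n, 'k) mpoly set \<Rightarrow>
     ('n, 'k) mpoly set \<Rightarrow> int \<Rightarrow> int" where
  "sigma C B S S' i =
    (THE j. B + frag_cmul i (frag_of S) + frag_cmul j (frag_of S') \<in> Delta C S S')"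

end

theory Submission
  imports Defs "HOL-Library.FuncSet" "HOL-Library.Multiset"
begin

text \<open>
  That the gaps are the triples whose divisor has a basepoint is linear algebra. A function whose pole divisor
  is exactly \<open>D = aP + bQ + cR\<close> witnesses that \<open>D\<close> has no basepoint at a point where
  \<open>D\<close> is positive, and the constant \<open>1\<close> does so where \<open>D\<close> vanishes.
  Conversely, if \<open>D\<close> has no basepoint at any of the three points, then \<open>L(D - P)\<close>,
  \<open>L(D - Q)\<close>, \<open>L(D - R)\<close> are three proper subspaces of \<open>L(D)\<close>; over a
  field with at least three elements they do not cover \<open>L(D)\<close> (lemma
  \<open>avoid_three_subspaces\<close>), and any function outside them has pole divisor \<open>D\<close>.

  For the description by \<open>\<sigma>\<close>, fix a divisor \<open>B\<close>, an integer \<open>i\<close>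
  and points \<open>S\<close>, \<open>S'\<close>. That \<open>B + iS + jS'\<close> has no basepoint at
  \<open>S\<close> is a property of \<open>j\<close> that is inherited by larger \<open>j\<close>. If it holds
  for some \<open>j\<close> and fails for all sufficiently negative \<open>j\<close>, then its threshold is
  the unique \<open>j\<close> with \<open>B + iS + jS' \<in> \<Delta>(S,S')\<close>, so it is
  \<open>\<sigma>(i)\<close>, and each of the three basepoint conditions is one of the three inequalities. The
  substance is therefore the existence of the threshold, i.e. two facts about the curve:
  \<open>L(B + jS') = 0\<close> for \<open>j\<close> very negative (\<open>RR_eventually_zero\<close>), and
  for some \<open>j\<close> a function in \<open>L(B + iS + jS')\<close> has the smallest order at
  \<open>S\<close> that this divisor allows (\<open>exact_pole_order\<close>). Instead of the Riemann-Roch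
  theorem, the proof uses the finiteness of the base field.

  Both facts follow once there is, for any two closed points \<open>p \<noteq> q\<close>, a function with a
  zero at \<open>p\<close> and neither zeros nor poles outside \<open>p\<close> and \<open>q\<close>
  (\<open>function_with_one_zero_one_pole\<close>): powers of such functions push all unwanted poles into
  \<open>q\<close>. They exist because the number of elements of \<open>L(uZ)\<close>, for \<open>Z\<close>
  the divisor of a coordinate, is eventually geometric in \<open>u\<close> (\<open>Hilbert_function\<close>).
  Hence for every large \<open>d\<close> some element of \<open>L(dZ)\<close> vanishes at \<open>p\<close> to
  so high an order that its remaining zeros form a divisor whose norm has a bound independent of
  \<open>d\<close>. There are finitely many such divisors, so two different \<open>d\<close> give the same
  one, and the quotient of the two functions has divisor \<open>rp - eZ\<close> with \<open>r, e > 0\<close>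
  (\<open>section_with_one_zero\<close>). Combining this with the same statement for \<open>q\<close>
  eliminates \<open>Z\<close>. This is the torsion property of divisor classes of degree zero.

  The count rests on three properties of the curve. Forms of high degree realize all prescribed residues at
  finitely many points (\<open>sections_surjective\<close>), which bounds the norm of a zero divisor by
  quotients of cardinalities. The number of values of forms of degree \<open>u\<close> grows at most
  exponentially in \<open>u\<close>, because the transcendence degree is one
  (\<open>form_values_growth\<close>). A function without poles has no zeros, because the curve is projective
  (\<open>no_zero_without_pole\<close>): otherwise the place of \<open>k[1/f]\<close> that sends
  \<open>1/f\<close> to \<open>0\<close> would extend to all ratios of coordinates, and its centre would be a
  point of the curve at which \<open>f\<close> is not regular.
\<close>

abbreviation "lookup \<equiv> Poly_Mapping.lookup"
abbreviation "keys \<equiv> Poly_Mapping.keys"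

section \<open>Evaluation of forms\<close>

lemma field_embeddingD:
  fixes h :: "'a::field \<Rightarrow> 'b::field"
  assumes "field_embedding h"
  shows "h 0 = 0" "h 1 = 1" "h (x + y) = h x + h y" "h (x * y) = h x * h y" "h (- x) = - h x"
    "h (x - y) = h x - h y" "h x = 0 \<longleftrightarrow> x = 0"
proof -
  show 1: "h 1 = 1" and add: "h (x + y) = h x + h y" and mult: "h (x * y) = h x * h y" for x y
    using assms by (auto simp: field_embedding_def)
  show 0: "h 0 = 0" using add[of 0 0] by (metis add.right_neutral add_left_cancel)
  show min: "h (- x) = - h x" for x using add[of x "- x"] 0 by (simp add: eq_neg_iff_add_eq_0 add.commute)
  show "h (x - y) = h x - h y" using add[of x "- y"] min by simp
  show "h x = 0 \<longleftrightarrow> x = 0"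
  proof
    assume "h x = 0"
    then show "x = 0" using mult[of x "inverse x"] 1 by (cases "x = 0") auto
  qed (simp add: 0)
qed

lemma field_embedding_to_ac: "field_embedding to_ac"
  by (simp add: field_embedding_def)

definition monomial_eval :: "('v \<Rightarrow> 'b::comm_semiring_1) \<Rightarrow> ('v \<Rightarrow>\<^sub>0 nat) \<Rightarrow> 'b" where
  "monomial_eval x m = (\<Prod>i\<in>keys m. x i ^ lookup m i)"

definition monomial_degree :: "('v \<Rightarrow>\<^sub>0 nat) \<Rightarrow> nat" where
  "monomial_degree m = (\<Sum>i\<in>keys m. lookup m i)"

lemma monomial_eval_superset:
  "finite A \<Longrightarrow> keys m \<subseteq> A \<Longrightarrow> monomial_eval x m = (\<Prod>i\<in>A. x i ^ lookup m i)"
  unfolding monomial_eval_def by (rule prod.mono_neutral_left) (auto simp: in_keys_iff)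

lemma monomial_degree_superset:
  "finite A \<Longrightarrow> keys m \<subseteq> A \<Longrightarrow> monomial_degree m = (\<Sum>i\<in>A. lookup m i)"
  unfolding monomial_degree_def by (rule sum.mono_neutral_left) (auto simp: in_keys_iff)

lemma monomial_eval_add: "monomial_eval x (m + m') = monomial_eval x m * monomial_eval x m'"
proof -
  let ?A = "keys m \<union> keys m'"
  have "monomial_eval x (m + m') = (\<Prod>i\<in>?A. x i ^ lookup (m + m') i)"
    by (rule monomial_eval_superset) (use keys_add[of m m'] in auto)
  also have "\<dots> = (\<Prod>i\<in>?A. x i ^ lookup m i) * (\<Prod>i\<in>?A. x i ^ lookup m' i)"
    by (simp add: lookup_add power_add prod.distrib)
  also have "\<dots> = monomial_eval x m * monomial_eval x m'"
    using monomial_eval_superset[of ?A m x] monomial_eval_superset[of ?A m' x] by simp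
  finally show ?thesis .
qed

lemma monomial_degree_add: "monomial_degree (m + m') = monomial_degree m + monomial_degree m'"
proof -
  let ?A = "keys m \<union> keys m'"
  have "monomial_degree (m + m') = (\<Sum>i\<in>?A. lookup (m + m') i)"
    by (rule monomial_degree_superset) (use keys_add[of m m'] in auto)
  also have "\<dots> = (\<Sum>i\<in>?A. lookup m i) + (\<Sum>i\<in>?A. lookup m' i)"
    by (simp add: lookup_add sum.distrib)
  also have "\<dots> = monomial_degree m + monomial_degree m'"
    using monomial_degree_superset[of ?A m] monomial_degree_superset[of ?A m'] by simp
  finally show ?thesis .
qed

lemma monomial_eval_scale: "monomial_eval (\<lambda>i. c * x i) m = c ^ monomial_degree m * monomial_eval x m"
  by (simp add: monomial_eval_def monomial_degree_def power_mult_distrib prod.distrib power_sum)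

lemma mpoly_eval_alt: "mpoly_eval h g x = (\<Sum>m\<in>keys g. h (lookup g m) * monomial_eval x m)"
  by (simp add: mpoly_eval_def monomial_eval_def)

lemma is_form_alt: "is_form d g \<longleftrightarrow> (\<forall>m\<in>keys g. monomial_degree m = d)"
  by (simp add: is_form_def monomial_degree_def)

lemma is_form_diff: "is_form d f \<Longrightarrow> is_form d g \<Longrightarrow> is_form d (f - g)"
  for f g :: "('v, 'a::comm_ring_1) mpoly"
  using keys_diff[of f g] by (force simp: is_form_alt)

lemma is_form_mult: "is_form d f \<Longrightarrow> is_form e g \<Longrightarrow> is_form (d + e) (f * g)"
  for f g :: "('v, 'a::comm_ring_1) mpoly"
  using keys_mult[of f g] by (force simp: is_form_alt monomial_degree_add)

lemma is_form_zero [simp]: "is_form d 0"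
  by (simp add: is_form_def)

definition const_form :: "'a::zero \<Rightarrow> ('v, 'a) mpoly" where
  "const_form c = Poly_Mapping.single 0 c"

definition coord_form :: "'v \<Rightarrow> ('v, 'a::zero_neq_one) mpoly" where
  "coord_form i = Poly_Mapping.single (Poly_Mapping.single i 1) 1"

lemma is_form_const: "is_form 0 (const_form c)"
  by (auto simp: is_form_def const_form_def)

lemma is_form_coord: "is_form 1 (coord_form i)"
  by (auto simp: is_form_def coord_form_def)

lemma is_form_one: "is_form 0 (1 :: ('v, 'a::comm_ring_1) mpoly)"
  using is_form_const[of "1::'a"] by (simp add: const_form_def)

lemma is_form_power: "is_form d f \<Longrightarrow> is_form (n * d) (f ^ n)"
  for f :: "('v, 'a::comm_ring_1) mpoly"
  by (induction n) (auto simp: is_form_one intro: is_form_mult)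

lemma is_form_prod: "(\<And>i. i \<in> I \<Longrightarrow> is_form (d i) (f i)) \<Longrightarrow> is_form (\<Sum>i\<in>I. d i) (\<Prod>i\<in>I. f i)"
  for f :: "'i \<Rightarrow> ('v, 'a::comm_ring_1) mpoly"
  by (induction I rule: infinite_finite_induct) (auto simp: is_form_one intro: is_form_mult)

lemma formsI: "is_form d g \<Longrightarrow> g \<in> forms"
  by (auto simp: forms_def)

context
  fixes h :: "'a::field \<Rightarrow> 'b::field"
  assumes h: "field_embedding h"
begin

lemma mpoly_eval_superset:
  "finite A \<Longrightarrow> keys g \<subseteq> A \<Longrightarrow>
    mpoly_eval h g x = (\<Sum>m\<in>A. h (lookup g m) * monomial_eval x m)"
  unfolding mpoly_eval_alt
  by (rule sum.mono_neutral_left) (auto simp: in_keys_iff field_embeddingD[OF h])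

lemma mpoly_eval_zero [simp]: "mpoly_eval h 0 x = 0"
  by (simp add: mpoly_eval_def)

lemma mpoly_eval_add: "mpoly_eval h (f + g) x = mpoly_eval h f x + mpoly_eval h g x"
proof -
  let ?A = "keys f \<union> keys g"
  have "mpoly_eval h (f + g) x = (\<Sum>m\<in>?A. h (lookup (f + g) m) * monomial_eval x m)"
    by (rule mpoly_eval_superset) (use keys_add[of f g] in auto)
  also have "\<dots> = (\<Sum>m\<in>?A. h (lookup f m) * monomial_eval x m) +
      (\<Sum>m\<in>?A. h (lookup g m) * monomial_eval x m)"
    by (simp add: lookup_add field_embeddingD[OF h] distrib_right sum.distrib)
  also have "\<dots> = mpoly_eval h f x + mpoly_eval h g x"
    using mpoly_eval_superset[of ?A f x] mpoly_eval_superset[of ?A g x] by simp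
  finally show ?thesis .
qed

lemma mpoly_eval_uminus: "mpoly_eval h (- f) x = - mpoly_eval h f x"
  by (simp add: mpoly_eval_alt field_embeddingD[OF h] sum_negf)

lemma mpoly_eval_diff: "mpoly_eval h (f - g) x = mpoly_eval h f x - mpoly_eval h g x"
  using mpoly_eval_add[of f "- g" x] by (simp add: mpoly_eval_uminus)

lemma mpoly_eval_sum: "mpoly_eval h (\<Sum>i\<in>I. f i) x = (\<Sum>i\<in>I. mpoly_eval h (f i) x)"
  by (induction I rule: infinite_finite_induct) (auto simp: mpoly_eval_add)

lemma mpoly_eval_single: "mpoly_eval h (Poly_Mapping.single m c) x = h c * monomial_eval x m"
  using mpoly_eval_superset[of "{m}" "Poly_Mapping.single m c" x] by auto

lemma mpoly_eval_mult: "mpoly_eval h (f * g) x = mpoly_eval h f x * mpoly_eval h g x"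
proof -
  have expand: "p = (\<Sum>m\<in>keys p. Poly_Mapping.single m (lookup p m))"
    for p :: "('c, 'a) mpoly"
    by (rule poly_mapping_eqI) (auto simp: lookup_sum lookup_single when_def in_keys_iff)
  have "mpoly_eval h (f * g) x = mpoly_eval h
      (\<Sum>m\<in>keys f. \<Sum>m'\<in>keys g.
        Poly_Mapping.single (m + m') (lookup f m * lookup g m')) x"
    by (subst expand[of f], subst expand[of g]) (simp add: sum_product mult_single)
  also have "\<dots> = (\<Sum>m\<in>keys f. \<Sum>m'\<in>keys g.
      (h (lookup f m) * monomial_eval x m) * (h (lookup g m') * monomial_eval x m'))"
    by (simp add: mpoly_eval_sum mpoly_eval_single field_embeddingD[OF h] monomial_eval_add mult_ac)
  also have "\<dots> = mpoly_eval h f x * mpoly_eval h g x"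
    by (simp add: mpoly_eval_alt sum_product)
  finally show ?thesis .
qed

lemma mpoly_eval_one: "mpoly_eval h 1 x = 1"
  using mpoly_eval_single[of 0 1 x] by (simp add: field_embeddingD[OF h] monomial_eval_def)

lemma mpoly_eval_power: "mpoly_eval h (f ^ n) x = mpoly_eval h f x ^ n"
  by (induction n) (auto simp: mpoly_eval_one mpoly_eval_mult)

lemma mpoly_eval_prod: "mpoly_eval h (\<Prod>i\<in>I. f i) x = (\<Prod>i\<in>I. mpoly_eval h (f i) x)"
  by (induction I rule: infinite_finite_induct) (auto simp: mpoly_eval_one mpoly_eval_mult)

lemma mpoly_eval_const: "mpoly_eval h (const_form c) x = h c"
  by (simp add: const_form_def mpoly_eval_single monomial_eval_def)

lemma mpoly_eval_coord: "mpoly_eval h (coord_form i) x = x i"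
  by (simp add: coord_form_def mpoly_eval_single monomial_eval_def field_embeddingD[OF h])

lemma mpoly_eval_scale: "is_form d g \<Longrightarrow> mpoly_eval h g (\<lambda>i. c * x i) = c ^ d * mpoly_eval h g x"
  by (simp add: mpoly_eval_alt is_form_alt monomial_eval_scale sum_distrib_left mult_ac)

end

section \<open>The valuation of a discrete valuation ring\<close>

text \<open>The normalized valuation is defined through an arbitrary uniformizer, so everything rests on two
  points: a unit has exponent \<open>0\<close> with respect to every uniformizer, and two uniformizers differ
  by a unit. The inequality for differences only says that the ring is closed under subtraction, after
  division by the argument of smaller value.\<close>

lemma dvr_props:
  fixes A :: "'f::field set"
  assumes "discrete_valuation_ring A"
  shows dvr_mult: "f \<noteq> 0 \<Longrightarrow> g \<noteq> 0 \<Longrightarrow> valuation A (f * g) = valuation A f + valuation A g"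
    and dvr_diff: "f \<noteq> 0 \<Longrightarrow> g \<noteq> 0 \<Longrightarrow> f \<noteq> g \<Longrightarrow> min (valuation A f) (valuation A g) \<le> valuation A (f - g)"
    and dvr_mem_iff: "f \<noteq> 0 \<Longrightarrow> f \<in> A \<longleftrightarrow> 0 \<le> valuation A f"
    and dvr_unit_iff: "f \<in> ring_units A \<longleftrightarrow> f \<noteq> 0 \<and> valuation A f = 0"
    and dvr_uniformizer: "\<exists>t. t \<noteq> 0 \<and> valuation A t = 1"
proof -
  from assms have A1: "1 \<in> A" and Ad: "\<And>a b. a \<in> A \<Longrightarrow> b \<in> A \<Longrightarrow> a - b \<in> A"
    and Am: "\<And>a b. a \<in> A \<Longrightarrow> b \<in> A \<Longrightarrow> a * b \<in> A" and ex: "\<exists>t. uniformizer A t"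
    by (auto simp: discrete_valuation_ring_def)
  have Apow: "a ^ n \<in> A" if "a \<in> A" for a n using that A1 Am by (induction n) auto
  have A0: "0 \<in> A" using Ad[OF A1 A1] by simp
  have Umult: "u * w \<in> ring_units A" if "u \<in> ring_units A" "w \<in> ring_units A" for u w
    using that Am by (auto simp: ring_units_def)
  have Uinv: "inverse u \<in> ring_units A" if "u \<in> ring_units A" for u
    using that by (auto simp: ring_units_def)
  have Upow: "u powi n \<in> ring_units A" if "u \<in> ring_units A" for u and n :: int
  proof -
    have "u ^ n \<in> ring_units A" if "u \<in> ring_units A" for u and n :: nat
      using that A1 Umult by (induction n) (auto simp: ring_units_def)
    then show ?thesis using that Uinv by (auto simp: power_int_def)
  qed
  have nonunit: "t powi n \<notin> ring_units A" if t: "uniformizer A t" and n: "0 < n" for t and n :: int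
  proof
    assume "t powi n \<in> ring_units A"
    then have "inverse (t powi n) * t ^ nat (n - 1) \<in> A"
      using t by (auto simp: ring_units_def uniformizer_def intro: Am Apow)
    moreover have "inverse (t powi n) * t ^ nat (n - 1) = inverse t"
    proof -
      have t0: "t \<noteq> 0" using t by (simp add: uniformizer_def)
      have "t powi n = t ^ nat (n - 1) * t"
      proof -
        have "nat n = Suc (nat (n - 1))" using n by simp
        then show ?thesis using n by (simp add: power_int_def)
      qed
      then show ?thesis using t0 by simp
    qed
    ultimately show False using t by (auto simp: uniformizer_def ring_units_def)
  qed
  have uniq: "n = k" if t: "uniformizer A t" and u: "u \<in> ring_units A" "w \<in> ring_units A"
    and eq: "u * t powi n = w * t powi k" for t u w n k
  proof (rule ccontr)
    assume "n \<noteq> k"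
    have t0: "t \<noteq> 0" using t by (simp add: uniformizer_def)
    have nz: "u \<noteq> 0" "w \<noteq> 0" using u by (auto simp: ring_units_def)
    have "t powi (n - k) = w * inverse u" "t powi (k - n) = u * inverse w"
      using eq t0 nz by (simp_all add: power_int_diff field_simps)
    then have "t powi (n - k) \<in> ring_units A" "t powi (k - n) \<in> ring_units A"
      using Umult Uinv u by auto
    then show False using nonunit[OF t, of "n - k"] nonunit[OF t, of "k - n"] \<open>n \<noteq> k\<close> by linarith
  qed
  have rep: "\<exists>u\<in>ring_units A. \<exists>n. f = u * t powi n" if "uniformizer A t" "f \<noteq> 0" for t f
    using that by (auto simp: uniformizer_def)
  have pos: "0 < n" if t: "uniformizer A t" "uniformizer A t'" and u: "u \<in> ring_units A" "t' = u * t powi n" for t t' u n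
  proof (rule ccontr)
    assume "\<not> 0 < n"
    have t0: "t \<noteq> 0" using t by (simp add: uniformizer_def)
    have nz: "u \<noteq> 0" using u by (auto simp: ring_units_def)
    show False
    proof (cases "n = 0")
      case True
      then show ?thesis using t u by (simp add: uniformizer_def)
    next
      case False
      then have "0 < - n" using \<open>\<not> 0 < n\<close> by simp
      have "inverse t' = inverse u * t powi (- n)" using u t0 by (simp add: power_int_minus)
      moreover have "t powi (- n) \<in> A" using \<open>0 < - n\<close> t Apow by (auto simp: power_int_def uniformizer_def)
      moreover have "inverse u \<in> A" using u by (auto simp: ring_units_def)
      ultimately have "inverse t' \<in> A" using Am by simp
      then show False using t by (auto simp: uniformizer_def ring_units_def)
    qed
  qed
  have one: "n = 1" if t: "uniformizer A t" "uniformizer A t'" and u: "u \<in> ring_units A" "t' = u * t powi n" for t t' u n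
  proof -
    have "t' \<noteq> 0" "t \<noteq> 0" using t by (auto simp: uniformizer_def)
    obtain w k where w: "w \<in> ring_units A" "t = w * t' powi k" using rep[OF t(2) \<open>t \<noteq> 0\<close>] by blast
    have "1 * t powi 1 = w * u powi k * t powi (n * k)"
      using w(2) u(2) by (simp add: power_int_mult_distrib power_int_mult mult.assoc)
    moreover have "1 \<in> ring_units A" using A1 by (simp add: ring_units_def)
    ultimately have "1 = n * k" using uniq[OF t(1)] Umult w(1) Upow u(1) by blast
    then show ?thesis using pos[OF t u] by (metis zmult_eq_1_iff less_minus_one_simps(3) not_less_iff_gr_or_eq)
  qed
  have val: "valuation A (u * t powi n) = n" if t: "uniformizer A t" and u: "u \<in> ring_units A" for t u n
    unfolding valuation_def
  proof (rule the_equality)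
    show "\<exists>t' u'. uniformizer A t' \<and> u' \<in> ring_units A \<and> u * t powi n = u' * t' powi n" using t u by blast
    fix k assume "\<exists>t' u'. uniformizer A t' \<and> u' \<in> ring_units A \<and> u * t powi n = u' * t' powi k"
    then obtain t' u' where t': "uniformizer A t'" "u' \<in> ring_units A" "u * t powi n = u' * t' powi k" by blast
    then have "t' \<noteq> 0" by (auto simp: uniformizer_def)
    then obtain w j where w: "w \<in> ring_units A" "t' = w * t powi j" using rep[OF t] by blast
    have "j = 1" by (rule one[OF t t'(1) w])
    then have "u * t powi n = (u' * w powi k) * t powi k"
      using t'(3) w(2) by (simp add: power_int_mult_distrib mult.assoc)
    then show "k = n" using uniq[OF t u] Umult[OF t'(2) Upow[OF w(1)]] by blast
  qed
  obtain t where t: "uniformizer A t" using ex by blast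
  then have t0: "t \<noteq> 0" "t \<in> A" by (auto simp: uniformizer_def)
  have rep': "\<exists>u\<in>ring_units A. f = u * t powi valuation A f" if "f \<noteq> 0" for f
    using rep[OF t that] val[OF t] by metis
  show mult: "valuation A (f * g) = valuation A f + valuation A g" if fg: "f \<noteq> 0" "g \<noteq> 0" for f g
  proof -
    obtain u w where uw: "u \<in> ring_units A" "f = u * t powi valuation A f"
      "w \<in> ring_units A" "g = w * t powi valuation A g" using rep' fg by blast
    then have "f * g = (u * w) * t powi (valuation A f + valuation A g)"
      using t0 by (metis (no_types, lifting) mult.assoc mult.left_commute power_int_add)
    then show ?thesis using val[OF t Umult[OF uw(1,3)]] by metis
  qed
  show mem: "f \<in> A \<longleftrightarrow> 0 \<le> valuation A f" if "f \<noteq> 0" for f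
  proof -
    obtain u where u: "u \<in> ring_units A" "f = u * t powi valuation A f" using rep' \<open>f \<noteq> 0\<close> by blast
    show ?thesis
    proof
      assume "0 \<le> valuation A f"
      then have "t powi valuation A f \<in> A" using t0 Apow by (auto simp: power_int_def)
      then show "f \<in> A" using u Am by (metis (no_types, lifting) mem_Collect_eq ring_units_def)
    next
      assume f: "f \<in> A"
      show "0 \<le> valuation A f"
      proof (rule ccontr)
        assume "\<not> 0 \<le> valuation A f"
        then have neg: "0 < - valuation A f" by simp
        have u0: "u \<noteq> 0" "inverse u \<in> A" "u \<in> A" using u(1) by (auto simp: ring_units_def)
        have "inverse (t powi (- valuation A f)) = f * inverse u"
          using u(2) u0 t0 by (metis field_class.field_inverse inverse_inverse_eq mult.assoc mult.commute mult_1 power_int_minus)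
        then have "inverse (t powi (- valuation A f)) \<in> A" using Am f u0 by simp
        moreover have "t powi (- valuation A f) \<in> A" using neg t0 Apow by (auto simp: power_int_def)
        ultimately have "t powi (- valuation A f) \<in> ring_units A" using t0 by (simp add: ring_units_def)
        then show False using nonunit[OF t neg] by blast
      qed
    qed
  qed
  have v1: "valuation A 1 = 0" using mult[of 1 1] by simp
  have inv: "valuation A (inverse f) = - valuation A f" if "f \<noteq> 0" for f
    using mult[of f "inverse f"] that v1 by simp
  show "f \<in> ring_units A \<longleftrightarrow> f \<noteq> 0 \<and> valuation A f = 0" for f
    using mem[of f] mem[of "inverse f"] inv[of f] by (cases "f = 0") (auto simp: ring_units_def)
  show "min (valuation A f) (valuation A g) \<le> valuation A (f - g)" if fg: "f \<noteq> 0" "g \<noteq> 0" "f \<noteq> g" for f g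
  proof -
    have *: "valuation A g \<le> valuation A (f - g)" if le: "valuation A g \<le> valuation A f" and nz: "f \<noteq> 0" "g \<noteq> 0" "f \<noteq> g" for f g
    proof -
      have "f * inverse g \<in> A" using mem[of "f * inverse g"] mult[of f "inverse g"] inv nz le by simp
      then have "f * inverse g - 1 \<in> A" using Ad A1 by blast
      moreover have "f - g = (f * inverse g - 1) * g" "f * inverse g - 1 \<noteq> 0" using nz by (auto simp: field_simps)
      ultimately show ?thesis using mult[of "f * inverse g - 1" g] mem[of "f * inverse g - 1"] nz by simp
    qed
    have "valuation A (-1) = 0" using mult[of "-1" "-1"] v1 by simp
    then have "valuation A (g - f) = valuation A (f - g)" using mult[of "-1" "f - g"] fg by simp
    then show ?thesis using *[of g f] *[of f g] fg by (cases "valuation A g \<le> valuation A f") auto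
  qed
  have "valuation A t = 1" using val[OF t, of 1 1] A1 by (simp add: ring_units_def)
  then show "\<exists>t. t \<noteq> 0 \<and> valuation A t = 1" using t0 by blast
qed

section \<open>Extension of places\<close>

text
  \<open>The graph of a ring homomorphism from a subring of one field to another field. As a relation it is extended by adding pairs; the last condition makes it single-valued.\<close>

definition place_graph :: "('f::field \<times> 'k::field) set \<Rightarrow> bool" where
  "place_graph G \<longleftrightarrow> (1, 1) \<in> G \<and>
    (\<forall>a \<alpha> b \<beta>. (a, \<alpha>) \<in> G \<longrightarrow> (b, \<beta>) \<in> G \<longrightarrow> (a - b, \<alpha> - \<beta>) \<in> G \<and> (a * b, \<alpha> * \<beta>) \<in> G) \<and>
    (\<forall>\<beta>. (0, \<beta>) \<in> G \<longrightarrow> \<beta> = 0)"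

lemma place_graphD:
  assumes "place_graph G"
  shows "(1, 1) \<in> G" "(0, 0) \<in> G"
    "\<And>a \<alpha> b \<beta>. (a, \<alpha>) \<in> G \<Longrightarrow> (b, \<beta>) \<in> G \<Longrightarrow> (a - b, \<alpha> - \<beta>) \<in> G"
    "\<And>a \<alpha> b \<beta>. (a, \<alpha>) \<in> G \<Longrightarrow> (b, \<beta>) \<in> G \<Longrightarrow> (a + b, \<alpha> + \<beta>) \<in> G"
    "\<And>a \<alpha> b \<beta>. (a, \<alpha>) \<in> G \<Longrightarrow> (b, \<beta>) \<in> G \<Longrightarrow> (a * b, \<alpha> * \<beta>) \<in> G"
    "\<And>\<beta>. (0, \<beta>) \<in> G \<Longrightarrow> \<beta> = 0"
proof -
  show 1: "(1, 1) \<in> G" using assms by (auto simp: place_graph_def)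
  show d: "(a - b, \<alpha> - \<beta>) \<in> G" if "(a, \<alpha>) \<in> G" "(b, \<beta>) \<in> G" for a \<alpha> b \<beta>
    using assms that unfolding place_graph_def by blast
  show 0: "(0, 0) \<in> G" using d[OF 1 1] by simp
  show "(a + b, \<alpha> + \<beta>) \<in> G" if "(a, \<alpha>) \<in> G" "(b, \<beta>) \<in> G" for a \<alpha> b \<beta>
    using d[OF that(1) d[OF 0 that(2)]] by simp
  show "(a * b, \<alpha> * \<beta>) \<in> G" if "(a, \<alpha>) \<in> G" "(b, \<beta>) \<in> G" for a \<alpha> b \<beta>
    using assms that unfolding place_graph_def by blast
  show "\<beta> = 0" if "(0, \<beta>) \<in> G" for \<beta> using assms that unfolding place_graph_def by blast
qed

lemma place_graph_sum:
  assumes "place_graph G" "\<And>i. i \<in> I \<Longrightarrow> (f i, g i) \<in> G"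
  shows "(sum f I, sum g I) \<in> G"
  using assms(2) by (induction I rule: infinite_finite_induct)
    (auto intro: place_graphD[OF assms(1)])

lemma place_graph_prod:
  assumes "place_graph G" "\<And>i. i \<in> I \<Longrightarrow> (f i, g i) \<in> G"
  shows "(prod f I, prod g I) \<in> G"
  using assms(2) by (induction I rule: infinite_finite_induct)
    (auto intro: place_graphD[OF assms(1)])

lemma place_graph_power:
  assumes "place_graph G" "(a, \<alpha>) \<in> G" shows "(a ^ n, \<alpha> ^ n) \<in> G"
  by (induction n) (auto intro: place_graphD[OF assms(1)] assms(2))

text
  \<open>An element with nonzero image may be inverted: it is itself nonzero, and its inverse has only one possible image. Afterwards the images form a field.\<close>

lemma place_graph_localize:
  assumes G: "place_graph G"
  defines "H \<equiv> {(a / b, \<alpha> / \<beta>) | a \<alpha> b \<beta>. (a, \<alpha>) \<in> G \<and> (b, \<beta>) \<in> G \<and> \<beta> \<noteq> 0}"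
  shows "place_graph H" "G \<subseteq> H" "\<And>a \<alpha>. (a, \<alpha>) \<in> H \<Longrightarrow> \<alpha> \<noteq> 0 \<Longrightarrow> (inverse a, inverse \<alpha>) \<in> H"
proof -
  note GD = place_graphD[OF G]
  have HI: "(a / b, \<alpha> / \<beta>) \<in> H" if "(a, \<alpha>) \<in> G" "(b, \<beta>) \<in> G" "\<beta> \<noteq> 0" for a \<alpha> b \<beta>
    using that unfolding H_def by blast
  have HE: "\<exists>a \<alpha> b \<beta>. x = a / b \<and> \<xi> = \<alpha> / \<beta> \<and> (a, \<alpha>) \<in> G \<and> (b, \<beta>) \<in> G \<and> \<beta> \<noteq> 0 \<and> b \<noteq> 0"
    if "(x, \<xi>) \<in> H" for x \<xi>
    using that GD(6) unfolding H_def by blast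
  show "G \<subseteq> H"
  proof clarify
    fix a \<alpha> assume "(a, \<alpha>) \<in> G"
    then show "(a, \<alpha>) \<in> H" using HI[OF _ GD(1)] by simp
  qed
  have inv: "(inverse x, inverse \<xi>) \<in> H" if x: "(x, \<xi>) \<in> H" "\<xi> \<noteq> 0" for x \<xi>
  proof -
    obtain a \<alpha> b \<beta> where *: "x = a / b" "\<xi> = \<alpha> / \<beta>" "(a, \<alpha>) \<in> G" "(b, \<beta>) \<in> G" "\<beta> \<noteq> 0"
      using HE[OF x(1)] by blast
    then have "(b / a, \<beta> / \<alpha>) \<in> H" using x(2) by (intro HI) auto
    then show ?thesis using * by simp
  qed
  then show "\<And>x \<xi>. (x, \<xi>) \<in> H \<Longrightarrow> \<xi> \<noteq> 0 \<Longrightarrow> (inverse x, inverse \<xi>) \<in> H" .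
  show "place_graph H"
    unfolding place_graph_def
  proof (intro conjI allI impI)
    show "(1, 1) \<in> H" using HI[OF GD(1) GD(1)] by simp
    fix x \<xi> y \<eta> assume "(x, \<xi>) \<in> H" "(y, \<eta>) \<in> H"
    then obtain a \<alpha> b \<beta> c \<gamma> d \<delta> where *: "x = a / b" "\<xi> = \<alpha> / \<beta>" "(a, \<alpha>) \<in> G" "(b, \<beta>) \<in> G" "\<beta> \<noteq> 0" "b \<noteq> 0"
      "y = c / d" "\<eta> = \<gamma> / \<delta>" "(c, \<gamma>) \<in> G" "(d, \<delta>) \<in> G" "\<delta> \<noteq> 0" "d \<noteq> 0"
      using HE by metis
    have "((a * d - c * b) / (b * d), (\<alpha> * \<delta> - \<gamma> * \<beta>) / (\<beta> * \<delta>)) \<in> H"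
      using * by (intro HI GD) auto
    then show "(x - y, \<xi> - \<eta>) \<in> H" using * by (simp add: diff_frac_eq)
    have "((a * c) / (b * d), (\<alpha> * \<gamma>) / (\<beta> * \<delta>)) \<in> H"
      using * by (intro HI GD) auto
    then show "(x * y, \<xi> * \<eta>) \<in> H" using * by simp
  next
    fix \<xi> assume "(0, \<xi>) \<in> H"
    then obtain a \<alpha> b \<beta> where *: "0 = a / b" "\<xi> = \<alpha> / \<beta>" "(a, \<alpha>) \<in> G" "b \<noteq> 0" using HE by blast
    then show "\<xi> = 0" using GD(6)[of \<alpha>] by simp
  qed
qed

text \<open>The polynomial \<open>\<pi>\<close> is the image of \<open>p\<close> when the homomorphism is
  applied to the coefficients.\<close>

definition poly_lift :: "('f::field \<times> 'k::field) set \<Rightarrow> 'f poly \<Rightarrow> 'k poly \<Rightarrow> bool" where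
  "poly_lift G p \<pi> \<longleftrightarrow> (\<forall>i. (poly.coeff p i, poly.coeff \<pi> i) \<in> G)"

lemma poly_lift_diff:
  "place_graph G \<Longrightarrow> poly_lift G p \<pi> \<Longrightarrow> poly_lift G q \<rho> \<Longrightarrow> poly_lift G (p - q) (\<pi> - \<rho>)"
  unfolding poly_lift_def by (auto intro: place_graphD)

lemma poly_lift_mult:
  "place_graph G \<Longrightarrow> poly_lift G p \<pi> \<Longrightarrow> poly_lift G q \<rho> \<Longrightarrow> poly_lift G (p * q) (\<pi> * \<rho>)"
  unfolding poly_lift_def by (auto simp: coeff_mult intro!: place_graph_sum place_graphD(5))

lemma poly_lift_monom:
  "place_graph G \<Longrightarrow> (a, \<alpha>) \<in> G \<Longrightarrow> poly_lift G (Polynomial.monom a n) (Polynomial.monom \<alpha> n)"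
  unfolding poly_lift_def by (auto intro: place_graphD)

text \<open>The polynomials that vanish at \<open>z\<close> are mapped to an ideal of polynomials over the
  field of images. A common root of this ideal can serve as the image of \<open>z\<close>. Since the target is
  algebraically closed, a generator of the ideal has a root unless it is constant, and then \<open>z\<close>
  satisfies a relation that is mapped to \<open>1\<close>.\<close>

lemma extend_to_generator:
  fixes G :: "('f::field \<times> 'k::alg_closed_field) set"
  assumes G: "place_graph G"
    and inv: "\<And>a \<alpha>. (a, \<alpha>) \<in> G \<Longrightarrow> \<alpha> \<noteq> 0 \<Longrightarrow> (inverse a, inverse \<alpha>) \<in> G"
  shows "(\<exists>G' \<alpha>. place_graph G' \<and> G \<subseteq> G' \<and> (z, \<alpha>) \<in> G') \<or> (\<exists>p. poly_lift G p 1 \<and> poly p z = 0)"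
proof -
  (* The images of the relations satisfied by z. *)
  define J where "J = {\<pi>. \<exists>p. poly_lift G p \<pi> \<and> poly p z = 0}"
  note GD = place_graphD[OF G]
  have extend: ?thesis if root: "\<And>\<pi>. \<pi> \<in> J \<Longrightarrow> poly \<pi> \<alpha> = 0" for \<alpha>
  proof -
    define G' where "G' = {(poly p z, poly \<pi> \<alpha>) | p \<pi>. poly_lift G p \<pi>}"
    have I: "(poly p z, poly \<pi> \<alpha>) \<in> G'" if "poly_lift G p \<pi>" for p \<pi> using that unfolding G'_def by blast
    have emb: "(a, \<beta>) \<in> G'" if "(a, \<beta>) \<in> G" for a \<beta>
      using I[OF poly_lift_monom[OF G that, of 0]] by (simp add: poly_monom)
    have gen: "(z, \<alpha>) \<in> G'"
      using I[OF poly_lift_monom[OF G GD(1), of 1]] by (simp add: poly_monom)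
    have "place_graph G'"
      unfolding place_graph_def
    proof (intro conjI allI impI)
      show "(1, 1) \<in> G'" using emb GD(1) .
      fix a \<beta> b \<gamma> assume "(a, \<beta>) \<in> G'" "(b, \<gamma>) \<in> G'"
      then obtain p \<pi> q \<rho> where *: "poly_lift G p \<pi>" "a = poly p z" "\<beta> = poly \<pi> \<alpha>"
        "poly_lift G q \<rho>" "b = poly q z" "\<gamma> = poly \<rho> \<alpha>" unfolding G'_def by blast
      show "(a - b, \<beta> - \<gamma>) \<in> G'" using I[OF poly_lift_diff[OF G *(1,4)]] * by simp
      show "(a * b, \<beta> * \<gamma>) \<in> G'" using I[OF poly_lift_mult[OF G *(1,4)]] * by simp
    next
      fix \<beta> assume "(0, \<beta>) \<in> G'"
      then show "\<beta> = 0" using root unfolding G'_def J_def by auto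
    qed
    moreover have "G \<subseteq> G'" using emb by auto
    ultimately show ?thesis using gen by blast
  qed
  show ?thesis
  proof (cases "J \<subseteq> {0}")
    case True
    then have "poly \<pi> 0 = 0" if "\<pi> \<in> J" for \<pi> using that by auto
    then show ?thesis by (rule extend)
  next
    case False
    then obtain \<pi>1 where "\<pi>1 \<in> J \<and> \<pi>1 \<noteq> 0" by blast
    from ex_has_least_nat[of "\<lambda>\<pi>. \<pi> \<in> J \<and> \<pi> \<noteq> 0", OF this, of degree] obtain \<pi>0 where \<pi>0: "\<pi>0 \<in> J" "\<pi>0 \<noteq> 0" "\<And>\<pi>. \<pi> \<in> J \<Longrightarrow> \<pi> \<noteq> 0 \<Longrightarrow> degree \<pi>0 \<le> degree \<pi>"
      by blast
    obtain p0 where p0: "poly_lift G p0 \<pi>0" "poly p0 z = 0" using \<pi>0(1) unfolding J_def by blast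
    (* The polynomial of minimal degree generates the ideal, by division with remainder;\nthe division can be carried out on the preimages as well. *)
    let ?c = "lead_coeff \<pi>0" and ?a = "poly.coeff p0 (degree \<pi>0)"
    have inv0: "(inverse ?a, inverse ?c) \<in> G"
      using p0(1) \<pi>0(2) inv unfolding poly_lift_def by simp
    have divides: "\<pi>0 dvd \<pi>" if "\<pi> \<in> J" for \<pi>
      using that
    proof (induction "degree \<pi>" arbitrary: \<pi> rule: less_induct)
      case less
      show ?case
      proof (cases "\<pi> = 0")
        case False
        obtain p where p: "poly_lift G p \<pi>" "poly p z = 0" using less.prems unfolding J_def by blast
        let ?n = "degree \<pi>" and ?k = "degree \<pi> - degree \<pi>0"
        have deg: "degree \<pi>0 \<le> degree \<pi>" using \<pi>0(3) less.prems False by blast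
        define \<mu> where "\<mu> = Polynomial.monom (lead_coeff \<pi> * inverse ?c) ?k"
        define m where "m = Polynomial.monom (poly.coeff p ?n * inverse ?a) ?k"
        have "poly_lift G m \<mu>" unfolding m_def \<mu>_def
          using p(1) inv0 by (intro poly_lift_monom G GD) (auto simp: poly_lift_def)
        then have lift: "poly_lift G (p - m * p0) (\<pi> - \<mu> * \<pi>0)"
          by (intro poly_lift_diff poly_lift_mult G p p0)
        then have J: "\<pi> - \<mu> * \<pi>0 \<in> J" using p(2) p0(2) unfolding J_def by (auto intro!: exI[of _ "p - m * p0"])
        have "\<pi>0 dvd \<pi> - \<mu> * \<pi>0"
        proof (cases "\<pi> - \<mu> * \<pi>0 = 0")
          case ne: False
          have \<mu>0: "\<mu> \<noteq> 0" using False \<pi>0(2) by (simp add: \<mu>_def monom_eq_0_iff)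
          have "degree (\<mu> * \<pi>0) = degree \<pi>"
            using \<mu>0 \<pi>0(2) deg by (simp add: degree_mult_eq \<mu>_def degree_monom_eq)
          moreover have "poly.coeff (\<mu> * \<pi>0) (degree \<pi>) = lead_coeff \<pi>"
            using \<pi>0(2) deg by (simp add: \<mu>_def coeff_monom_mult)
          ultimately have "degree (\<pi> - \<mu> * \<pi>0) < degree \<pi>"
            using ne
            by (metis coeff_diff degree_diff_le eq_iff_diff_eq_0 leading_coeff_0_iff
                order_le_imp_less_or_eq order_refl)
          then show ?thesis using less.hyps J by blast
        qed simp
        then show ?thesis by (metis diff_add_cancel dvd_add dvd_triv_right)
      qed simp
    qed
    show ?thesis
    proof (cases "degree \<pi>0 = 0")
      case True
      then have \<pi>0_eq: "\<pi>0 = [:?c:]" by (metis degree_eq_zeroE coeff_pCons_0 degree_pCons_0)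
      let ?m = "Polynomial.monom (inverse ?a) 0" and ?\<mu> = "Polynomial.monom (inverse ?c) 0"
      have "poly_lift G (?m * p0) (?\<mu> * \<pi>0)"
        by (intro poly_lift_mult poly_lift_monom G p0 inv0)
      moreover have "?\<mu> * \<pi>0 = 1"
        using \<pi>0(2) by (subst (2) \<pi>0_eq) (simp add: monom_0 one_pCons)
      ultimately show ?thesis using p0(2) by (intro disjI2 exI[of _ "?m * p0"]) simp
    next
      case False
      then obtain \<alpha> where "poly \<pi>0 \<alpha> = 0" using alg_closed_imp_poly_has_root[of \<pi>0] by auto
      then have "poly \<pi> \<alpha> = 0" if "\<pi> \<in> J" for \<pi> using divides[OF that] by (auto elim: dvdE)
      then show ?thesis by (rule extend)
    qed
  qed
qed

text \<open>A relation mapped to \<open>1\<close> has constant term a unit and all other coefficients in the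
  kernel. When such a relation for the inverse of \<open>z\<close> is multiplied by a power of
  \<open>z\<close>, its leading coefficient becomes the unit, and it can be used to cancel the leading term of
  the relation for \<open>z\<close>.\<close>

lemma reduce_unit_relation:
  assumes G: "place_graph G"
    and inv: "\<And>a \<alpha>. (a, \<alpha>) \<in> G \<Longrightarrow> \<alpha> \<noteq> 0 \<Longrightarrow> (inverse a, inverse \<alpha>) \<in> G"
    and z: "z \<noteq> 0"
    and p: "poly_lift G p 1" "poly p z = 0" and q: "poly_lift G q 1" "poly q (inverse z) = 0"
    and deg: "degree q \<le> degree p"
  shows "\<exists>p'. poly_lift G p' 1 \<and> poly p' z = 0 \<and> degree p' < degree p"
proof -
  note GD = place_graphD[OF G]
  have q0: "(poly.coeff q 0, 1) \<in> G" using q(1) unfolding poly_lift_def by (auto dest: spec[of _ 0])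
  then have q00: "poly.coeff q 0 \<noteq> 0" using GD(6) by force
  have degp: "degree p > 0"
  proof (rule ccontr)
    assume "\<not> degree p > 0"
    then obtain c where c: "p = [:c:]" by (metis degree_eq_zeroE gr0I)
    then have "(0, 1) \<in> G" using p unfolding poly_lift_def by (auto dest: spec[of _ 0])
    then show False using GD(6) by force
  qed
  let ?n = "degree p" and ?m = "degree q"
  have lead: "(poly.coeff p ?n, 0) \<in> G"
    using p(1) degp unfolding poly_lift_def by (auto dest!: spec[of _ ?n] simp: coeff_eq_0)
  have c: "(poly.coeff p ?n * inverse (poly.coeff q 0), 0) \<in> G"
    using GD(5)[OF lead inv[OF q0]] by simp
  (* The multiple of the reversed relation that has the same leading term as p.
     It maps to 0 because the leading coefficient of p does. *)
  define r where "r = Polynomial.monom (poly.coeff p ?n * inverse (poly.coeff q 0)) (?n - ?m) * reflect_poly q"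
  have "poly_lift G r 0"
  proof -
    have "poly_lift G (Polynomial.monom (poly.coeff p ?n * inverse (poly.coeff q 0)) (?n - ?m)) (Polynomial.monom 0 (?n - ?m))"
      by (rule poly_lift_monom[OF G c])
    moreover have "poly_lift G (reflect_poly q) (Polynomial.monom 1 ?m)"
      unfolding poly_lift_def
    proof
      fix i
      have "(poly.coeff q (?m - i), poly.coeff 1 (?m - i)) \<in> G" using q(1) unfolding poly_lift_def by blast
      then show "(poly.coeff (reflect_poly q) i, poly.coeff (Polynomial.monom 1 ?m) i) \<in> G"
        using GD(2) by (cases "i = ?m") (auto simp: coeff_reflect_poly split: if_splits)
    qed
    ultimately have "poly_lift G r (Polynomial.monom 0 (?n - ?m) * Polynomial.monom 1 ?m)"
      unfolding r_def by (rule poly_lift_mult[OF G])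
    then show ?thesis by simp
  qed
  then have lift: "poly_lift G (p - r) 1" using poly_lift_diff[OF G p(1)] by fastforce
  have "poly (reflect_poly q) z = z ^ ?m * poly q (inverse z)"
    using poly_reflect_poly_nz[OF z] .
  then have root: "poly (p - r) z = 0" using p(2) q(2) unfolding r_def by simp
  have cn: "poly.coeff r ?n = poly.coeff p ?n"
    using q00 deg unfolding r_def by (simp add: coeff_monom_mult coeff_reflect_poly)
  have dr: "degree r \<le> ?n"
  proof -
    have "degree r \<le> (?n - ?m) + degree (reflect_poly q)"
      unfolding r_def using degree_mult_le degree_monom_le by (metis (no_types, lifting) add_le_mono1 le_trans)
    then show ?thesis using degree_reflect_poly_le[of q] deg by linarith
  qed
  have "degree (p - r) < ?n"
  proof -
    have "degree (p - r) \<le> ?n" using degree_diff_le[of p ?n r] dr by simp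
    moreover have "poly.coeff (p - r) ?n = 0" using cn by simp
    ultimately show ?thesis using degp
      by (metis degree_0 leading_coeff_0_iff order_le_imp_less_or_eq)
  qed
  then show ?thesis using lift root by blast
qed

text \<open>If neither \<open>z\<close> nor its inverse could be added, each would satisfy a relation mapped
  to \<open>1\<close>, and two such relations of minimal degree would reduce one another.\<close>

lemma extend_place:
  fixes G :: "('f::field \<times> 'k::alg_closed_field) set"
  assumes G: "place_graph G" and z: "z \<noteq> 0"
  shows "\<exists>G' \<alpha>. place_graph G' \<and> G \<subseteq> G' \<and> ((z, \<alpha>) \<in> G' \<or> (inverse z, \<alpha>) \<in> G')"
proof -
  define H where "H = {(a / b, \<alpha> / \<beta>) | a \<alpha> b \<beta>. (a, \<alpha>) \<in> G \<and> (b, \<beta>) \<in> G \<and> \<beta> \<noteq> 0}"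
  note H = place_graph_localize[OF G, folded H_def]
  show ?thesis
  proof (rule ccontr)
    assume no: "\<not> ?thesis"
    obtain p1 where "poly_lift H p1 1 \<and> poly p1 z = 0"
      using extend_to_generator[OF H(1,3), of z] H(2) no by blast
    from ex_has_least_nat[of "\<lambda>p. poly_lift H p 1 \<and> poly p z = 0", OF this, of degree] obtain p where p: "poly_lift H p 1 \<and> poly p z = 0"
      "\<And>p'. poly_lift H p' 1 \<and> poly p' z = 0 \<Longrightarrow> degree p \<le> degree p'"
      by blast
    obtain q1 where "poly_lift H q1 1 \<and> poly q1 (inverse z) = 0"
      using extend_to_generator[OF H(1,3), of "inverse z"] H(2) no by blast
    from ex_has_least_nat[of "\<lambda>q. poly_lift H q 1 \<and> poly q (inverse z) = 0", OF this, of degree] obtain q where q: "poly_lift H q 1 \<and> poly q (inverse z) = 0"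
      "\<And>q'. poly_lift H q' 1 \<and> poly q' (inverse z) = 0 \<Longrightarrow> degree q \<le> degree q'"
      by blast
    show False
    proof (cases "degree q \<le> degree p")
      case True
      then show False using reduce_unit_relation[OF H(1,3) z, of p q] p q by (meson not_less)
    next
      case False
      then show False using reduce_unit_relation[OF H(1,3), of "inverse z" q p] z p q by (simp add: not_less) (meson not_less)
    qed
  qed
qed

lemma extend_place_finite:
  fixes G :: "('f::field \<times> 'k::alg_closed_field) set"
  assumes G: "place_graph G" and A: "finite A" "0 \<notin> A"
  shows "\<exists>G'. place_graph G' \<and> G \<subseteq> G' \<and> (\<forall>z\<in>A. \<exists>\<alpha>. (z, \<alpha>) \<in> G' \<or> (inverse z, \<alpha>) \<in> G')"
  using A
proof (induction A rule: finite_induct)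
  case empty
  then show ?case using G by auto
next
  case (insert z A)
  then obtain G1 where G1: "place_graph G1" "G \<subseteq> G1" "\<forall>z\<in>A. \<exists>\<alpha>. (z, \<alpha>) \<in> G1 \<or> (inverse z, \<alpha>) \<in> G1" by auto
  have "z \<noteq> 0" using insert.prems by auto
  then obtain G' \<alpha> where "place_graph G'" "G1 \<subseteq> G'" "(z, \<alpha>) \<in> G' \<or> (inverse z, \<alpha>) \<in> G'"
    using extend_place[OF G1(1)] by blast
  then show ?case using G1 by (intro exI[of _ G']) blast
qed

text
  \<open>Once every quotient of two coordinates, or its inverse, has an image, the coordinates are totally preordered by divisibility. Dividing by a coordinate that divides all the others gives the homogeneous coordinates of a point.\<close>

lemma place_center:
  fixes G :: "('f::field \<times> 'k::alg_closed_field) set" and y :: "'n::finite \<Rightarrow> 'f"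
  assumes G: "place_graph G" and y: "y \<noteq> (\<lambda>_. 0)"
  shows "\<exists>G' i x. place_graph G' \<and> G \<subseteq> G' \<and> y i \<noteq> 0 \<and> x i = 1 \<and> (\<forall>j. (y j / y i, x j) \<in> G')"
proof -
  define N where "N = {i. y i \<noteq> 0}"
  have N: "finite N" "N \<noteq> {}" using y by (auto simp: N_def)
  have "finite ((\<lambda>(i, j). y j / y i) ` (N \<times> N))" "0 \<notin> (\<lambda>(i, j). y j / y i) ` (N \<times> N)"
    using N by (auto simp: N_def)
  from extend_place_finite[OF G this] obtain G' where G': "place_graph G'" "G \<subseteq> G'"
    "\<And>i j. i \<in> N \<Longrightarrow> j \<in> N \<Longrightarrow> \<exists>\<alpha>. (y j / y i, \<alpha>) \<in> G' \<or> (y i / y j, \<alpha>) \<in> G'"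
    by (auto simp: image_iff)
  have "\<exists>i\<in>M. \<forall>j\<in>M. \<exists>\<alpha>. (y j / y i, \<alpha>) \<in> G'" if "M \<subseteq> N" "M \<noteq> {}" for M
  proof -
    have "finite M" using that N finite_subset by blast
    then show ?thesis using that(2,1)
    proof (induction M rule: finite_ne_induct)
      case (singleton i)
      then have "y i / y i = 1" by (auto simp: N_def)
      then show ?case using place_graphD(1)[OF G'(1)] by auto
    next
      case (insert k M)
      then obtain i where i: "i \<in> M" "\<forall>j\<in>M. \<exists>\<alpha>. (y j / y i, \<alpha>) \<in> G'" by auto
      have nz: "y i \<noteq> 0" "y k \<noteq> 0" using i insert.prems by (auto simp: N_def)
      obtain \<alpha> where "(y k / y i, \<alpha>) \<in> G' \<or> (y i / y k, \<alpha>) \<in> G'"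
        using G'(3)[of i k] i insert.prems by blast
      then show ?case
      proof
        assume "(y k / y i, \<alpha>) \<in> G'"
        then show ?case using i by (intro bexI[of _ i]) auto
      next
        assume \<alpha>: "(y i / y k, \<alpha>) \<in> G'"
        show ?case
        proof (intro bexI[of _ k] ballI)
          fix j assume "j \<in> insert k M"
          then consider "j = k" | "j \<in> M" by blast
          then show "\<exists>\<alpha>. (y j / y k, \<alpha>) \<in> G'"
          proof cases
            case 1
            then show ?thesis using place_graphD(1)[OF G'(1)] nz by auto
          next
            case 2
            then obtain \<beta> where "(y j / y i, \<beta>) \<in> G'" using i by blast
            then have "(y j / y i * (y i / y k), \<beta> * \<alpha>) \<in> G'"
              using \<alpha> by (intro place_graphD(5)[OF G'(1)])
            then show ?thesis using nz by auto
          qed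
        qed simp
      qed
    qed
  qed
  from this[OF subset_refl N(2)] obtain i where
    i: "i \<in> N" "\<And>j. j \<in> N \<Longrightarrow> \<exists>\<alpha>. (y j / y i, \<alpha>) \<in> G'" by blast
  have all: "\<exists>\<alpha>. (y j / y i, \<alpha>) \<in> G'" for j
    using i place_graphD(2)[OF G'(1)] by (cases "j \<in> N") (auto simp: N_def)
  then obtain x where x: "\<And>j. (y j / y i, x j) \<in> G'" by metis
  have "(1, x i) \<in> G'" using x[of i] i by (simp add: N_def)
  then have "(1 - 1, x i - 1) \<in> G'" by (rule place_graphD(3)[OF G'(1) _ place_graphD(1)[OF G'(1)]])
  then have "x i = 1" using place_graphD(6)[OF G'(1), of "x i - 1"] by simp
  then show ?thesis using G' x i by (auto simp: N_def intro!: exI[of _ G'] exI[of _ i] exI[of _ x])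
qed

section \<open>Growth of the values of forms\<close>

text \<open>The set \<open>P k\<close> plays the role of the polynomials of degree at most \<open>k\<close> in
  one transcendental element \<open>b\<close>, and every \<open>y j\<close> is algebraic over
  \<open>b\<close>: its power with exponent \<open>bound j\<close>, multiplied by \<open>lead j\<close>, is a
  combination of lower powers. Then every product of powers of the \<open>y j\<close>, up to a power of the
  common denominator, is a combination of finitely many reduced products, with coefficients of degree linear
  in the total degree.\<close>

locale power_reduction =
  fixes y :: "'n::finite \<Rightarrow> 'f::field" and P :: "nat \<Rightarrow> 'f set" and bound :: "'n \<Rightarrow> nat"
    and lead :: "'n \<Rightarrow> 'f" and M :: nat
  assumes P_0: "0 \<in> P k" and P_1: "1 \<in> P 0"
    and P_add: "a \<in> P k \<Longrightarrow> b \<in> P k \<Longrightarrow> a + b \<in> P k"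
    and P_mult: "a \<in> P k \<Longrightarrow> b \<in> P l \<Longrightarrow> a * b \<in> P (k + l)"
    and P_finite: "finite (P k)"
    and bound_pos: "0 < bound j"
    and lead: "lead j \<in> P M"
    and reduction: "\<exists>a. (\<forall>l. a l \<in> P M) \<and> lead j * y j ^ bound j = (\<Sum>l<bound j. a l * y j ^ l)"
begin

definition exponents :: "('n \<Rightarrow> nat) set" where
  "exponents = {\<beta>. \<forall>j. \<beta> j < bound j}"

definition power_product :: "('n \<Rightarrow> nat) \<Rightarrow> 'f" where
  "power_product \<beta> = (\<Prod>j\<in>UNIV. y j ^ \<beta> j)"

definition box :: "nat \<Rightarrow> 'f set" where
  "box k = (\<lambda>w. \<Sum>\<beta>\<in>exponents. w \<beta> * power_product \<beta>) ` (exponents \<rightarrow>\<^sub>E P k)"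

definition denom :: 'f where
  "denom = (\<Prod>j\<in>UNIV. lead j)"

definition slope :: nat where
  "slope = card (UNIV :: 'n set) * M"

lemma finite_exponents: "finite exponents"
proof -
  have "exponents \<subseteq> {\<beta>. \<forall>j. (j \<in> UNIV \<longrightarrow> \<beta> j \<in> {..<Max (range bound)}) \<and> (j \<notin> UNIV \<longrightarrow> \<beta> j = 0)}"
    unfolding exponents_def by (auto intro: less_le_trans)
  then show ?thesis using finite_set_of_finite_funs[of "UNIV :: 'n set" "{..<Max (range bound)}" 0]
    finite_subset by auto
qed

lemma box_finite: "finite (box k)"
  unfolding box_def by (intro finite_imageI finite_PiE finite_exponents P_finite)

lemma card_box: "card (box k) \<le> card (P k) ^ card exponents"
proof -
  have "card (box k) \<le> card (exponents \<rightarrow>\<^sub>E P k)"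
    unfolding box_def by (intro card_image_le finite_PiE finite_exponents P_finite)
  then show ?thesis using finite_exponents by (simp add: card_PiE)
qed

lemma boxI: "(\<And>\<beta>. \<beta> \<in> exponents \<Longrightarrow> w \<beta> \<in> P k) \<Longrightarrow> (\<Sum>\<beta>\<in>exponents. w \<beta> * power_product \<beta>) \<in> box k"
  unfolding box_def by (rule image_eqI[of _ _ "restrict w exponents"]) auto

lemma boxE:
  assumes "g \<in> box k"
  obtains w where "\<And>\<beta>. \<beta> \<in> exponents \<Longrightarrow> w \<beta> \<in> P k" "g = (\<Sum>\<beta>\<in>exponents. w \<beta> * power_product \<beta>)"
  using assms unfolding box_def by auto

lemma box_0: "0 \<in> box k"
  using boxI[of "\<lambda>_. 0" k] P_0 by simp

lemma box_add: "f \<in> box k \<Longrightarrow> g \<in> box k \<Longrightarrow> f + g \<in> box k"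
proof -
  assume "f \<in> box k" "g \<in> box k"
  then obtain w w' where "\<And>\<beta>. \<beta> \<in> exponents \<Longrightarrow> w \<beta> \<in> P k" "f = (\<Sum>\<beta>\<in>exponents. w \<beta> * power_product \<beta>)"
    "\<And>\<beta>. \<beta> \<in> exponents \<Longrightarrow> w' \<beta> \<in> P k" "g = (\<Sum>\<beta>\<in>exponents. w' \<beta> * power_product \<beta>)"
    by (auto elim!: boxE)
  then show ?thesis using boxI[of "\<lambda>\<beta>. w \<beta> + w' \<beta>" k] P_add by (simp add: distrib_right sum.distrib)
qed

lemma box_sum: "(\<And>i. i \<in> I \<Longrightarrow> f i \<in> box k) \<Longrightarrow> sum f I \<in> box k"
  by (induction I rule: infinite_finite_induct) (auto simp: box_0 box_add)

lemma box_mult: "a \<in> P k \<Longrightarrow> g \<in> box l \<Longrightarrow> a * g \<in> box (k + l)"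
proof -
  assume a: "a \<in> P k" and "g \<in> box l"
  then obtain w where "\<And>\<beta>. \<beta> \<in> exponents \<Longrightarrow> w \<beta> \<in> P l" "g = (\<Sum>\<beta>\<in>exponents. w \<beta> * power_product \<beta>)"
    by (auto elim!: boxE)
  then show ?thesis using boxI[of "\<lambda>\<beta>. a * w \<beta>" "k + l"] P_mult[OF a] by (simp add: sum_distrib_left mult.assoc)
qed

lemma power_product_in_box: "\<beta> \<in> exponents \<Longrightarrow> power_product \<beta> \<in> box 0"
proof -
  assume \<beta>: "\<beta> \<in> exponents"
  have "(\<Sum>\<gamma>\<in>exponents. (if \<gamma> = \<beta> then 1 else 0) * power_product \<gamma>) = power_product \<beta>"
    using \<beta> finite_exponents by (simp add: if_distrib[of "\<lambda>x. x * _"] cong: if_cong)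
  then show ?thesis using boxI[of "\<lambda>\<gamma>. if \<gamma> = \<beta> then 1 else 0" 0] P_0 P_1 by simp
qed

lemma prod_in_P: "finite I \<Longrightarrow> (\<And>i. i \<in> I \<Longrightarrow> a i \<in> P k) \<Longrightarrow> prod a I \<in> P (card I * k)"
  by (induction I rule: finite_induct) (auto simp: P_1 intro: P_mult)

lemma denom_in_P: "denom \<in> P slope"
  unfolding denom_def slope_def by (rule prod_in_P) (auto simp: lead)

text \<open>Multiplication by \<open>y j\<close> raises one exponent by one. Only if this leaves the range of
  reduced exponents is the relation for \<open>y j\<close> used; multiplying by the denominator in any case
  makes the degree bound uniform.\<close>

lemma mult_coord_in_box:
  assumes g: "g \<in> box k" shows "denom * (y j * g) \<in> box (slope + k)"
proof -
  have *: "denom * (y j * power_product \<beta>) \<in> box slope" if \<beta>: "\<beta> \<in> exponents" for \<beta>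
  proof -
    have split: "power_product (\<beta>(j := l)) = y j ^ l * (\<Prod>i\<in>UNIV - {j}. y i ^ \<beta> i)" for l
    proof -
      have "power_product (\<beta>(j := l)) = y j ^ l * (\<Prod>i\<in>UNIV - {j}. y i ^ (\<beta>(j := l)) i)"
        unfolding power_product_def by (subst prod.remove[of _ j]) auto
      moreover have "(\<Prod>i\<in>UNIV - {j}. y i ^ (\<beta>(j := l)) i) = (\<Prod>i\<in>UNIV - {j}. y i ^ \<beta> i)"
        by (rule prod.cong) auto
      ultimately show ?thesis by simp
    qed
    have shift: "y j * power_product \<beta> = power_product (\<beta>(j := Suc (\<beta> j)))"
      using split[of "\<beta> j"] split[of "Suc (\<beta> j)"] by simp
    show ?thesis
    proof (cases "Suc (\<beta> j) < bound j")
      case True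
      then have "\<beta>(j := Suc (\<beta> j)) \<in> exponents" using \<beta> by (auto simp: exponents_def)
      then show ?thesis unfolding shift using box_mult[OF denom_in_P power_product_in_box] by simp
    next
      case False
      then have b: "Suc (\<beta> j) = bound j"
      proof -
        have "\<beta> j < bound j" using \<beta> by (simp add: exponents_def)
        then show ?thesis using False by linarith
      qed
      obtain a where a: "\<And>l. a l \<in> P M" "lead j * y j ^ bound j = (\<Sum>l<bound j. a l * y j ^ l)"
        using reduction[of j] by blast
      (* The remaining factors of the denominator; lead j is consumed by the relation. *)
      define r where "r = (\<Prod>i\<in>UNIV - {j}. lead i)"
      have r: "r \<in> P (card (UNIV - {j}) * M)" unfolding r_def by (rule prod_in_P) (auto simp: lead)
      have slope: "card (UNIV - {j}) * M + M = slope"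

        unfolding slope_def card.remove[OF finite UNIV_I, of j] by simp
      have "denom * (y j * power_product \<beta>) = r * (lead j * y j ^ bound j) * (\<Prod>i\<in>UNIV - {j}. y i ^ \<beta> i)"
        unfolding shift split b denom_def r_def by (subst prod.remove[of _ j]) (auto simp: mult_ac)
      also have "\<dots> = (\<Sum>l<bound j. r * a l * power_product (\<beta>(j := l)))"
        unfolding a(2) split by (simp add: sum_distrib_left sum_distrib_right mult.assoc)
      also have "\<dots> \<in> box slope"
      proof (rule box_sum)
        fix l assume "l \<in> {..<bound j}"
        then have "\<beta>(j := l) \<in> exponents" using \<beta> by (auto simp: exponents_def)
        then show "r * a l * power_product (\<beta>(j := l)) \<in> box slope"
          using box_mult[OF P_mult[OF r a(1)] power_product_in_box] slope by simp
      qed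
      finally show ?thesis .
    qed
  qed
  obtain w where w: "\<And>\<beta>. \<beta> \<in> exponents \<Longrightarrow> w \<beta> \<in> P k" "g = (\<Sum>\<beta>\<in>exponents. w \<beta> * power_product \<beta>)"
    using g by (auto elim!: boxE)
  have "denom * (y j * g) = (\<Sum>\<beta>\<in>exponents. w \<beta> * (denom * (y j * power_product \<beta>)))"
    unfolding w(2) by (simp add: sum_distrib_left mult_ac)
  also have "\<dots> \<in> box (slope + k)"
    by (rule box_sum) (use box_mult[OF w(1) *] in \<open>simp add: add.commute\<close>)
  finally show ?thesis .
qed

lemma mult_power_in_box: "g \<in> box k \<Longrightarrow> denom ^ n * (y j ^ n * g) \<in> box (n * slope + k)"
proof (induction n)
  case (Suc n)
  have "denom ^ Suc n * (y j ^ Suc n * g) = denom * (y j * (denom ^ n * (y j ^ n * g)))" by (simp add: mult_ac)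
  moreover have "slope + (n * slope + k) = Suc n * slope + k" by simp
  ultimately show ?case using mult_coord_in_box[OF Suc.IH[OF Suc.prems], of j] by (simp only:)
qed simp

lemma one_in_box: "1 \<in> box 0"
  using power_product_in_box[of "\<lambda>_. 0"] bound_pos by (simp add: exponents_def power_product_def)

lemma monomial_in_box: "denom ^ monomial_degree m * monomial_eval y m \<in> box (monomial_degree m * slope)"
proof -
  have "denom ^ (\<Sum>i\<in>A. lookup m i) * (\<Prod>i\<in>A. y i ^ lookup m i)
      \<in> box ((\<Sum>i\<in>A. lookup m i) * slope)" if "finite A" for A
    using that
  proof (induction A rule: finite_induct)
    case empty
    then show ?case using one_in_box by simp
  next
    case (insert i A)
    then show ?case using mult_power_in_box[OF insert.IH, of "lookup m i" i]
      by (simp add: power_add mult_ac distrib_left)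
  qed
  then show ?thesis unfolding monomial_degree_def monomial_eval_def by simp
qed

lemma form_in_box:
  assumes "is_form u g" "\<And>a. h a \<in> P 0"
  shows "denom ^ u * mpoly_eval h g y \<in> box (u * slope)"
proof -
  have "denom ^ u * mpoly_eval h g y = (\<Sum>m\<in>keys g. h (lookup g m) * (denom ^ u * monomial_eval y m))"
    by (simp add: mpoly_eval_alt sum_distrib_left mult_ac)
  also have "\<dots> \<in> box (u * slope)"
  proof (rule box_sum)
    fix m assume "m \<in> keys g"
    then have "monomial_degree m = u" using assms(1) by (simp add: is_form_alt)
    then show "h (lookup g m) * (denom ^ u * monomial_eval y m) \<in> box (u * slope)"
      using box_mult[OF assms(2) monomial_in_box[of m]] by simp
  qed
  finally show ?thesis .
qed

end

text \<open>The coordinates of a geometric point are algebraic over the finite field \<open>'k\<close>, so one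
  may take for \<open>P k\<close> the constants, for every \<open>k\<close>, and divide each relation by its
  leading coefficient: all values lie in a single box.\<close>

lemma finite_form_values:
  fixes x :: "'n::finite \<Rightarrow> 'k::{field,finite} alg_closure"
  shows "finite {mpoly_eval to_ac g x | g. g \<in> forms}"
proof -
  have ex: "\<exists>n a. 0 < n \<and> (\<forall>l. a l \<in> range to_ac) \<and> x j ^ n = (\<Sum>l<n. a l * x j ^ l)" for j
  proof -
    obtain p :: "'k poly" where p: "p \<noteq> 0" "poly (map_poly to_ac p) (x j) = 0"
      using alg_closure_algebraic by blast
    let ?n = "degree p"
    have deg: "degree (map_poly to_ac p) = ?n" by (rule degree_map_poly) auto
    have "?n \<noteq> 0"
    proof
      assume "?n = 0"
      then obtain c where "p = [:c:]" by (rule degree_eq_zeroE)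
      then show False using p by (simp add: map_poly_pCons)
    qed
    have "(\<Sum>l\<le>?n. to_ac (poly.coeff p l) * x j ^ l) = 0"
      using p(2) unfolding poly_altdef deg by (simp add: coeff_map_poly)
    then have "to_ac (lead_coeff p) * x j ^ ?n = - (\<Sum>l<?n. to_ac (poly.coeff p l) * x j ^ l)"
      by (simp add: lessThan_Suc_atMost[symmetric] eq_neg_iff_add_eq_0 add.commute)
    then have "x j ^ ?n = - inverse (to_ac (lead_coeff p)) * (\<Sum>l<?n. to_ac (poly.coeff p l) * x j ^ l)"
      using p(1) by (simp add: field_simps)
    also have "\<dots> = (\<Sum>l<?n. to_ac (- inverse (lead_coeff p) * poly.coeff p l) * x j ^ l)"
      by (simp add: sum_distrib_left mult.assoc sum_negf)
    finally have "x j ^ ?n = (\<Sum>l<?n. to_ac (- inverse (lead_coeff p) * poly.coeff p l) * x j ^ l)" .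
    moreover have "\<forall>l. to_ac (- inverse (lead_coeff p) * poly.coeff p l) \<in> range to_ac" by blast
    ultimately show ?thesis using \<open>?n \<noteq> 0\<close>
      by (intro exI[of _ ?n] exI[of _ "\<lambda>l. to_ac (- inverse (lead_coeff p) * poly.coeff p l)"] conjI) simp_all
  qed
  then obtain n where n: "\<And>j. 0 < n j"
    "\<And>j. \<exists>a. (\<forall>l. a l \<in> range to_ac) \<and> x j ^ n j = (\<Sum>l<n j. a l * x j ^ l)" by metis
  have add: "a + b \<in> range to_ac" "a * b \<in> range to_ac" if "a \<in> range to_ac" "b \<in> range to_ac" for a b :: "'k alg_closure"
    using that by (auto simp flip: to_ac_add to_ac_mult)
  have 01: "0 \<in> range to_ac" "1 \<in> range to_ac" by (metis rangeI to_ac_0, metis rangeI to_ac_1)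
  interpret power_reduction x "\<lambda>_. range to_ac" n "\<lambda>_. 1" 0
    by unfold_locales (use n add 01 in auto)
  have "{mpoly_eval to_ac g x | g. g \<in> forms} \<subseteq> box 0"
  proof clarify
    fix g :: "('n, 'k) mpoly" assume "g \<in> forms"
    then obtain u where "is_form u g" by (auto simp: forms_def)
    then have "denom ^ u * mpoly_eval to_ac g x \<in> box (u * slope)" by (rule form_in_box) auto
    then show "mpoly_eval to_ac g x \<in> box 0" by (simp add: denom_def slope_def)
  qed
  then show ?thesis using box_finite finite_subset by blast
qed

lemma sum_embedding: "field_embedding h \<Longrightarrow> h (sum f I) = (\<Sum>i\<in>I. h (f i))"
  by (induction I rule: infinite_finite_induct) (simp_all add: field_embeddingD)

lemma map_poly_embedding:
  assumes h: "field_embedding h"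
  shows "map_poly h (p + q) = map_poly h p + map_poly h q" "map_poly h (p * q) = map_poly h p * map_poly h q"
proof -
  show "map_poly h (p + q) = map_poly h p + map_poly h q"
    by (rule poly_eqI) (simp add: coeff_map_poly field_embeddingD[OF h])
  show "map_poly h (p * q) = map_poly h p * map_poly h q"
    by (rule poly_eqI) (simp add: coeff_map_poly coeff_mult field_embeddingD[OF h] sum_embedding[OF h])
qed

lemma monomial_eval_single: "monomial_eval x (Poly_Mapping.single b i) = x b ^ i"
  by (cases "i = 0") (simp_all add: monomial_eval_def)

definition poly_values :: "('k::field \<Rightarrow> 'f::field) \<Rightarrow> 'f \<Rightarrow> nat \<Rightarrow> 'f set" where
  "poly_values h b k = (\<lambda>p. poly (map_poly h p) b) ` {p. degree p \<le> k}"

lemma poly_valuesI: "degree p \<le> k \<Longrightarrow> poly (map_poly h p) b \<in> poly_values h b k"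
  by (simp add: poly_values_def)

lemma poly_valuesE:
  assumes "x \<in> poly_values h b k"
  obtains p where "degree p \<le> k" "x = poly (map_poly h p) b"
  using assms by (auto simp: poly_values_def)

lemma poly_values_const:
  assumes "field_embedding h" shows "h c \<in> poly_values h b k"
  using poly_valuesI[of "[:c:]" k h b] by (simp add: map_poly_pCons field_embeddingD[OF assms])

lemma poly_values_add:
  assumes h: "field_embedding h" and x: "x \<in> poly_values h b k" and y: "y \<in> poly_values h b k"
  shows "x + y \<in> poly_values h b k"
proof -
  obtain p where "degree p \<le> k" "x = poly (map_poly h p) b" using x by (rule poly_valuesE)
  moreover obtain q where "degree q \<le> k" "y = poly (map_poly h q) b" using y by (rule poly_valuesE)
  ultimately show ?thesis using poly_valuesI[of "p + q" k h b] degree_add_le[of p k q]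
    by (simp add: map_poly_embedding[OF h])
qed

lemma poly_values_mult:
  assumes h: "field_embedding h" and x: "x \<in> poly_values h b k" and y: "y \<in> poly_values h b l"
  shows "x * y \<in> poly_values h b (k + l)"
proof -
  obtain p where "degree p \<le> k" "x = poly (map_poly h p) b" using x by (rule poly_valuesE)
  moreover obtain q where "degree q \<le> l" "y = poly (map_poly h q) b" using y by (rule poly_valuesE)
  ultimately show ?thesis using poly_valuesI[of "p * q" "k + l" h b] degree_mult_le[of p q]
    by (simp add: map_poly_embedding[OF h])
qed

lemma poly_values_mono: "k \<le> l \<Longrightarrow> poly_values h b k \<subseteq> poly_values h b l"
  unfolding poly_values_def by (intro image_mono) auto

lemma card_poly_values:
  fixes h :: "'k::{field,finite} \<Rightarrow> 'f::field"
  shows "finite (poly_values h b k)" "card (poly_values h b k) \<le> card (UNIV :: 'k set) ^ Suc k"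
proof -
  let ?D = "{p :: 'k poly. degree p \<le> k}" and ?F = "{..k} \<rightarrow>\<^sub>E (UNIV :: 'k set)"
  have inj: "inj_on (\<lambda>p. restrict (poly.coeff p) {..k}) ?D"
  proof (rule inj_onI)
    fix p q :: "'k poly" assume d: "p \<in> ?D" "q \<in> ?D" and eq: "restrict (poly.coeff p) {..k} = restrict (poly.coeff q) {..k}"
    show "p = q"
    proof (rule poly_eqI)
      fix n show "poly.coeff p n = poly.coeff q n"
        using fun_cong[OF eq, of n] d by (cases "n \<le> k") (auto simp: coeff_eq_0)
    qed
  qed
  have sub: "(\<lambda>p. restrict (poly.coeff p) {..k}) ` ?D \<subseteq> ?F"
    by (auto simp: PiE_def extensional_def)
  have finF: "finite ?F" by (intro finite_PiE) auto
  have fin: "finite ?D" using inj_on_finite[OF inj sub finF] .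
  then show "finite (poly_values h b k)" by (simp add: poly_values_def)
  have "card (poly_values h b k) \<le> card ?D" unfolding poly_values_def by (rule card_image_le[OF fin])
  also have "\<dots> \<le> card ?F" by (rule card_inj_on_le[OF inj sub finF])
  also have "\<dots> = card (UNIV :: 'k set) ^ Suc k" by (simp add: card_PiE)
  finally show "card (poly_values h b k) \<le> card (UNIV :: 'k set) ^ Suc k" .
qed

text \<open>A polynomial relation for \<open>b\<close> is turned into an \<open>mpoly\<close> whose variables
  are named by elements of the field, as the definition of algebraic independence requires.\<close>

lemma poly_at_transcendental:
  fixes h :: "'k::field \<Rightarrow> 'f::field"
  assumes h: "field_embedding h" and b: "alg_independent h {b}" and p: "poly (map_poly h p) b = 0"
  shows "p = 0"
proof -
  define g where "g = (\<Sum>i\<le>degree p. Poly_Mapping.single (Poly_Mapping.single b i) (poly.coeff p i))"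
  have inj: "Poly_Mapping.single b i = Poly_Mapping.single b j \<longleftrightarrow> i = j" for i j :: nat
    by (metis lookup_single_eq)
  have keys: "keys m \<subseteq> {b}" if "m \<in> keys g" for m
  proof -
    have "keys g \<subseteq> (\<Union>i\<le>degree p. keys (Poly_Mapping.single (Poly_Mapping.single b i) (poly.coeff p i)))"
      unfolding g_def by (rule keys_sum)
    then have "m \<in> (\<Union>i\<le>degree p. keys (Poly_Mapping.single (Poly_Mapping.single b i) (poly.coeff p i)))"
      using that by blast
    then obtain i where "m = Poly_Mapping.single b i" by (auto split: if_splits)
    then show ?thesis by (auto split: if_splits)
  qed
  have deg: "degree (map_poly h p) = degree p" by (rule degree_map_poly) (simp add: field_embeddingD[OF h])
  have ev: "mpoly_eval h g (\<lambda>x. x) = poly (map_poly h p) b"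
    unfolding g_def poly_altdef deg
    by (simp add: mpoly_eval_sum[OF h] mpoly_eval_single[OF h] coeff_map_poly field_embeddingD[OF h] monomial_eval_single)
  have "g = 0" using b keys ev p unfolding alg_independent_def by auto
  show "p = 0"
  proof (rule poly_eqI)
    fix n
    have "lookup g (Poly_Mapping.single b n) = (\<Sum>i\<le>degree p. poly.coeff p i when i = n)"
      unfolding g_def by (simp add: lookup_sum lookup_single inj)
    also have "\<dots> = poly.coeff p n" by (cases "n \<le> degree p") (simp_all add: when_def coeff_eq_0)
    finally show "poly.coeff p n = poly.coeff 0 n" using \<open>g = 0\<close> by simp
  qed
qed

text \<open>By maximality of the transcendence basis, \<open>b\<close> and \<open>f\<close> satisfy a
  nontrivial relation. Sorted by powers of \<open>f\<close> its coefficients are polynomials in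
  \<open>b\<close>, and a coefficient polynomial that is not zero does not vanish at \<open>b\<close>, since
  \<open>b\<close> is transcendental.\<close>

lemma algebraic_relation:
  fixes h :: "'k::field \<Rightarrow> 'f::field"
  assumes h: "field_embedding h" and b: "transcendence_basis h {b}"
  shows "\<exists>n k c a. 0 < n \<and> c \<noteq> 0 \<and> c \<in> poly_values h b k \<and> (\<forall>l. a l \<in> poly_values h b k) \<and>
    c * f ^ n = (\<Sum>l<n. a l * f ^ l)"
proof (cases "f = b")
  case True
  have "poly (map_poly h [:0, 1:]) b \<in> poly_values h b 1" by (rule poly_valuesI) simp
  then have "b \<in> poly_values h b 1" by (simp add: map_poly_pCons field_embeddingD[OF h])
  moreover have "1 \<in> poly_values h b 1" using poly_values_const[OF h, of 1 b 1] by (simp add: field_embeddingD[OF h])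
  ultimately show ?thesis using True
    by (intro exI[of _ 1] exI[of _ "1::nat"] exI[of _ "1::'f"] exI[of _ "\<lambda>_. b"]) auto
next
  case False
  have indep: "alg_independent h {b}" and max: "\<And>B'. alg_independent h B' \<Longrightarrow> {b} \<subseteq> B' \<Longrightarrow> B' = {b}"
    using b by (auto simp: transcendence_basis_def)
  have "\<not> alg_independent h {b, f}" using max[of "{b, f}"] False by auto
  then obtain g :: "('f, 'k) mpoly" where g: "\<And>m. m \<in> keys g \<Longrightarrow> keys m \<subseteq> {b, f}"
    "mpoly_eval h g (\<lambda>x. x) = 0" "g \<noteq> 0" unfolding alg_independent_def by auto
  define mono where "mono = (\<lambda>(i, n). Poly_Mapping.single b i + Poly_Mapping.single f n :: 'f \<Rightarrow>\<^sub>0 nat)"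
  have mono_b: "lookup (mono (i, n)) b = i" and mono_f: "lookup (mono (i, n)) f = n" for i n
    using False by (auto simp: mono_def lookup_add lookup_single when_def)
  have mono_eq: "m = mono (lookup m b, lookup m f)" if m: "m \<in> keys g" for m
  proof (rule poly_mapping_eqI)
    fix x show "lookup m x = lookup (mono (lookup m b, lookup m f)) x"
      using g(1)[OF m] False by (cases "x = b"; cases "x = f") (auto simp: mono_def lookup_add lookup_single when_def in_keys_iff)
  qed
  define D where "D = Max ((\<lambda>m. lookup m b + lookup m f) ` keys g)"
  have D: "lookup m b \<le> D" "lookup m f \<le> D" if "m \<in> keys g" for m
  proof -
    have "lookup m b + lookup m f \<le> D"
      unfolding D_def using that by (intro Max_ge) auto
    then show "lookup m b \<le> D" "lookup m f \<le> D" by auto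
  qed
  have keys: "keys g \<subseteq> mono ` ({..D} \<times> {..D})"
  proof
    fix m assume m: "m \<in> keys g"
    show "m \<in> mono ` ({..D} \<times> {..D})"
      by (rule image_eqI[where x = "(lookup m b, lookup m f)"])
        (use mono_eq[OF m] D[OF m] in auto)
  qed
  have inj: "inj_on mono ({..D} \<times> {..D})"
    by (rule inj_onI) (metis mono_b mono_f prod.collapse)
  define q where "q n = (\<Sum>i\<le>D. Polynomial.monom (lookup g (mono (i, n))) i)" for n
  have coeff_q: "poly.coeff (q n) i = (if i \<le> D then lookup g (mono (i, n)) else 0)" for n i
    unfolding q_def by (simp add: coeff_sum)
  have deg_q: "degree (q n) \<le> D" for n by (rule degree_le) (simp add: coeff_q)
  define A where "A n = poly (map_poly h (q n)) b" for n
  have A_in: "A n \<in> poly_values h b D" for n unfolding A_def by (rule poly_valuesI[OF deg_q])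
  have A_0: "A n = 0 \<longleftrightarrow> q n = 0" for n
    using poly_at_transcendental[OF h indep, of "q n"] unfolding A_def by auto
  have A_sum: "A n = (\<Sum>i\<le>D. h (lookup g (mono (i, n))) * b ^ i)" for n
  proof -
    have "A n = (\<Sum>i\<le>D. poly.coeff (map_poly h (q n)) i * b ^ i)"
      unfolding A_def poly_altdef
    proof (rule sum.mono_neutral_left)
      have "degree (map_poly h (q n)) \<le> D"
        using order_trans[OF map_poly_degree_leq deg_q] .
      then show "{..degree (map_poly h (q n))} \<subseteq> {..D}" by auto
    qed (auto simp: coeff_eq_0)
    then show ?thesis by (simp add: coeff_map_poly field_embeddingD[OF h] coeff_q)
  qed
  have rel: "(\<Sum>n\<le>D. A n * f ^ n) = 0"
  proof -
    have "0 = (\<Sum>m\<in>mono ` ({..D} \<times> {..D}). h (lookup g m) * monomial_eval (\<lambda>x. x) m)"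
      using mpoly_eval_superset[OF h _ keys, of "\<lambda>x. x"] g(2) by simp
    also have "\<dots> = (\<Sum>(i, n)\<in>{..D} \<times> {..D}. h (lookup g (mono (i, n))) * (b ^ i * f ^ n))"
      unfolding sum.reindex[OF inj]
      by (rule sum.cong) (auto simp: mono_def monomial_eval_add monomial_eval_single)
    also have "\<dots> = (\<Sum>n\<le>D. \<Sum>i\<le>D. h (lookup g (mono (i, n))) * (b ^ i * f ^ n))"
      by (subst sum.cartesian_product[symmetric], subst sum.swap) simp
    also have "\<dots> = (\<Sum>n\<le>D. A n * f ^ n)"
      unfolding A_sum by (simp add: sum_distrib_right mult.assoc)
    finally show ?thesis by simp
  qed
  (* The highest power of f that really occurs. *)
  define N where "N = Max {n. n \<le> D \<and> A n \<noteq> 0}"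
  have ne: "{n. n \<le> D \<and> A n \<noteq> 0} \<noteq> {}"
  proof -
    have "keys g \<noteq> {}" using g(3) by simp
    then obtain m where m: "m \<in> keys g" by blast
    have "poly.coeff (q (lookup m f)) (lookup m b) \<noteq> 0"
      using coeff_q D[OF m] mono_eq[OF m] m by (simp add: in_keys_iff)
    then have "q (lookup m f) \<noteq> 0" by auto
    then show ?thesis using A_0 D[OF m] by blast
  qed
  have N: "N \<le> D" "A N \<noteq> 0" using Max_in[OF _ ne] unfolding N_def by auto
  have above: "A n = 0" if "N < n" "n \<le> D" for n
  proof (rule ccontr)
    assume "A n \<noteq> 0"
    then have "n \<le> N" unfolding N_def using that by (intro Max_ge) auto
    then show False using that by simp
  qed
  have "(\<Sum>n\<le>D. A n * f ^ n) = (\<Sum>n\<le>N. A n * f ^ n)"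
    using N(1) above by (intro sum.mono_neutral_right) auto
  then have "(\<Sum>n<N. A n * f ^ n) + A N * f ^ N = 0" using rel by (simp add: lessThan_Suc_atMost[symmetric])
  then have eq: "A N * f ^ N = (\<Sum>l<N. - A l * f ^ l)" by (simp add: sum_negf eq_neg_iff_add_eq_0 add.commute)
  have "N \<noteq> 0"
  proof
    assume "N = 0"
    then show False using eq N(2) by simp
  qed
  have neg: "- A l \<in> poly_values h b D" for l
    using poly_values_mult[OF h poly_values_const[OF h, of "-1" b 0] A_in[of l]]
    by (simp add: field_embeddingD[OF h])
  show ?thesis using eq \<open>N \<noteq> 0\<close> N(2) A_in neg
    by (intro exI[of _ N] exI[of _ D] exI[of _ "A N"] exI[of _ "\<lambda>l. - A l"]) auto
qed

text \<open>All values of forms of degree \<open>u\<close>, multiplied by one and the same nonzero element,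
  lie in a box whose size is exponential in \<open>u\<close>. This is where transcendence degree one
  enters.\<close>

lemma form_values_growth:
  fixes h :: "'k::{field,finite} \<Rightarrow> 'f::field" and y :: "'n::finite \<Rightarrow> 'f"
  assumes h: "field_embedding h" and b: "transcendence_basis h {b}"
  shows "\<exists>K. \<forall>u. finite {mpoly_eval h g y | g. is_form u g} \<and> card {mpoly_eval h g y | g. is_form u g} \<le> K ^ Suc u"
proof -
  define good where "good j n k c \<longleftrightarrow> 0 < n \<and> c \<noteq> 0 \<and> c \<in> poly_values h b k \<and>
    (\<exists>a. (\<forall>l. a l \<in> poly_values h b k) \<and> c * y j ^ n = (\<Sum>l<n. a l * y j ^ l))" for j n k c
  have "\<exists>n k c. good j n k c" for j
    using algebraic_relation[OF h b, of "y j"] unfolding good_def by blast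
  then obtain n k c where good: "\<And>j. good j (n j) (k j) (c j)" by metis
  have rel: "0 < n j" "c j \<noteq> 0" "c j \<in> poly_values h b (k j)"
    "\<exists>a. (\<forall>l. a l \<in> poly_values h b (k j)) \<and> c j * y j ^ n j = (\<Sum>l<n j. a l * y j ^ l)" for j
    using good[of j] unfolding good_def by blast+
  define M where "M = Max (range k)"
  have kM: "poly_values h b (k j) \<subseteq> poly_values h b M" for j
    unfolding M_def by (rule poly_values_mono) simp
  interpret power_reduction y "poly_values h b" n c M
  proof
    show "0 \<in> poly_values h b k" "1 \<in> poly_values h b 0" for k
      using poly_values_const[OF h, of 0 b k] poly_values_const[OF h, of 1 b 0] by (simp_all add: field_embeddingD[OF h])
    show "finite (poly_values h b k)" for k by (rule card_poly_values)
    show "\<exists>a. (\<forall>l. a l \<in> poly_values h b M) \<and> c j * y j ^ n j = (\<Sum>l<n j. a l * y j ^ l)" for j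
      using rel(4)[of j] kM[of j] by blast
    show "c j \<in> poly_values h b M" for j using rel(3) kM by blast
  qed (use rel(1) poly_values_add[OF h] poly_values_mult[OF h] poly_values_mono in blast)+
  have denom: "denom \<noteq> 0" unfolding denom_def using rel(2) by simp
  define q where "q = card (UNIV :: 'k set)"
  have q: "0 < q" unfolding q_def by (simp add: finite_UNIV_card_ge_0)
  show ?thesis
  proof (intro exI[of _ "q ^ (Suc slope * card exponents)"] allI)
    fix u
    let ?V = "{mpoly_eval h g y | g. is_form u g}"
    have sub: "(\<lambda>f. denom ^ u * f) ` ?V \<subseteq> box (u * slope)"
      using form_in_box poly_values_const[OF h] by blast
    have inj: "inj_on (\<lambda>f. denom ^ u * f) ?V" using denom by (auto simp: inj_on_def)
    have "card ?V \<le> card (box (u * slope))" by (rule card_inj_on_le[OF inj sub box_finite])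
    also have "\<dots> \<le> (q ^ Suc (u * slope)) ^ card exponents"
      unfolding q_def by (rule order_trans[OF card_box power_mono[OF card_poly_values(2)]]) simp
    also have "\<dots> = q ^ (Suc (u * slope) * card exponents)" by (rule power_mult[symmetric])
    also have "\<dots> \<le> q ^ (Suc slope * card exponents * Suc u)"
      using q by (intro power_increasing) (simp_all add: algebra_simps)
    also have "\<dots> = (q ^ (Suc slope * card exponents)) ^ Suc u" by (rule power_mult)
    finally show "finite ?V \<and> card ?V \<le> (q ^ (Suc slope * card exponents)) ^ Suc u"
      using inj_on_finite[OF inj sub box_finite] by blast
  qed
qed

section \<open>Counting functions with bounded poles\<close>

lemma card_additive_map:
  fixes f :: "'a::ab_group_add \<Rightarrow> 'b::ab_group_add"
  assumes 0: "0 \<in> G" and diff: "\<And>a b. a \<in> G \<Longrightarrow> b \<in> G \<Longrightarrow> a - b \<in> G"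
    and f_diff: "\<And>a b. a \<in> G \<Longrightarrow> b \<in> G \<Longrightarrow> f (a - b) = f a - f b"
    and im: "finite (f ` G)" and ker: "finite {g\<in>G. f g = 0}"
  shows "finite G" and "card G = card (f ` G) * card {g\<in>G. f g = 0}"
proof -
  have add: "a + b \<in> G" if "a \<in> G" "b \<in> G" for a b
    using diff[OF that(1) diff[OF 0 that(2)]] by simp
  have f0: "f 0 = 0" using f_diff[OF 0 0] by simp
  have f_add: "f (a + b) = f a + f b" if "a \<in> G" "b \<in> G" for a b
    using f_diff[OF that(1) diff[OF 0 that(2)]] f_diff[OF 0 that(2)] f0 by simp
  have fibre: "bij_betw (\<lambda>k. a + k) {g\<in>G. f g = 0} {g\<in>G. f g = f a}" if "a \<in> G" for a
    by (rule bij_betwI[where g = "\<lambda>g. g - a"])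
      (use that in \<open>auto simp: add f_add f_diff diff\<close>)
  have G: "G = (\<Union>y\<in>f ` G. {g\<in>G. f g = y})" by auto
  have fin: "finite {g\<in>G. f g = y}" if "y \<in> f ` G" for y
    using that bij_betw_finite[OF fibre] ker by auto
  have crd: "card {g\<in>G. f g = y} = card {g\<in>G. f g = 0}" if "y \<in> f ` G" for y
    using that bij_betw_same_card[OF fibre] by auto
  have "finite (\<Union>y\<in>f ` G. {g\<in>G. f g = y})" using im fin by (rule finite_UN_I)
  then show "finite G" using G by simp
  have "card (\<Union>y\<in>f ` G. {g\<in>G. f g = y}) = (\<Sum>y\<in>f ` G. card {g\<in>G. f g = y})"
    by (rule card_UN_disjoint) (use im fin in auto)
  then have "card G = (\<Sum>y\<in>f ` G. card {g\<in>G. f g = y})" using G by simp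
  also have "\<dots> = card (f ` G) * card {g\<in>G. f g = 0}"
    using crd by simp
  finally show "card G = card (f ` G) * card {g\<in>G. f g = 0}" .
qed

text \<open>What the counting argument needs to know of a curve: its closed points \<open>Pts\<close> with the
  orders \<open>v\<close>, the residue maps \<open>res\<close> (meaningful on functions without a pole at the
  point), local parameters \<open>par\<close>, and for each \<open>u\<close> a finite group \<open>S u\<close>
  of functions, the forms of degree \<open>u\<close> divided by the \<open>u\<close>-th power of a fixed
  coordinate. The number \<open>v p (triv p)\<close> is the order of that coordinate at \<open>p\<close> as a
  form, so multiplication by \<open>triv p ^ u\<close> turns an element of \<open>S u\<close> into a function
  without a pole at \<open>p\<close>. The last assumption says that, for large \<open>u\<close>, elements of
  \<open>S u\<close> that vanish on a given effective divisor \<open>E\<close> have arbitrary leading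
  coefficient at \<open>p\<close>.\<close>

locale projective_curve_places =
  fixes Pts :: "'p set"
    and v :: "'p \<Rightarrow> 'f::field \<Rightarrow> int"
    and res :: "'p \<Rightarrow> 'f \<Rightarrow> 'r::ab_group_add"
    and par :: "'p \<Rightarrow> 'f"
    and S :: "nat \<Rightarrow> 'f set"
    and triv :: "'p \<Rightarrow> 'f"
    and K :: nat
  assumes v_mult: "p \<in> Pts \<Longrightarrow> f \<noteq> 0 \<Longrightarrow> g \<noteq> 0 \<Longrightarrow> v p (f * g) = v p f + v p g"
    and v_diff: "p \<in> Pts \<Longrightarrow> f \<noteq> 0 \<Longrightarrow> g \<noteq> 0 \<Longrightarrow> f \<noteq> g \<Longrightarrow> min (v p f) (v p g) \<le> v p (f - g)"
    and v_par: "p \<in> Pts \<Longrightarrow> par p \<noteq> 0" "p \<in> Pts \<Longrightarrow> v p (par p) = 1"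
    and res_diff: "p \<in> Pts \<Longrightarrow> f = 0 \<or> 0 \<le> v p f \<Longrightarrow> g = 0 \<or> 0 \<le> v p g \<Longrightarrow>
          res p (f - g) = res p f - res p g"
    and res_eq_0: "p \<in> Pts \<Longrightarrow> f = 0 \<or> 0 \<le> v p f \<Longrightarrow> res p f = 0 \<longleftrightarrow> f = 0 \<or> 1 \<le> v p f"
    and finite_res: "p \<in> Pts \<Longrightarrow> finite (res p ` {f. f = 0 \<or> 0 \<le> v p f})"
    and finite_small: "finite {p\<in>Pts. card (res p ` {f. f = 0 \<or> 0 \<le> v p f}) \<le> B}"
    and complete: "f \<noteq> 0 \<Longrightarrow> \<forall>p\<in>Pts. 0 \<le> v p f \<Longrightarrow> p \<in> Pts \<Longrightarrow> v p f = 0"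
    and triv: "p \<in> Pts \<Longrightarrow> triv p \<noteq> 0" "p \<in> Pts \<Longrightarrow> 0 \<le> v p (triv p)"
    and S_regular: "f \<in> S u \<Longrightarrow> f \<noteq> 0 \<Longrightarrow> p \<in> Pts \<Longrightarrow> 0 \<le> v p f + int u * v p (triv p)"
    and S_0: "0 \<in> S u"
    and S_diff: "f \<in> S u \<Longrightarrow> g \<in> S u \<Longrightarrow> f - g \<in> S u"
    and S_mono: "S u \<subseteq> S (Suc u)"
    and S_finite: "finite (S u)"
    and S_growth: "card (S u) \<le> K ^ Suc u"
    and S_frac: "\<exists>d. \<exists>g\<in>S d. \<exists>h\<in>S d. h \<noteq> 0 \<and> f = g / h"
    and S_surj: "p \<in> Pts \<Longrightarrow> set_mset E \<subseteq> Pts \<Longrightarrow> \<exists>u0. \<forall>u\<ge>u0. \<forall>r\<in>res p ` {f. f = 0 \<or> 0 \<le> v p f}.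
          \<exists>g\<in>S u. (\<forall>p'\<in>Pts. g = 0 \<or> int (count E p') \<le> v p' (g * triv p' ^ u)) \<and>
            res p (g * (triv p ^ u * par p powi (- int (count E p)))) = r"
begin

definition ord_ge :: "'p \<Rightarrow> int \<Rightarrow> 'f \<Rightarrow> bool" where
  "ord_ge p n f \<longleftrightarrow> f = 0 \<or> n \<le> v p f"

text \<open>The space \<open>L(D)\<close>. Divisors are arbitrary integer-valued functions here, which allows
  one to speak of \<open>L(uZ)\<close> before \<open>Z\<close> is known to have finite support.\<close>

definition RR :: "('p \<Rightarrow> int) \<Rightarrow> 'f set" where
  "RR D = {f. \<forall>p\<in>Pts. ord_ge p (- D p) f}"

definition point_norm :: "'p \<Rightarrow> nat" where
  "point_norm p = card (res p ` {f. ord_ge p 0 f})"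

text
  \<open>An effective divisor is represented by a multiset of points; its norm is the number of residue classes modulo it.\<close>

definition norm_div :: "'p multiset \<Rightarrow> nat" where
  "norm_div E = prod_mset (image_mset point_norm E)"

lemma v_1: "p \<in> Pts \<Longrightarrow> v p 1 = 0"
  using v_mult[of p 1 1] by simp

lemma v_inverse: "p \<in> Pts \<Longrightarrow> f \<noteq> 0 \<Longrightarrow> v p (inverse f) = - v p f"
  using v_mult[of p f "inverse f"] v_1 by simp

lemma v_divide: "p \<in> Pts \<Longrightarrow> f \<noteq> 0 \<Longrightarrow> g \<noteq> 0 \<Longrightarrow> v p (f / g) = v p f - v p g"
  by (simp add: divide_inverse v_mult v_inverse)

lemma v_power: "p \<in> Pts \<Longrightarrow> f \<noteq> 0 \<Longrightarrow> v p (f ^ n) = int n * v p f"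
  by (induction n) (auto simp: v_1 v_mult algebra_simps)

lemma v_powi: "p \<in> Pts \<Longrightarrow> f \<noteq> 0 \<Longrightarrow> v p (f powi n) = n * v p f"
  by (cases "n \<ge> 0") (auto simp: power_int_def v_power v_inverse)

lemma v_prod: "p \<in> Pts \<Longrightarrow> (\<And>i. i \<in> I \<Longrightarrow> f i \<noteq> 0) \<Longrightarrow> v p (\<Prod>i\<in>I. f i) = (\<Sum>i\<in>I. v p (f i))"
  by (induction I rule: infinite_finite_induct) (auto simp: v_1 v_mult)

lemma ord_ge_diff: "p \<in> Pts \<Longrightarrow> ord_ge p n f \<Longrightarrow> ord_ge p n g \<Longrightarrow> ord_ge p n (f - g)"
  unfolding ord_ge_def
proof -
  assume p: "p \<in> Pts" and f: "f = 0 \<or> n \<le> v p f" and g: "g = 0 \<or> n \<le> v p g"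
  have neg: "v p (- g) = v p g"
  proof (cases "g = 0")
    case False
    have "v p (-1) + v p (-1) = 0" using v_mult[of p "-1" "-1"] p v_1 by simp
    then show ?thesis using v_mult[of p "-1" g] p False by simp
  qed auto
  then show "f - g = 0 \<or> n \<le> v p (f - g)"
    using v_diff[OF p, of f g] f g by (cases "f = 0"; cases "g = 0"; cases "f = g") auto
qed

lemma ord_ge_mult: "p \<in> Pts \<Longrightarrow> g \<noteq> 0 \<Longrightarrow> ord_ge p n (f * g) \<longleftrightarrow> ord_ge p (n - v p g) f"
  by (cases "f = 0") (auto simp: ord_ge_def v_mult)

lemma point_norm_ge_2:
  assumes "p \<in> Pts" shows "2 \<le> point_norm p"
proof -
  have "res p 1 \<noteq> 0" using res_eq_0[of p 1] v_1 assms by simp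
  moreover have "res p 0 = 0" using res_eq_0[of p 0] assms by simp
  ultimately have "card {res p 0, res p 1} = 2" by simp
  moreover have "{res p 0, res p 1} \<subseteq> res p ` {f. ord_ge p 0 f}"
    using v_1 assms by (auto simp: ord_ge_def)
  moreover have "finite (res p ` {f. ord_ge p 0 f})"
    using finite_res assms unfolding ord_ge_def by blast
  ultimately show ?thesis unfolding point_norm_def
    using card_mono[of "res p ` {f. ord_ge p 0 f}" "{res p 0, res p 1}"] by simp
qed

lemma norm_div_add [simp]: "norm_div (add_mset p E) = point_norm p * norm_div E"
  "norm_div {#} = 1" "norm_div (A + B) = norm_div A * norm_div B"
  by (auto simp: norm_div_def)

lemma norm_div_ge:
  "set_mset E \<subseteq> Pts \<Longrightarrow> 2 ^ size E \<le> norm_div E"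
proof (induction E)
  case (add p E)
  then show ?case using point_norm_ge_2[of p] mult_mono[of 2 "point_norm p" "2 ^ size E" "norm_div E"] by simp
qed simp

lemma RR_0 [simp]: "0 \<in> RR D" by (auto simp: RR_def ord_ge_def)

lemma RR_diff: "f \<in> RR D \<Longrightarrow> g \<in> RR D \<Longrightarrow> f - g \<in> RR D"
  by (auto simp: RR_def ord_ge_diff)

lemma RR_mono: "(\<And>p. p \<in> Pts \<Longrightarrow> D p \<le> D' p) \<Longrightarrow> RR D \<subseteq> RR D'"
  unfolding RR_def ord_ge_def by (smt (verit) Collect_mono)

lemma RR_cong: "(\<And>p. p \<in> Pts \<Longrightarrow> D p = D' p) \<Longrightarrow> RR D = RR D'"
  by (auto simp: RR_def)

text \<open>The leading coefficient at \<open>p\<close>, read off after multiplication by a function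
  \<open>t\<close> of the appropriate order, is an additive map whose kernel consists of the functions with
  one more zero at \<open>p\<close>. The function \<open>t\<close> is left arbitrary because powers of
  \<open>par p\<close> serve for the upper bound, products with powers of \<open>triv p\<close> for the lower
  one.\<close>

lemma card_RR_step:
  assumes p: "p \<in> Pts" and G: "0 \<in> G" "\<And>a b. a \<in> G \<Longrightarrow> b \<in> G \<Longrightarrow> a - b \<in> G" "G \<subseteq> RR D"
    and t: "t \<noteq> 0" "v p t = D p"
    and fin: "finite (G \<inter> RR (\<lambda>p'. D p' - (if p' = p then 1 else 0)))"
  shows "finite G"
    and "card G = card ((\<lambda>g. res p (g * t)) ` G) * card (G \<inter> RR (\<lambda>p'. D p' - (if p' = p then 1 else 0)))"
    and "card ((\<lambda>g. res p (g * t)) ` G) \<le> point_norm p"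
proof -
  have int: "ord_ge p 0 (g * t)" if "g \<in> G" for g
  proof -
    have "ord_ge p (- D p) g" using that G(3) p unfolding RR_def by blast
    then show ?thesis using p t by (simp add: ord_ge_mult)
  qed
  have ker: "{g\<in>G. res p (g * t) = 0} = G \<inter> RR (\<lambda>p'. D p' - (if p' = p then 1 else 0))"
  proof -
    have "res p (g * t) = 0 \<longleftrightarrow> ord_ge p (1 - D p) g" if "g \<in> G" for g
    proof -
      have "res p (g * t) = 0 \<longleftrightarrow> ord_ge p 1 (g * t)"
        using res_eq_0[OF p] int[OF that] unfolding ord_ge_def by blast
      then show ?thesis using ord_ge_mult[OF p t(1), of 1 g] t(2) by simp
    qed
    moreover have "g \<in> RR (\<lambda>p'. D p' - (if p' = p then 1 else 0)) \<longleftrightarrow> ord_ge p (1 - D p) g" if "g \<in> G" for g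
    proof -
      have g: "\<forall>p'\<in>Pts. ord_ge p' (- D p') g" using that G(3) unfolding RR_def by blast
      show ?thesis
      proof
        assume "g \<in> RR (\<lambda>p'. D p' - (if p' = p then 1 else 0))"
        then show "ord_ge p (1 - D p) g" using p unfolding RR_def by force
      next
        assume "ord_ge p (1 - D p) g"
        then show "g \<in> RR (\<lambda>p'. D p' - (if p' = p then 1 else 0))"
          using g unfolding RR_def by simp
      qed
    qed
    ultimately show ?thesis by blast
  qed
  have sub: "(\<lambda>g. res p (g * t)) ` G \<subseteq> res p ` {f. ord_ge p 0 f}" using int by blast
  have fin': "finite (res p ` {f. ord_ge p 0 f})" using finite_res p by (simp add: ord_ge_def)
  have d: "res p ((a - b) * t) = res p (a * t) - res p (b * t)" if "a \<in> G" "b \<in> G" for a b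
    using res_diff[OF p] int[OF that(1)] int[OF that(2)]
    unfolding ord_ge_def left_diff_distrib by blast
  note * = card_additive_map[of G "\<lambda>g. res p (g * t)", OF G(1,2) d finite_subset[OF sub fin'],
      unfolded ker, OF _ _ _ _ fin]
  show "finite G" using *(1) by blast
  show "card G = card ((\<lambda>g. res p (g * t)) ` G) *
      card (G \<inter> RR (\<lambda>p'. D p' - (if p' = p then 1 else 0)))"
    using *(2) by blast
  show "card ((\<lambda>g. res p (g * t)) ` G) \<le> point_norm p"
    unfolding point_norm_def using card_mono[OF fin' sub] .
qed

lemma card_RR_le:
  assumes "set_mset E \<subseteq> Pts" "finite (RR (\<lambda>p. D p - int (count E p)))"
  shows "finite (RR D) \<and> card (RR D) \<le> norm_div E * card (RR (\<lambda>p. D p - int (count E p)))"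
  using assms
proof (induction E arbitrary: D)
  case empty
  then show ?case by simp
next
  case (add p E)
  let ?D = "\<lambda>p'. D p' - (if p' = p then 1 else 0)"
  have p: "p \<in> Pts" using add.prems by simp
  have eq: "(\<lambda>p'. D p' - int (count (add_mset p E) p')) = (\<lambda>p'. ?D p' - int (count E p'))"
    by auto
  have IH: "finite (RR ?D)" "card (RR ?D) \<le> norm_div E * card (RR (\<lambda>p'. ?D p' - int (count E p')))"
    using add.IH[of ?D] add.prems unfolding eq by auto
  have inter: "RR D \<inter> RR ?D = RR ?D" using RR_mono[of ?D D] by (simp add: Int_absorb1)
  have t: "par p powi D p \<noteq> 0" "v p (par p powi D p) = D p" using v_par p by (auto simp: v_powi)
  note st = card_RR_step[of p "RR D" D "par p powi D p", OF p RR_0 RR_diff subset_refl t, unfolded inter, OF _ _ IH(1)]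
  have "card (RR D) \<le> point_norm p * card (RR ?D)"
    using st by (simp add: mult_right_mono)
  also have "\<dots> \<le> point_norm p * (norm_div E * card (RR (\<lambda>p'. ?D p' - int (count E p'))))"
    using IH(2) by simp
  finally show ?case using st unfolding eq by (simp add: mult.assoc)
qed

abbreviation Z :: "'p \<Rightarrow> int" where "Z p \<equiv> v p (triv p)"

abbreviation level :: "nat \<Rightarrow> 'f set" where
  "level u \<equiv> RR (\<lambda>p. int u * Z p)"

abbreviation level_minus :: "nat \<Rightarrow> 'p multiset \<Rightarrow> 'f set" where
  "level_minus u E \<equiv> RR (\<lambda>p. int u * Z p - int (count E p))"

lemma S_subset_RR: "S u \<subseteq> level u"
proof
  fix f assume f: "f \<in> S u"
  show "f \<in> level u" unfolding RR_def ord_ge_def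
  proof (rule CollectI, rule ballI)
    fix p assume "p \<in> Pts"
    then show "f = 0 \<or> - (int u * Z p) \<le> v p f" using S_regular[OF f] by force
  qed
qed

text \<open>Vanishing on \<open>E\<close> imposes the full number of conditions on every group between
  \<open>S u\<close> and \<open>L(uZ)\<close>. Both extremes are used: \<open>S u\<close> while
  \<open>L(uZ)\<close> is not yet known to be finite, and \<open>L(uZ)\<close> later.\<close>

definition separates :: "'p multiset \<Rightarrow> nat \<Rightarrow> bool" where
  "separates E u \<longleftrightarrow> (\<forall>G. 0 \<in> G \<longrightarrow> (\<forall>a\<in>G. \<forall>b\<in>G. a - b \<in> G) \<longrightarrow> S u \<subseteq> G \<longrightarrow>
    G \<subseteq> level u \<longrightarrow> finite G \<longrightarrow>
    norm_div E * card (G \<inter> level_minus u E) \<le> card G)"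

lemma separatesD:
  assumes "separates E u" "0 \<in> G" "\<And>a b. a \<in> G \<Longrightarrow> b \<in> G \<Longrightarrow> a - b \<in> G" "S u \<subseteq> G"
    "G \<subseteq> level u" "finite G"
  shows "norm_div E * card (G \<inter> level_minus u E) \<le> card G"
  using assms unfolding separates_def by blast

text \<open>By induction on \<open>E\<close>: by assumption, for large \<open>u\<close>, the elements of
  \<open>S u\<close> that vanish on \<open>E\<close> take all possible leading coefficients at the next point,
  so each further point divides the size by its norm.\<close>

lemma eventually_separates:
  assumes "set_mset E \<subseteq> Pts"
  shows "\<exists>u0. \<forall>u\<ge>u0. separates E u"
  using assms
proof (induction E)
  case empty
  show ?case by (intro exI[of _ 0] allI impI) (simp add: separates_def card_mono)
next
  case (add p E)
  then have p: "p \<in> Pts" and E: "set_mset E \<subseteq> Pts" by auto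
  from add.IH[OF E] obtain u1 where u1: "\<forall>u\<ge>u1. separates E u" by blast
  from S_surj[OF p E] obtain u2 where u2: "\<forall>u\<ge>u2. \<forall>r\<in>res p ` {f. ord_ge p 0 f}.
          \<exists>g\<in>S u. (\<forall>p'\<in>Pts. g = 0 \<or> int (count E p') \<le> v p' (g * triv p' ^ u)) \<and>
            res p (g * (triv p ^ u * par p powi (- int (count E p)))) = r"
    unfolding ord_ge_def by blast
  show ?case
  proof (intro exI[of _ "max u1 u2"] allI impI, unfold separates_def, intro allI impI)
    fix u G assume u: "max u1 u2 \<le> u" and G: "0 \<in> G" "\<forall>a\<in>G. \<forall>b\<in>G. a - b \<in> G" "S u \<subseteq> G"
      "G \<subseteq> level u" "finite G"
    define D where "D = (\<lambda>p. int u * Z p - int (count E p))"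
    define D' where "D' = (\<lambda>p'. D p' - (if p' = p then 1 else 0))"
    have le: "norm_div E * card (G \<inter> RR D) \<le> card G"
      unfolding D_def by (rule separatesD) (use u1 u G in auto)
    define t where "t = triv p ^ u * par p powi (- int (count E p))"
    have t: "t \<noteq> 0" "v p t = D p" unfolding t_def D_def using triv(1)[OF p] v_par[OF p] p
      by (auto simp: v_mult v_powi v_power)
    have sub: "RR D' \<subseteq> RR D" unfolding D'_def by (rule RR_mono) auto
    have GD: "a - b \<in> G \<inter> RR D" if "a \<in> G \<inter> RR D" "b \<in> G \<inter> RR D" for a b
      using that G RR_diff by auto
    have st: "card (G \<inter> RR D) = card ((\<lambda>g. res p (g * t)) ` (G \<inter> RR D)) * card (G \<inter> RR D \<inter> RR D')"
      unfolding D'_def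
      by (rule card_RR_step(2)[of p "G \<inter> RR D" D t, OF p _ GD _ t])
        (use G finite_subset[of "G \<inter> RR D \<inter> RR D'" G] in \<open>auto simp: D'_def[symmetric]\<close>)
    have "res p ` {f. ord_ge p 0 f} \<subseteq> (\<lambda>g. res p (g * t)) ` (G \<inter> RR D)"
    proof
      fix r assume "r \<in> res p ` {f. ord_ge p 0 f}"
      moreover have "u2 \<le> u" using u by simp
      ultimately obtain g where g: "g \<in> S u" "\<forall>p'\<in>Pts. g = 0 \<or> int (count E p') \<le> v p' (g * triv p' ^ u)"
        "res p (g * t) = r" using u2 unfolding t_def ord_ge_def by blast
      have "g \<in> RR D" unfolding RR_def D_def using g(2) triv
        by (cases "g = 0") (simp_all add: ord_ge_def v_mult v_power algebra_simps)
      then show "r \<in> (\<lambda>g. res p (g * t)) ` (G \<inter> RR D)" using g G by auto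
    qed
    then have "point_norm p \<le> card ((\<lambda>g. res p (g * t)) ` (G \<inter> RR D))"
      unfolding point_norm_def using G(5) by (intro card_mono) auto
    then have "point_norm p * card (G \<inter> RR D') \<le> card (G \<inter> RR D)"
      using st sub by (simp add: Int_assoc Int_absorb1 mult_right_mono)
    then have "norm_div (add_mset p E) * card (G \<inter> RR D') \<le> norm_div E * card (G \<inter> RR D)"
      unfolding norm_div_add(1) by (metis mult.commute mult.assoc mult_le_mono2)
    moreover have "(\<lambda>p'. int u * Z p' - int (count (add_mset p E) p')) = D'"
      unfolding D'_def D_def by auto
    ultimately show "norm_div (add_mset p E) * card (G \<inter> level_minus u (add_mset p E)) \<le> card G"
      using le by (simp only: le_trans)
  qed
qed

lemma card_S_pos: "0 < card (S u)"
  using S_0 S_finite by (metis card_gt_0_iff empty_iff)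

text \<open>A part \<open>E\<close> of \<open>Z\<close> of norm greater than \<open>K\<close> would force
  \<open>card (S (u + 1))\<close> to be at least \<open>K + 1\<close> times \<open>card (S u)\<close> for all
  large \<open>u\<close>, because \<open>S u\<close> is contained in the part of \<open>S (u + 1)\<close> that
  vanishes on \<open>E\<close>; this contradicts the growth bound.\<close>

lemma norm_div_le_K:
  assumes E: "set_mset E \<subseteq> Pts" "\<And>p. p \<in> Pts \<Longrightarrow> int (count E p) \<le> Z p"
  shows "norm_div E \<le> K"
proof (rule ccontr)
  assume nK: "\<not> norm_div E \<le> K"
  from eventually_separates[OF E(1)] obtain u0 where u0: "\<forall>u\<ge>u0. separates E u" by blast
  have step: "Suc K * card (S u) \<le> card (S (Suc u))" if "u \<ge> u0" for u
  proof -
    have "S u \<subseteq> S (Suc u) \<inter> level_minus (Suc u) E"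
    proof -
      have "level u \<subseteq> level_minus (Suc u) E"
        by (rule RR_mono) (use E(2) in \<open>simp add: algebra_simps\<close>)
      then show ?thesis using S_mono S_subset_RR[of u] by blast
    qed
    then have "card (S u) \<le> card (S (Suc u) \<inter> level_minus (Suc u) E)"
      by (intro card_mono) (auto simp: S_finite)
    then have "Suc K * card (S u) \<le> norm_div E * card (S (Suc u) \<inter> level_minus (Suc u) E)"
      using nK by (intro mult_mono) auto
    also have "\<dots> \<le> card (S (Suc u))"
      by (rule separatesD[OF _ S_0 S_diff subset_refl S_subset_RR S_finite]) (use u0 that in simp)
    finally show ?thesis .
  qed
  have grow: "Suc K ^ m \<le> card (S (u0 + m))" for m
  proof (induction m)
    case 0
    then show ?case using card_S_pos by (simp add: Suc_leI)
  next
    case (Suc m)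
    have "Suc K ^ Suc m \<le> Suc K * card (S (u0 + m))" using mult_le_mono2[OF Suc, of "Suc K"] by simp
    also have "\<dots> \<le> card (S (u0 + Suc m))" using step[of "u0 + m"] by simp
    finally show ?case .
  qed
  have K1: "K \<ge> 1" using S_growth[of 0] card_S_pos[of 0] by (cases K) auto
  have bd: "Suc K ^ m \<le> K ^ Suc u0 * K ^ m" for m
  proof -
    have "K ^ Suc (u0 + m) = K ^ Suc u0 * K ^ m" by (simp add: power_add)
    then show ?thesis using order_trans[OF grow[of m] S_growth[of "u0 + m"]] by (simp only:)
  qed
  have "((1 + 1 / real K) ^ m) \<le> real (K ^ Suc u0)" for m
  proof -
    have "real (Suc K ^ m) \<le> real (K ^ Suc u0 * K ^ m)" using bd of_nat_mono by blast
    then have le: "real (Suc K) ^ m \<le> real (K ^ Suc u0) * real K ^ m" by (simp only: of_nat_mult of_nat_power)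
    have "1 + 1 / real K = real (Suc K) / real K" using K1 by (simp add: field_simps)
    then have "(1 + 1 / real K) ^ m = real (Suc K) ^ m / real K ^ m"
      by (simp only: power_divide)
    also have "\<dots> \<le> real (K ^ Suc u0)"
      using le K1 by (subst pos_divide_le_eq) simp_all
    finally show ?thesis .
  qed
  (* Powers of 1 + 1/K exceed every bound. *)
  moreover obtain m where "real (K ^ Suc u0) < (1 + 1 / real K) ^ m"
    using real_arch_pow[of "1 + 1 / real K"] K1 by auto
  ultimately show False using not_less by blast
qed

text \<open>Every point contributes a factor of at least \<open>2\<close> to the norm, which is bounded by
  \<open>K\<close>.\<close>

lemma finite_Z: "finite {p\<in>Pts. Z p \<noteq> 0}"
proof (rule ccontr)
  assume "infinite {p\<in>Pts. Z p \<noteq> 0}"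
  then obtain A where A: "finite A" "card A = K" "A \<subseteq> {p\<in>Pts. Z p \<noteq> 0}"
    using infinite_arbitrarily_large by blast
  have "int (count (mset_set A) p) \<le> Z p" if "p \<in> Pts" for p
    using A triv(2)[OF that] that by (cases "p \<in> A") (force simp: count_mset_set)+
  then have "norm_div (mset_set A) \<le> K" using A by (intro norm_div_le_K) auto
  moreover have "2 ^ K \<le> norm_div (mset_set A)" using norm_div_ge[of "mset_set A"] A by auto
  ultimately show False using less_exp[of K] by linarith
qed

lemma multiset_of_fun:
  assumes "finite {p\<in>Pts. e p \<noteq> 0}" "\<And>p. p \<in> Pts \<Longrightarrow> 0 \<le> e p"
  obtains M where "set_mset M \<subseteq> Pts" "\<And>p. p \<in> Pts \<Longrightarrow> int (count M p) = e p"
proof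
  let ?M = "Abs_multiset (\<lambda>p. if p \<in> Pts then nat (e p) else 0)"
  have "{p. 0 < (if p \<in> Pts then nat (e p) else 0)} \<subseteq> {p\<in>Pts. e p \<noteq> 0}" by auto
  then have c: "count ?M = (\<lambda>p. if p \<in> Pts then nat (e p) else 0)"
    using assms(1) finite_subset by (intro count_Abs_multiset) blast
  show "int (count ?M p) = e p" if "p \<in> Pts" for p using assms that by (simp add: c)
  show "set_mset ?M \<subseteq> Pts" by (auto simp: set_mset_def c split: if_splits)
qed

definition Zdiv :: "'p multiset" where
  "Zdiv = (SOME M. set_mset M \<subseteq> Pts \<and> (\<forall>p\<in>Pts. int (count M p) = Z p))"

lemma Zdiv: "set_mset Zdiv \<subseteq> Pts" "p \<in> Pts \<Longrightarrow> int (count Zdiv p) = Z p"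
proof -
  have "\<exists>M. set_mset M \<subseteq> Pts \<and> (\<forall>p\<in>Pts. int (count M p) = Z p)"
    using multiset_of_fun[OF finite_Z triv(2)] by metis
  from someI_ex[OF this] show "set_mset Zdiv \<subseteq> Pts" "p \<in> Pts \<Longrightarrow> int (count Zdiv p) = Z p"
    unfolding Zdiv_def by blast+
qed

text \<open>The only function without poles and with residue \<open>0\<close> at \<open>p\<close> is
  \<open>0\<close>, so \<open>L(0)\<close> embeds into a finite residue field.\<close>

lemma finite_RR_zero:
  assumes p: "p \<in> Pts" shows "finite (RR (\<lambda>_. 0))"
proof (rule card_additive_map(1)[where f = "res p"])
  have reg: "f = 0 \<or> 0 \<le> v p' f" if "f \<in> RR (\<lambda>_. 0)" "p' \<in> Pts" for f p'
    using that unfolding RR_def ord_ge_def by auto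
  show "res p (a - b) = res p a - res p b" if "a \<in> RR (\<lambda>_. 0)" "b \<in> RR (\<lambda>_. 0)" for a b
    using reg that p by (intro res_diff) auto
  have "res p ` RR (\<lambda>_. 0) \<subseteq> res p ` {f. f = 0 \<or> 0 \<le> v p f}" using reg p by blast
  then show "finite (res p ` RR (\<lambda>_. 0))" using finite_res[OF p] finite_subset by blast
  have "g = 0" if g: "g \<in> RR (\<lambda>_. 0)" "res p g = 0" for g
  proof (rule ccontr)
    assume "g \<noteq> 0"
    then have "v p g = 0" using complete[of g p] reg[OF g(1)] p by auto
    then show False using res_eq_0[OF p reg[OF g(1) p]] g(2) \<open>g \<noteq> 0\<close> by simp
  qed
  then have "{g \<in> RR (\<lambda>_. 0). res p g = 0} \<subseteq> {0}" by blast
  then show "finite {g \<in> RR (\<lambda>_. 0). res p g = 0}" using finite_subset by blast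
qed (auto simp: RR_diff)

lemma finite_RR:
  assumes p: "p \<in> Pts" and D: "finite {p\<in>Pts. 0 < D p}"
  shows "finite (RR D)"
proof -
  have "{p\<in>Pts. max 0 (D p) \<noteq> 0} \<subseteq> {p\<in>Pts. 0 < D p}" by auto
  then have fin: "finite {p\<in>Pts. max 0 (D p) \<noteq> 0}" using D by (rule finite_subset)
  obtain M where M: "set_mset M \<subseteq> Pts" "\<And>p. p \<in> Pts \<Longrightarrow> int (count M p) = max 0 (D p)"
    using multiset_of_fun[OF fin max.cobounded1] by blast
  have "RR (\<lambda>p. D p - int (count M p)) \<subseteq> RR (\<lambda>_. 0)"
    by (rule RR_mono) (simp add: M(2))
  then show ?thesis using card_RR_le[OF M(1)] finite_RR_zero[OF p] finite_subset by blast
qed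

lemma finite_level: "p \<in> Pts \<Longrightarrow> finite (level u)"
  by (rule finite_RR, assumption, rule finite_subset[OF _ finite_Z]) auto

lemma card_RR_pos: "finite (RR D) \<Longrightarrow> 0 < card (RR D)"
  by (metis RR_0 card_gt_0_iff empty_iff)

lemma norm_div_pos: "set_mset E \<subseteq> Pts \<Longrightarrow> 0 < norm_div E"
  using norm_div_ge[of E] by (metis less_le_trans zero_less_numeral zero_less_power)

lemma norm_div_replicate [simp]: "norm_div (replicate_mset n p) = point_norm p ^ n"
  by (induction n) auto

lemma level_Suc_minus_Zdiv: "level_minus (Suc u) Zdiv = level u"
  by (rule RR_cong) (simp add: Zdiv(2) algebra_simps)

text \<open>Passing from \<open>uZ\<close> to \<open>(u + 1)Z\<close> multiplies the size by at most the norm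
  of \<open>Z\<close>, for every \<open>u\<close>, and by at least this norm as soon as
  \<open>S (u + 1)\<close> separates \<open>Z\<close>.\<close>

lemma Hilbert_function:
  assumes p: "p \<in> Pts"
  shows "\<exists>u0. \<forall>u\<ge>u0. \<forall>d. card (level (u + d)) = norm_div Zdiv ^ d * card (level u)"
proof -
  obtain u0 where u0: "\<forall>u\<ge>u0. separates Zdiv u" using eventually_separates[OF Zdiv(1)] by blast
  have step: "card (level (Suc u)) = norm_div Zdiv * card (level u)" if "u0 \<le> u" for u
  proof (rule antisym)
    show "card (level (Suc u)) \<le> norm_div Zdiv * card (level u)"
      using card_RR_le[OF Zdiv(1), of "\<lambda>p. int (Suc u) * Z p"] finite_level[OF p]
      unfolding level_Suc_minus_Zdiv by blast
    have "level u \<subseteq> level (Suc u)"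
      by (rule RR_mono) (use triv(2) in \<open>simp add: algebra_simps\<close>)
    moreover have "norm_div Zdiv * card (level (Suc u) \<inter> level_minus (Suc u) Zdiv)
        \<le> card (level (Suc u))"
      by (rule separatesD[OF _ RR_0 RR_diff S_subset_RR subset_refl finite_level[OF p]])
        (use u0 that in simp)
    ultimately show "norm_div Zdiv * card (level u) \<le> card (level (Suc u))"
      unfolding level_Suc_minus_Zdiv by (simp add: Int_absorb1)
  qed
  show ?thesis
  proof (intro exI[of _ u0] allI impI)
    fix u d assume "u0 \<le> u"
    then show "card (level (u + d)) = norm_div Zdiv ^ d * card (level u)"
    proof (induction d)
      case (Suc d)
      then show ?case using step[of "u + d"] by simp
    qed simp
  qed
qed

text \<open>Bezout's inequality: multiplication by \<open>h\<close> embeds \<open>L(uZ)\<close> into the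
  elements of \<open>L((u + d)Z)\<close> that vanish on \<open>E\<close>, and by the Hilbert function the two
  ambient sizes have quotient \<open>norm_div Zdiv ^ d\<close>.\<close>

lemma norm_zero_divisor_le:
  assumes p: "p \<in> Pts" and h: "h \<noteq> 0" and E: "set_mset E \<subseteq> Pts"
    and le: "\<And>p. p \<in> Pts \<Longrightarrow> int (count E p) \<le> v p h + int d * Z p"
  shows "norm_div E \<le> norm_div Zdiv ^ d"
proof -
  obtain u0 where "\<forall>u\<ge>u0. \<forall>d. card (level (u + d)) = norm_div Zdiv ^ d * card (level u)"
    using Hilbert_function[OF p] by blast
  note u0 = this[rule_format]
  obtain u1 where u1: "\<forall>u\<ge>u1. separates E u" using eventually_separates[OF E] by blast
  define u where "u = max u0 u1"
  let ?R = "level_minus (u + d) E"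
  have sub: "(\<lambda>g. h * g) ` level u \<subseteq> level (u + d) \<inter> ?R"
  proof -
    have "h * g \<in> ?R" if "g \<in> level u" for g
      unfolding RR_def
    proof (rule CollectI, rule ballI)
      fix p assume p: "p \<in> Pts"
      then have "ord_ge p (- (int u * Z p)) g" using that unfolding RR_def by blast
      then show "ord_ge p (- (int (u + d) * Z p - int (count E p))) (h * g)"
        using le[OF p] v_mult[OF p h, of g] unfolding ord_ge_def by (auto simp: algebra_simps)
    qed
    moreover have "?R \<subseteq> level (u + d)" by (rule RR_mono) simp
    ultimately show ?thesis by blast
  qed
  have "card (level u) = card ((\<lambda>g. h * g) ` level u)"
    using h by (intro card_image[symmetric]) (simp add: inj_on_def)
  also have "\<dots> \<le> card (level (u + d) \<inter> ?R)"
    by (rule card_mono[OF finite_subset[OF Int_lower1 finite_level[OF p]] sub])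
  finally have "norm_div E * card (level u) \<le> norm_div E * card (level (u + d) \<inter> ?R)" by simp
  also have "\<dots> \<le> card (level (u + d))"
    by (rule separatesD[OF _ RR_0 RR_diff S_subset_RR subset_refl finite_level[OF p]])
      (use u1 in \<open>simp add: u_def\<close>)
  also have "\<dots> = norm_div Zdiv ^ d * card (level u)" by (rule u0) (simp add: u_def)
  finally show ?thesis using card_RR_pos[OF finite_level[OF p]] by simp
qed

text \<open>A function is a quotient of two elements of \<open>S d\<close>, and the norm of the zeros of such
  an element is bounded.\<close>

lemma finite_support:
  assumes f: "f \<noteq> 0" shows "finite {p\<in>Pts. v p f \<noteq> 0}"
proof -
  have S: "finite {p\<in>Pts. v p h + int d * Z p \<noteq> 0}" if h: "h \<in> S d" "h \<noteq> 0" for h d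
  proof (rule ccontr)
    assume "infinite {p\<in>Pts. v p h + int d * Z p \<noteq> 0}"
    then obtain A where A: "finite A" "card A = Suc (norm_div Zdiv ^ d)"
      "A \<subseteq> {p\<in>Pts. v p h + int d * Z p \<noteq> 0}"
      using infinite_arbitrarily_large by blast
    have "norm_div (mset_set A) \<le> norm_div Zdiv ^ d"
    proof -
      obtain p where p: "p \<in> A" using A by fastforce
      show ?thesis
      proof (rule norm_zero_divisor_le[of p])
        show "int (count (mset_set A) p) \<le> v p h + int d * Z p" if "p \<in> Pts" for p
          using A(1,3) S_regular[OF h that] that by (cases "p \<in> A") fastforce+
      qed (use p A h in auto)
    qed
    moreover have "2 ^ Suc (norm_div Zdiv ^ d) \<le> norm_div (mset_set A)"
      using norm_div_ge[of "mset_set A"] A by auto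
    ultimately show False using less_exp[of "Suc (norm_div Zdiv ^ d)"] by linarith
  qed
  obtain d g h where gh: "g \<in> S d" "h \<in> S d" "h \<noteq> 0" "f = g / h" using S_frac by blast
  then have g: "g \<noteq> 0" using f by auto
  have "{p\<in>Pts. v p f \<noteq> 0} \<subseteq> {p\<in>Pts. v p g + int d * Z p \<noteq> 0} \<union> {p\<in>Pts. v p h + int d * Z p \<noteq> 0}"
    using gh g by (auto simp: v_divide)
  then show ?thesis using S gh g finite_subset by blast
qed

text \<open>If \<open>Z\<close> were trivial, \<open>L(uZ)\<close> would have eventually constant size, but it
  separates arbitrarily high multiples of \<open>p\<close>.\<close>

lemma norm_Zdiv_ge_2:
  assumes p: "p \<in> Pts" shows "2 \<le> norm_div Zdiv"
proof (rule ccontr)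
  assume "\<not> 2 \<le> norm_div Zdiv"
  then have 1: "norm_div Zdiv = 1" using norm_div_pos[OF Zdiv(1)] by linarith
  obtain u0 where "\<forall>u\<ge>u0. \<forall>d. card (level (u + d)) = norm_div Zdiv ^ d * card (level u)"
    using Hilbert_function[OF p] by blast
  note u0 = this[rule_format]
  define E where "E = replicate_mset (card (level u0)) p"
  have E: "set_mset E \<subseteq> Pts" using p by (auto simp: E_def)
  obtain u1 where u1: "\<forall>u\<ge>u1. separates E u" using eventually_separates[OF E] by blast
  let ?R = "level (u0 + u1) \<inter> level_minus (u0 + u1) E"
  have "norm_div E * card ?R \<le> card (level (u0 + u1))"
    by (rule separatesD[OF _ RR_0 RR_diff S_subset_RR subset_refl finite_level[OF p]])
      (use u1 in simp)
  also have "\<dots> = card (level u0)" using u0[of u0 u1] 1 by simp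
  finally have "norm_div E * card ?R \<le> card (level u0)" .
  moreover have "1 \<le> card ?R"
  proof -
    have "finite ?R" by (rule finite_subset[OF Int_lower1 finite_level[OF p]])
    then have "0 < card ?R" using RR_0 by (metis IntI card_gt_0_iff empty_iff)
    then show ?thesis by linarith
  qed
  ultimately have "norm_div E \<le> card (level u0)"
    using mult_le_mono2[of 1 "card ?R" "norm_div E"] by linarith
  moreover have "2 ^ card (level u0) \<le> norm_div E" using norm_div_ge[OF E] by (simp add: E_def)
  ultimately show False using less_exp[of "card (level u0)"] by linarith
qed

text \<open>Vanishing at \<open>p\<close> to order \<open>r\<close> imposes at most \<open>r\<close>
  conditions over the residue field of \<open>p\<close>, and \<open>r\<close> is the largest number for which
  they cannot exhaust \<open>L(dZ)\<close>.\<close>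

lemma large_order_section:
  assumes p: "p \<in> Pts" and c: "2 \<le> card (level d)"
  obtains h r where "h \<noteq> 0" "h \<in> RR (\<lambda>p'. int d * Z p' - (if p' = p then int r else 0))"
    "card (level d) \<le> point_norm p ^ Suc r"
proof -
  let ?P = "\<lambda>r. card (level d) \<le> point_norm p ^ Suc r"
  have "card (level d) \<le> point_norm p ^ Suc (card (level d))"
    using point_norm_ge_2[OF p] power_mono[of 2 "point_norm p" "Suc (card (level d))"] less_exp[of "Suc (card (level d))"]
    by linarith
  then have ex: "?P (LEAST r. ?P r)" by (rule LeastI)
  define r where "r = (LEAST r. ?P r)"
  have lt: "point_norm p ^ r < card (level d)"
  proof (cases r)
    case 0
    then show ?thesis using c by simp
  next
    case (Suc r')
    then have "\<not> ?P r'" using not_less_Least[of r' ?P] unfolding r_def by simp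
    then show ?thesis using Suc by simp
  qed
  let ?R = "RR (\<lambda>p'. int d * Z p' - (if p' = p then int r else 0))"
  have E: "set_mset (replicate_mset r p) \<subseteq> Pts" using p by (auto split: if_splits)
  have eq: "level_minus d (replicate_mset r p) = ?R"
    by (rule RR_cong) simp
  have "?R \<subseteq> level d" by (rule RR_mono) simp
  then have fin: "finite ?R" using finite_level[OF p] finite_subset by blast
  have "card (level d) \<le> point_norm p ^ r * card ?R"
    using card_RR_le[OF E, of "\<lambda>p'. int d * Z p'"] fin unfolding eq by simp
  with lt have "card ?R \<noteq> 1" by auto
  then have "?R \<noteq> {0}" by auto
  then obtain h where "h \<in> ?R" "h \<noteq> 0" using RR_0 by blast
  then show ?thesis using that ex unfolding r_def by blast
qed

text \<open>The elements \<open>h d\<close> of \<open>L(dZ)\<close> with a zero of maximal order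
  \<open>r d\<close> at \<open>p\<close> have residual zero divisors \<open>e d\<close> of norm bounded
  independently of \<open>d\<close>. Only finitely many points and multiplicities satisfy this bound, so two
  of the residual divisors agree.\<close>

lemma section_with_one_zero:
  assumes p: "p \<in> Pts"
  obtains y e r where "y \<noteq> 0" "0 < e" "0 < r"
    "\<And>p'. p' \<in> Pts \<Longrightarrow> v p' y = (if p' = p then int r else 0) - int e * Z p'"
proof -
  obtain u0 where "\<forall>u\<ge>u0. \<forall>d. card (level (u + d)) = norm_div Zdiv ^ d * card (level u)"
    using Hilbert_function[OF p] by blast
  note u0 = this[rule_format]
  (* The bound on the norm of the residual zero divisors. *)
  define B where "B = point_norm p * norm_div Zdiv ^ u0"
  have pos: "0 < card (level u)" for u using card_RR_pos[OF finite_level[OF p]] .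
  have big: "2 ^ (d - u0) \<le> card (level d)" if "u0 \<le> d" for d
  proof -
    have "2 ^ (d - u0) \<le> norm_div Zdiv ^ (d - u0) * card (level u0)"
      using mult_mono[OF power_mono[OF norm_Zdiv_ge_2[OF p], of "d - u0"], of 1 "card (level u0)"] pos[of u0]
      by simp
    then show ?thesis using u0[of u0 "d - u0"] that by simp
  qed
  define good where "good d h r \<longleftrightarrow> h \<noteq> 0 \<and>
      h \<in> RR (\<lambda>p'. int d * Z p' - (if p' = p then int r else 0)) \<and> card (level d) \<le> point_norm p ^ Suc r" for d h r
  have "\<exists>h r. good d h r" if "u0 < d" for d
  proof -
    have "2 \<le> (2::nat) ^ (d - u0)" using that power_increasing[of 1 "d - u0" "2::nat"] by simp
    then have "2 \<le> card (level d)" using big[of d] that by simp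
    then obtain h r where "h \<noteq> 0" "h \<in> RR (\<lambda>p'. int d * Z p' - (if p' = p then int r else 0))"
      "card (level d) \<le> point_norm p ^ Suc r" by (rule large_order_section[OF p])
    then show ?thesis unfolding good_def by blast
  qed
  then obtain h r where good: "\<And>d. u0 < d \<Longrightarrow> good d (h d) (r d)" by metis
  have hr: "h d \<noteq> 0" "h d \<in> RR (\<lambda>p'. int d * Z p' - (if p' = p then int (r d) else 0))"
    "card (level d) \<le> point_norm p ^ Suc (r d)" if "u0 < d" for d
    using good[OF that] unfolding good_def by blast+
  define e where "e d p' = (if p' \<in> Pts then
      nat (v p' (h d) + int d * Z p' - (if p' = p then int (r d) else 0)) else 0)" for d p'
  have e_eq: "int (e d p') = v p' (h d) + int d * Z p' - (if p' = p then int (r d) else 0)"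
    if "u0 < d" "p' \<in> Pts" for d p'
  proof -
    have "ord_ge p' (- (int d * Z p' - (if p' = p then int (r d) else 0))) (h d)"
      using hr(2)[OF that(1)] that(2) unfolding RR_def by blast
    then show ?thesis using hr(1) that unfolding ord_ge_def e_def by auto
  qed
  have e_bound: "point_norm p' ^ e d p' \<le> B" if d: "u0 < d" and p': "p' \<in> Pts" for d p'
  proof -
    let ?E = "replicate_mset (e d p') p' + replicate_mset (r d) p"
    have "norm_div ?E \<le> norm_div Zdiv ^ d"
    proof (rule norm_zero_divisor_le[OF p hr(1)[OF d]])
      show "set_mset ?E \<subseteq> Pts" using p p' by (auto split: if_splits)
      show "int (count ?E q) \<le> v q (h d) + int d * Z q" if "q \<in> Pts" for q
        using e_eq[OF d that] by auto
    qed
    then have "point_norm p' ^ e d p' * point_norm p ^ r d \<le> norm_div Zdiv ^ d" by simp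
    then have ab: "point_norm p' ^ e d p' * point_norm p ^ r d \<le> norm_div Zdiv ^ (d - u0) * norm_div Zdiv ^ u0"
      using d by (simp flip: power_add)
    have "card (level d) = norm_div Zdiv ^ (d - u0) * card (level u0)"
      using u0[of u0 "d - u0"] d by simp
    then have "norm_div Zdiv ^ (d - u0) * (point_norm p' ^ e d p' * card (level u0)) = point_norm p' ^ e d p' * card (level d)"
      by (simp only: mult_ac)
    also have "\<dots> \<le> point_norm p' ^ e d p' * (point_norm p * point_norm p ^ r d)"
      using hr(3)[OF d] by (intro mult_le_mono2) simp
    also have "\<dots> = point_norm p * (point_norm p' ^ e d p' * point_norm p ^ r d)" by (simp only: mult_ac)
    also have "\<dots> \<le> point_norm p * (norm_div Zdiv ^ (d - u0) * norm_div Zdiv ^ u0)"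
      using ab by (rule mult_le_mono2)
    also have "\<dots> = norm_div Zdiv ^ (d - u0) * B" unfolding B_def by (simp only: mult_ac)
    finally have "norm_div Zdiv ^ (d - u0) * (point_norm p' ^ e d p' * card (level u0)) \<le> norm_div Zdiv ^ (d - u0) * B" .
    then have "point_norm p' ^ e d p' * card (level u0) \<le> B" using norm_div_pos[OF Zdiv(1)] by simp
    moreover have "point_norm p' ^ e d p' * 1 \<le> point_norm p' ^ e d p' * card (level u0)"
      using pos[of u0] by (intro mult_le_mono2) simp
    ultimately show ?thesis by linarith
  qed
  let ?small = "{p\<in>Pts. point_norm p \<le> B}"
  have "e ` {d. u0 < d} \<subseteq> {f. \<forall>x. (x \<in> ?small \<longrightarrow> f x \<in> {..B}) \<and> (x \<notin> ?small \<longrightarrow> f x = 0)}"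
  proof clarify
    fix d p' assume d: "u0 < d"
    have "e d p' \<le> B \<and> (point_norm p' \<le> B \<or> e d p' = 0)" if p': "p' \<in> Pts"
    proof -
      have "e d p' < point_norm p' ^ e d p'"
        using less_le_trans[OF less_exp power_mono[OF point_norm_ge_2[OF p']]] by simp
      moreover have "point_norm p' \<le> point_norm p' ^ e d p'" if "e d p' \<noteq> 0"
        using self_le_power[of "point_norm p'" "e d p'"] point_norm_ge_2[OF p'] that by simp
      ultimately show ?thesis using e_bound[OF d p'] by fastforce
    qed
    then show "(p' \<in> ?small \<longrightarrow> e d p' \<in> {..B}) \<and> (p' \<notin> ?small \<longrightarrow> e d p' = 0)"
      by (cases "p' \<in> Pts") (auto simp: e_def)
  qed
  moreover have "finite {f. \<forall>x. (x \<in> ?small \<longrightarrow> f x \<in> {..B}) \<and> (x \<notin> ?small \<longrightarrow> f x = (0::nat))}"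
    by (rule finite_set_of_finite_funs)
      (use finite_small[of B] in \<open>simp_all add: point_norm_def ord_ge_def\<close>)
  ultimately have "finite (e ` {d. u0 < d})" using finite_subset by blast
  moreover have "infinite {d::nat. u0 < d}" by (simp add: infinite_Ioi flip: greaterThan_def)
  ultimately obtain a where a: "u0 < a" "infinite {d \<in> {d. u0 < d}. e d = e a}"
    using pigeonhole_infinite[of "{d. u0 < d}" e] by auto
  (* The class of a is infinite, so it contains some d with r d > r a. *)
  then obtain d where d: "max a (u0 + point_norm p ^ Suc (r a)) < d" "u0 < d" "e d = e a"
    unfolding infinite_nat_iff_unbounded by blast
  have "r a < r d"
  proof (rule ccontr)
    assume "\<not> r a < r d"
    then have "point_norm p ^ Suc (r d) \<le> point_norm p ^ Suc (r a)"
      using point_norm_ge_2[OF p] by (intro power_increasing) auto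
    then have "2 ^ (d - u0) \<le> point_norm p ^ Suc (r a)" using big[of d] hr(3)[OF d(2)] d(2) by linarith
    then show False using less_exp[of "d - u0"] d(1) unfolding max_less_iff_conj by linarith
  qed
  show ?thesis
  proof (rule that[of "h d / h a" "d - a" "r d - r a"])
    show "h d / h a \<noteq> 0" "0 < d - a" "0 < r d - r a"
      using hr(1) a(1) d \<open>r a < r d\<close> by auto
    fix p' assume p': "p' \<in> Pts"
    have "v p' (h d / h a) = v p' (h d) - v p' (h a)"
      by (rule v_divide) (use hr(1) a(1) d(2) p' in auto)
    also have "\<dots> = (if p' = p then int (r d) - int (r a) else 0) - (int d - int a) * Z p'"
      using e_eq[OF d(2) p'] e_eq[OF a(1) p'] d(3) by (auto simp: algebra_simps)
    finally show "v p' (h d / h a) = (if p' = p then int (r d - r a) else 0) - int (d - a) * Z p'"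
      using \<open>r a < r d\<close> d(1) by (auto simp: of_nat_diff)
  qed
qed

text \<open>Suitable powers of the functions with divisors \<open>rp - eZ\<close> and \<open>r'q - e'Z\<close>
  have a quotient in which \<open>Z\<close> cancels.\<close>

lemma function_with_one_zero_one_pole:
  assumes p: "p \<in> Pts" and q: "q \<in> Pts" and pq: "p \<noteq> q"
  obtains y where "y \<noteq> 0" "0 < v p y" "\<And>p'. p' \<in> Pts \<Longrightarrow> p' \<noteq> p \<Longrightarrow> p' \<noteq> q \<Longrightarrow> v p' y = 0"
proof -
  obtain y e r where y: "y \<noteq> 0" "0 < e" "0 < r"
    "\<And>p'. p' \<in> Pts \<Longrightarrow> v p' y = (if p' = p then int r else 0) - int e * Z p'"
    using section_with_one_zero[OF p] by blast
  obtain z e' r' where z: "z \<noteq> 0" "0 < e'" "0 < r'"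
    "\<And>p'. p' \<in> Pts \<Longrightarrow> v p' z = (if p' = q then int r' else 0) - int e' * Z p'"
    using section_with_one_zero[OF q] by blast
  have eq: "v p' (y ^ e' / z ^ e) = (if p' = p then int (e' * r) else 0) - (if p' = q then int (e * r') else 0)"
    if "p' \<in> Pts" for p'
  proof -
    have "v p' (y ^ e' / z ^ e) = int e' * v p' y - int e * v p' z"
      using that y(1) z(1) by (simp add: v_divide v_power)
    also have "\<dots> = (if p' = p then int (e' * r) else 0) - (if p' = q then int (e * r') else 0)"
      unfolding y(4)[OF that] z(4)[OF that]
      by (cases "p' = p"; cases "p' = q") (simp_all add: algebra_simps)
    finally show ?thesis .
  qed
  show ?thesis
    by (rule that[of "y ^ e' / z ^ e"]) (use eq p q pq y z in auto)
qed

text \<open>A product of powers of functions with a single zero each; all their poles are at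
  \<open>q\<close>.\<close>

lemma function_with_prescribed_zeros:
  assumes q: "q \<in> Pts" and A: "finite A" "A \<subseteq> Pts - {q}"
  obtains y where "y \<noteq> 0" "\<And>p. p \<in> A \<Longrightarrow> int (M p) \<le> v p y"
    "\<And>p. p \<in> Pts \<Longrightarrow> p \<notin> A \<Longrightarrow> p \<noteq> q \<Longrightarrow> v p y = 0"
proof -
  have "\<exists>y. y \<noteq> 0 \<and> 0 < v p y \<and> (\<forall>p'\<in>Pts. p' \<noteq> p \<longrightarrow> p' \<noteq> q \<longrightarrow> v p' y = 0)" if "p \<in> A" for p
    using function_with_one_zero_one_pole[of p q] that A q by (metis Diff_iff insertI1 subset_iff)
  then obtain y where y: "\<And>p. p \<in> A \<Longrightarrow> y p \<noteq> 0" "\<And>p. p \<in> A \<Longrightarrow> 0 < v p (y p)"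
    "\<And>p p'. p \<in> A \<Longrightarrow> p' \<in> Pts \<Longrightarrow> p' \<noteq> p \<Longrightarrow> p' \<noteq> q \<Longrightarrow> v p' (y p) = 0" by metis
  define Y where "Y = (\<Prod>p\<in>A. y p ^ M p)"
  have Y: "v p Y = (\<Sum>p'\<in>A. int (M p') * v p (y p'))" if "p \<in> Pts" for p
    unfolding Y_def by (subst v_prod) (use that y(1) in \<open>auto simp: v_power\<close>)
  show ?thesis
  proof (rule that[of Y])
    show "Y \<noteq> 0" unfolding Y_def using y(1) A(1) by simp
    fix p assume p: "p \<in> A"
    have "(\<Sum>p'\<in>A. int (M p') * v p (y p')) = (\<Sum>p'\<in>{p}. int (M p') * v p (y p'))"
      using p A y(3) by (intro sum.mono_neutral_right) auto
    moreover have "int (M p) * 1 \<le> int (M p) * v p (y p)"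
      using y(2)[OF p] by (intro mult_left_mono) auto
    ultimately show "int (M p) \<le> v p Y" using Y p A by auto
  next
    fix p assume p: "p \<in> Pts" "p \<notin> A" "p \<noteq> q"
    have "v p (y x) = 0" if "x \<in> A" for x using y(3)[OF that p(1) _ p(3)] that p(2) by blast
    then show "v p Y = 0" using Y[OF p(1)] by simp
  qed
qed

text \<open>Multiplication by a function \<open>Y\<close> with sufficient zeros at the points where
  \<open>D\<close> is positive and no poles outside \<open>q\<close> removes all poles of \<open>f\<close>
  outside \<open>q\<close>. If the zero of \<open>f\<close> at \<open>q\<close> outweighs the pole of
  \<open>Y\<close>, the product has a zero and no pole.\<close>

lemma RR_eventually_zero:
  assumes q: "q \<in> Pts" and D: "finite {p\<in>Pts. D p \<noteq> 0}"
  obtains j0 where "\<And>j. j \<le> j0 \<Longrightarrow> RR (\<lambda>p. D p + (if p = q then j else 0)) = {0}"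
proof -
  define A where "A = {p\<in>Pts. 0 < D p} - {q}"
  have A: "finite A" "A \<subseteq> Pts - {q}"
  proof -
    have "A \<subseteq> {p\<in>Pts. D p \<noteq> 0}" unfolding A_def by auto
    then show "finite A" using D by (rule finite_subset)
    show "A \<subseteq> Pts - {q}" unfolding A_def by blast
  qed
  obtain Y where Y: "Y \<noteq> 0" "\<And>p. p \<in> A \<Longrightarrow> int (nat (D p)) \<le> v p Y"
    "\<And>p. p \<in> Pts \<Longrightarrow> p \<notin> A \<Longrightarrow> p \<noteq> q \<Longrightarrow> v p Y = 0"
    using function_with_prescribed_zeros[OF q A, of "\<lambda>p. nat (D p)"] by blast
  show ?thesis
  proof (rule that[of "v q Y - D q - 1"])
    fix j assume j: "j \<le> v q Y - D q - 1"
    have "f = 0" if f: "f \<in> RR (\<lambda>p. D p + (if p = q then j else 0))" for f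
    proof (rule ccontr)
      assume f0: "f \<noteq> 0"
      have ord: "- (D p + (if p = q then j else 0)) \<le> v p f" if "p \<in> Pts" for p
        using f f0 that unfolding RR_def ord_ge_def by blast
      have vq: "1 \<le> v q (f * Y)" using ord[OF q] j Y(1) f0 q by (simp add: v_mult)
      have "0 \<le> v p (f * Y)" if "p \<in> Pts" for p
      proof (cases "p = q")
        case False
        then show ?thesis using ord[OF that] Y(2)[of p] Y(3)[of p] f0 Y(1) that
          by (cases "p \<in> A") (auto simp: v_mult A_def)
      qed (use vq in simp)
      then have "v q (f * Y) = 0" using complete[of "f * Y" q] f0 Y(1) q by auto
      then show False using vq by simp
    qed
    then show "RR (\<lambda>p. D p + (if p = q then j else 0)) = {0}" using RR_0 by blast
  qed
qed

text \<open>A power of a local parameter has the right order at \<open>p\<close>. Its finitely many excess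
  poles are cancelled by a function that has neither a zero nor a pole at \<open>p\<close> and whose only
  poles are at \<open>q\<close>.\<close>

lemma exact_pole_order:
  assumes p: "p \<in> Pts" and q: "q \<in> Pts" and pq: "p \<noteq> q" and D: "finite {p\<in>Pts. D p \<noteq> 0}"
  obtains f j where "f \<in> RR (\<lambda>p. D p + (if p = q then j else 0))" "f \<noteq> 0" "v p f = - D p"
proof -
  define s where "s = par p powi (- D p)"
  have s: "s \<noteq> 0" "v p s = - D p" unfolding s_def using v_par p by (auto simp: v_powi)
  define A where "A = {p'\<in>Pts. v p' s < - D p'} - {p, q}"
  have "A \<subseteq> {p\<in>Pts. D p \<noteq> 0} \<union> {p\<in>Pts. v p s \<noteq> 0}" unfolding A_def by auto
  then have A: "finite A" "A \<subseteq> Pts - {q}"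
    using finite_subset finite_support[OF s(1)] D unfolding A_def by blast+
  obtain Y where Y: "Y \<noteq> 0" "\<And>p'. p' \<in> A \<Longrightarrow> int (nat (- D p' - v p' s)) \<le> v p' Y"
    "\<And>p. p \<in> Pts \<Longrightarrow> p \<notin> A \<Longrightarrow> p \<noteq> q \<Longrightarrow> v p Y = 0"
    using function_with_prescribed_zeros[OF q A, of "\<lambda>p'. nat (- D p' - v p' s)"] by blast
  show ?thesis
  proof (rule that[of "s * Y" "- D q - v q (s * Y)"])
    show "s * Y \<noteq> 0" using s Y by simp
    have "v p Y = 0" using Y(3)[OF p] pq by (simp add: A_def)
    then show vp: "v p (s * Y) = - D p" using s Y p by (simp add: v_mult)
    show "s * Y \<in> RR (\<lambda>p. D p + (if p = q then - D q - v q (s * Y) else 0))"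
      unfolding RR_def ord_ge_def
    proof (rule CollectI, rule ballI, rule disjI2)
      fix p' assume p': "p' \<in> Pts"
      show "- (D p' + (if p' = q then - D q - v q (s * Y) else 0)) \<le> v p' (s * Y)"
        using Y(2)[of p'] Y(3)[OF p'] s(1) Y(1) p' vp
        by (cases "p' \<in> A"; cases "p' = p"; cases "p' = q") (auto simp: v_mult A_def)
    qed
  qed
qed

end

section \<open>Residues and sections on a smooth projective curve\<close>

lemma is_form_coord_power: "is_form n (coord_form i ^ n :: ('v, 'a::comm_ring_1) mpoly)"
proof -
  have "is_form (n * 1) (coord_form i ^ n :: ('v, 'a) mpoly)" by (intro is_form_power is_form_coord)
  then show ?thesis by simp
qed

text \<open>Two of the first powers must coincide.\<close>

lemma power_eq_1_in_finite:
  fixes r :: "'a::field"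
  assumes "finite A" "\<And>n. r ^ n \<in> A" "r \<noteq> 0"
  shows "\<exists>\<rho>. 1 \<le> \<rho> \<and> \<rho> \<le> card A \<and> r ^ \<rho> = 1"
proof -
  have "\<not> inj_on (\<lambda>n. r ^ n) {0..card A}"
  proof
    assume "inj_on (\<lambda>n. r ^ n) {0..card A}"
    then have "card {0..card A} \<le> card A" by (rule card_inj_on_le) (use assms in auto)
    then show False by simp
  qed
  then obtain m n where mn: "m < n" "n \<le> card A" "r ^ m = r ^ n"
    unfolding inj_on_def by (metis atLeastAtMost_iff linorder_neqE_nat)
  have "r ^ n = r ^ m * r ^ (n - m)" using mn(1) by (simp flip: power_add)
  then have "r ^ (n - m) = 1" using mn(3) assms(3) by simp
  then show ?thesis using mn by (intro exI[of _ "n - m"]) auto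
qed

lemma place_graph_mpoly_eval:
  assumes G: "place_graph G" and const: "\<And>c. (h c, k c) \<in> G" and y: "\<And>i. (y i, x i) \<in> G"
  shows "(mpoly_eval h g y, mpoly_eval k g x) \<in> G"
  unfolding mpoly_eval_def
  by (intro place_graph_sum[OF G] place_graphD(5)[OF G] const place_graph_prod[OF G] place_graph_power[OF G] y)

text \<open>Forms have values \<open>E g\<close> at the generic point and \<open>V g x\<close> at geometric
  points. For every closed point \<open>p\<close> a geometric point \<open>pt p\<close> is chosen, and a
  coordinate \<open>chart p\<close> that does not vanish there, whose powers serve as denominators. A function
  is regular at \<open>p\<close> if it is a quotient of forms of equal degree whose denominator does not
  vanish there.\<close>

locale smooth_curve =
  fixes C :: "('k::{field,finite}, 'f::field, 'n::finite) variety"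
  assumes smooth: "smooth_projective_curve C"
begin

abbreviation E :: "('n, 'k) mpoly \<Rightarrow> 'f" where
  "E g \<equiv> mpoly_eval (const C) g (gen C)"

abbreviation V :: "('n, 'k) mpoly \<Rightarrow> ('n \<Rightarrow> 'k alg_closure) \<Rightarrow> 'k alg_closure" where
  "V g x \<equiv> mpoly_eval to_ac g x"

lemma emb: "field_embedding (const C)"
  using smooth by (simp add: smooth_projective_curve_def is_function_field_def)

lemmas emb_simps = field_embeddingD[OF emb]
lemmas E_simps = mpoly_eval_add[OF emb] mpoly_eval_diff[OF emb] mpoly_eval_mult[OF emb]
  mpoly_eval_power[OF emb] mpoly_eval_prod[OF emb] mpoly_eval_const[OF emb] mpoly_eval_coord[OF emb]
lemmas V_simps = mpoly_eval_add[OF field_embedding_to_ac] mpoly_eval_diff[OF field_embedding_to_ac]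
  mpoly_eval_mult[OF field_embedding_to_ac] mpoly_eval_power[OF field_embedding_to_ac]
  mpoly_eval_prod[OF field_embedding_to_ac] mpoly_eval_const[OF field_embedding_to_ac]
  mpoly_eval_coord[OF field_embedding_to_ac]

lemma E_eq_0_iff: "is_form d g \<Longrightarrow> E g = 0 \<longleftrightarrow> (\<forall>x\<in>locus C. V g x = 0)"
  using smooth formsI[of d g] by (simp add: smooth_projective_curve_def is_function_field_def)

lemma E_fraction: "\<exists>d g h. is_form d g \<and> is_form d h \<and> E h \<noteq> 0 \<and> f = E g / E h"
  using smooth by (simp add: smooth_projective_curve_def is_function_field_def)

lemma locus_nonempty: "locus C \<noteq> {}"
  using smooth by (simp add: smooth_projective_curve_def absolutely_irreducible_def)

lemma locus_nonzero: "x \<in> locus C \<Longrightarrow> x \<noteq> (\<lambda>_. 0)"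
  using smooth by (auto simp: smooth_projective_curve_def closed_over_base_def zero_locus_def)

lemma in_locusI:
  assumes "x \<noteq> (\<lambda>_. 0)" "\<And>d g. is_form d g \<Longrightarrow> E g = 0 \<Longrightarrow> V g x = 0"
  shows "x \<in> locus C"
proof -
  obtain S :: "('n, 'k) mpoly set" where S: "S \<subseteq> forms" "locus C = zero_locus to_ac S"
    using smooth by (auto simp: smooth_projective_curve_def closed_over_base_def)
  have "V g x = 0" if g: "g \<in> S" for g
  proof -
    obtain d where d: "is_form d g" using S(1) g unfolding forms_def by blast
    have "E g = 0" unfolding E_eq_0_iff[OF d] using g S(2) by (auto simp: zero_locus_def)
    then show ?thesis by (rule assms(2)[OF d])
  qed
  then show ?thesis using assms(1) S(2) by (simp add: zero_locus_def)
qed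

lemma gen_nonzero: "x \<in> locus C \<Longrightarrow> x i \<noteq> 0 \<Longrightarrow> gen C i \<noteq> 0"
  using E_eq_0_iff[OF is_form_coord[of i]] by (auto simp: E_simps V_simps)

definition i0 :: 'n where "i0 = (SOME i. gen C i \<noteq> 0)"

lemma gen_i0: "gen C i0 \<noteq> 0"
proof -
  obtain x where x: "x \<in> locus C" using locus_nonempty by blast
  then obtain i where "x i \<noteq> 0" using locus_nonzero by blast
  from gen_nonzero[OF x this] show ?thesis unfolding i0_def by (rule someI)
qed

definition pt :: "('n, 'k) mpoly set \<Rightarrow> 'n \<Rightarrow> 'k alg_closure" where
  "pt p = (SOME x. x \<in> locus C \<and> forms_at x = p)"

definition chart :: "('n, 'k) mpoly set \<Rightarrow> 'n" where
  "chart p = (SOME i. pt p i \<noteq> 0)"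

definition regular :: "('n, 'k) mpoly set \<Rightarrow> 'f \<Rightarrow> bool" where
  "regular p f \<longleftrightarrow> (\<exists>d g h. is_form d g \<and> is_form d h \<and> V h (pt p) \<noteq> 0 \<and> f = E g / E h)"

definition res :: "('n, 'k) mpoly set \<Rightarrow> 'f \<Rightarrow> 'k alg_closure" where
  "res p f = (THE r. \<exists>d g h. is_form d g \<and> is_form d h \<and> V h (pt p) \<noteq> 0 \<and> f = E g / E h \<and>
    r = V g (pt p) / V h (pt p))"

context
  fixes p assumes p: "p \<in> closed_points C"
begin

lemma pt: "pt p \<in> locus C" "forms_at (pt p) = p"
proof -
  have "\<exists>x. x \<in> locus C \<and> forms_at x = p" using p by (auto simp: closed_points_def)
  from someI_ex[OF this] show "pt p \<in> locus C" "forms_at (pt p) = p" by (auto simp: pt_def)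
qed

lemma mem_point_iff: "is_form d g \<Longrightarrow> g \<in> p \<longleftrightarrow> V g (pt p) = 0"
  using pt(2) formsI[of d g] by (auto simp: forms_at_def)

lemma pt_chart: "pt p (chart p) \<noteq> 0"
proof -
  have "\<exists>i. pt p i \<noteq> 0" using locus_nonzero[OF pt(1)] by auto
  then show ?thesis unfolding chart_def by (rule someI_ex)
qed

lemma gen_chart: "gen C (chart p) \<noteq> 0"
  by (rule gen_nonzero[OF pt(1) pt_chart])

lemma E_nonzero: "is_form d h \<Longrightarrow> V h (pt p) \<noteq> 0 \<Longrightarrow> E h \<noteq> 0"
  using E_eq_0_iff pt(1) by blast

lemma local_ring_eq: "f \<in> local_ring C p \<longleftrightarrow> regular p f"
  unfolding local_ring_def regular_def using mem_point_iff by blast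

lemma regularI: "is_form d g \<Longrightarrow> is_form d h \<Longrightarrow> V h (pt p) \<noteq> 0 \<Longrightarrow> regular p (E g / E h)"
  unfolding regular_def by blast

lemma res_eq:
  assumes "is_form d g" "is_form d h" "V h (pt p) \<noteq> 0"
  shows "res p (E g / E h) = V g (pt p) / V h (pt p)"
  unfolding res_def
proof (rule the_equality)
  show "\<exists>d' g' h'. is_form d' g' \<and> is_form d' h' \<and> V h' (pt p) \<noteq> 0 \<and> E g / E h = E g' / E h' \<and>
      V g (pt p) / V h (pt p) = V g' (pt p) / V h' (pt p)" using assms by blast
  fix r assume "\<exists>d' g' h'. is_form d' g' \<and> is_form d' h' \<and> V h' (pt p) \<noteq> 0 \<and> E g / E h = E g' / E h' \<and>
      r = V g' (pt p) / V h' (pt p)"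
  then obtain d' g' h' where *: "is_form d' g'" "is_form d' h'" "V h' (pt p) \<noteq> 0" "E g / E h = E g' / E h'"
    "r = V g' (pt p) / V h' (pt p)" by blast
  have "is_form (d + d') (g * h' - g' * h)"
    using is_form_mult[OF assms(1) *(2)] is_form_mult[OF *(1) assms(2)] by (simp add: is_form_diff add.commute)
  moreover have "E (g * h' - g' * h) = 0"
    using *(4) E_nonzero[OF assms(2,3)] E_nonzero[OF *(2,3)] by (simp add: E_simps field_simps)
  ultimately have "V (g * h' - g' * h) (pt p) = 0" using E_eq_0_iff pt(1) by blast
  then show "r = V g (pt p) / V h (pt p)"
    using *(3) assms(3) unfolding *(5) by (simp add: V_simps frac_eq_eq)
qed

lemma regularE:
  assumes "regular p f"
  obtains d g h where "is_form d g" "is_form d h" "V h (pt p) \<noteq> 0" "f = E g / E h"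
    "E h \<noteq> 0" "res p f = V g (pt p) / V h (pt p)"
proof -
  obtain d g h where *: "is_form d g" "is_form d h" "V h (pt p) \<noteq> 0" "f = E g / E h"
    using assms unfolding regular_def by blast
  then show ?thesis using that E_nonzero res_eq by blast
qed

lemma regular_mult:
  assumes "regular p f" "regular p f'"
  shows "regular p (f * f')" "res p (f * f') = res p f * res p f'"
proof -
  obtain d g h where 1: "is_form d g" "is_form d h" "V h (pt p) \<noteq> 0" "f = E g / E h"
    "E h \<noteq> 0" "res p f = V g (pt p) / V h (pt p)" by (rule regularE[OF assms(1)])
  obtain d' g' h' where 2: "is_form d' g'" "is_form d' h'" "V h' (pt p) \<noteq> 0" "f' = E g' / E h'"
    "E h' \<noteq> 0" "res p f' = V g' (pt p) / V h' (pt p)" by (rule regularE[OF assms(2)])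
  have form: "is_form (d + d') (g * g')" "is_form (d + d') (h * h')" "V (h * h') (pt p) \<noteq> 0"
    using 1 2 by (auto simp: V_simps intro: is_form_mult)
  have eq: "f * f' = E (g * g') / E (h * h')" using 1 2 by (simp add: E_simps)
  show "regular p (f * f')" unfolding eq by (rule regularI[OF form])
  show "res p (f * f') = res p f * res p f'"
    unfolding eq res_eq[OF form] using 1 2 by (simp add: V_simps)
qed

lemma regular_diff:
  assumes "regular p f" "regular p f'"
  shows "regular p (f - f')" "res p (f - f') = res p f - res p f'"
proof -
  obtain d g h where 1: "is_form d g" "is_form d h" "V h (pt p) \<noteq> 0" "f = E g / E h"
    "E h \<noteq> 0" "res p f = V g (pt p) / V h (pt p)" by (rule regularE[OF assms(1)])
  obtain d' g' h' where 2: "is_form d' g'" "is_form d' h'" "V h' (pt p) \<noteq> 0" "f' = E g' / E h'"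
    "E h' \<noteq> 0" "res p f' = V g' (pt p) / V h' (pt p)" by (rule regularE[OF assms(2)])
  have form: "is_form (d + d') (g * h' - g' * h)" "is_form (d + d') (h * h')" "V (h * h') (pt p) \<noteq> 0"
  proof -
    have "is_form (d + d') (g' * h)" using is_form_mult[OF 2(1) 1(2)] by (simp add: add.commute)
    then show "is_form (d + d') (g * h' - g' * h)" using is_form_mult[OF 1(1) 2(2)] by (simp add: is_form_diff)
    show "is_form (d + d') (h * h')" by (rule is_form_mult[OF 1(2) 2(2)])
    show "V (h * h') (pt p) \<noteq> 0" using 1(3) 2(3) by (simp add: V_simps)
  qed
  have eq: "f - f' = E (g * h' - g' * h) / E (h * h')" using 1 2 by (simp add: E_simps diff_frac_eq)
  show "regular p (f - f')" unfolding eq by (rule regularI[OF form])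
  show "res p (f - f') = res p f - res p f'"
    unfolding eq res_eq[OF form] using 1 2 by (simp add: V_simps diff_frac_eq)
qed

lemma regular_const: "regular p (const C c)" "res p (const C c) = to_ac c"
proof -
  have *: "is_form 0 (const_form c)" "is_form 0 (const_form (1::'k))" "V (const_form 1) (pt p) \<noteq> 0"
    by (auto simp: V_simps is_form_const)
  show "regular p (const C c)" "res p (const C c) = to_ac c"
    using regularI[OF *] res_eq[OF *] by (simp_all add: E_simps V_simps emb_simps)
qed

lemma regular_0: "regular p 0" "res p 0 = 0" and regular_1: "regular p 1" "res p 1 = 1"
  using regular_const[of 0] regular_const[of 1] by (simp_all add: emb_simps)

lemma regular_power:
  assumes "regular p f" shows "regular p (f ^ n)" "res p (f ^ n) = res p f ^ n"
proof -
  have "regular p (f ^ n) \<and> res p (f ^ n) = res p f ^ n"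
    by (induction n) (use regular_1 regular_mult[OF assms] in auto)
  then show "regular p (f ^ n)" "res p (f ^ n) = res p f ^ n" by auto
qed

lemma regular_section:
  assumes "is_form d g"
  shows "regular p (E g / gen C (chart p) ^ d)" "res p (E g / gen C (chart p) ^ d) = V g (pt p) / pt p (chart p) ^ d"
proof -
  have *: "is_form d (coord_form (chart p) ^ d :: ('n, 'k) mpoly)" "V (coord_form (chart p) ^ d) (pt p) \<noteq> 0"
  proof -
    show "is_form d (coord_form (chart p) ^ d :: ('n, 'k) mpoly)" by (rule is_form_coord_power)
    show "V (coord_form (chart p) ^ d) (pt p) \<noteq> 0" using pt_chart by (simp add: V_simps)
  qed
  show "regular p (E g / gen C (chart p) ^ d)" "res p (E g / gen C (chart p) ^ d) = V g (pt p) / pt p (chart p) ^ d"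
    using regularI[OF assms *] res_eq[OF assms *] by (simp_all add: E_simps V_simps)
qed

lemma dvr: "discrete_valuation_ring (local_ring C p)"
  using smooth p by (simp add: smooth_projective_curve_def)

lemma regular_inverse:
  assumes "regular p f" "res p f \<noteq> 0"
  shows "f \<noteq> 0" "regular p (inverse f)" "res p (inverse f) = inverse (res p f)"
proof -
  show f0: "f \<noteq> 0" using assms(2) regular_0(2) by auto
  obtain d g h where *: "is_form d g" "is_form d h" "V h (pt p) \<noteq> 0" "f = E g / E h"
    "E h \<noteq> 0" "res p f = V g (pt p) / V h (pt p)" by (rule regularE[OF assms(1)])
  then have g: "V g (pt p) \<noteq> 0" using assms(2) by auto
  show "regular p (inverse f)" "res p (inverse f) = inverse (res p f)"
    using regularI[OF *(2,1) g] res_eq[OF *(2,1) g] * by simp_all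
qed

lemma regular_iff: "regular p f \<longleftrightarrow> f = 0 \<or> 0 \<le> ord_at C p f"
  unfolding ord_at_def local_ring_eq[symmetric]
  using dvr_mem_iff[OF dvr, of f] regular_0(1) local_ring_eq by auto

lemma res_eq_0_iff: "regular p f \<Longrightarrow> res p f = 0 \<longleftrightarrow> f = 0 \<or> 1 \<le> ord_at C p f"
proof -
  assume f: "regular p f"
  have "f \<in> ring_units (local_ring C p) \<longleftrightarrow> res p f \<noteq> 0"
  proof
    assume "f \<in> ring_units (local_ring C p)"
    then have "f \<noteq> 0" "regular p (inverse f)" by (auto simp: ring_units_def local_ring_eq)
    then show "res p f \<noteq> 0" using regular_mult(2)[OF f, of "inverse f"] regular_1(2) by auto
  next
    assume "res p f \<noteq> 0"
    then show "f \<in> ring_units (local_ring C p)"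
      using regular_inverse[OF f] f by (auto simp: ring_units_def local_ring_eq)
  qed
  then show ?thesis using dvr_unit_iff[OF dvr, of f] regular_iff[of f] f unfolding ord_at_def by auto
qed

lemma finite_residues: "finite (res p ` {f. regular p f})"
proof -
  let ?R = "{V g (pt p) | g. g \<in> forms}"
  have "res p ` {f. regular p f} \<subseteq> (\<lambda>(a, b). a / b) ` (?R \<times> ?R)"
  proof clarify
    fix f assume "regular p f"
    then obtain d g h where *: "is_form d g" "is_form d h" "res p f = V g (pt p) / V h (pt p)"
      by (rule regularE)
    then show "res p f \<in> (\<lambda>(a, b). a / b) ` (?R \<times> ?R)"
      by (intro image_eqI[where x = "(V g (pt p), V h (pt p))"]) (auto intro: formsI)
  qed
  then show ?thesis using finite_form_values finite_subset by blast
qed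

lemma residue_power_eq_1:
  assumes "regular p f" "res p f \<noteq> 0"
  shows "\<exists>\<rho>. 1 \<le> \<rho> \<and> \<rho> \<le> card (res p ` {f. regular p f}) \<and> res p f ^ \<rho> = 1"
proof (rule power_eq_1_in_finite[OF finite_residues _ assms(2)])
  fix n show "res p f ^ n \<in> res p ` {f. regular p f}"
    using regular_power[OF assms(1), of n] by (metis (mono_tags, lifting) imageI mem_Collect_eq)
qed

text \<open>A residue is a value \<open>g(x)/h(x)\<close>. In a finite residue field some power of
  \<open>h(x)\<close>, made homogeneous, is \<open>1\<close>, so the denominator can be replaced by a power of
  a coordinate; then the degree can be raised freely.\<close>

lemma residue_as_section:
  assumes "r \<in> res p ` {f. regular p f}"
  shows "\<exists>m. \<forall>k\<ge>m. \<exists>g. is_form k g \<and> V g (pt p) = r * pt p (chart p) ^ k"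
proof -
  let ?x = "pt p (chart p)"
  obtain f where f: "regular p f" "r = res p f" using assms by blast
  obtain d g h where *: "is_form d g" "is_form d h" "V h (pt p) \<noteq> 0" "res p f = V g (pt p) / V h (pt p)"
    using f(1) by (rule regularE)
  have "res p (E h / gen C (chart p) ^ d) \<noteq> 0"
    using regular_section(2)[OF *(2)] *(3) pt_chart by simp
  from residue_power_eq_1[OF regular_section(1)[OF *(2)] this] obtain \<rho> where
    \<rho>: "1 \<le> \<rho>" "(V h (pt p) / ?x ^ d) ^ \<rho> = 1" unfolding regular_section(2)[OF *(2)] by blast
  then have h\<rho>: "V h (pt p) ^ \<rho> = ?x ^ (d * \<rho>)" using pt_chart by (simp add: power_divide power_mult)
  show ?thesis
  proof (intro exI[of _ "d * \<rho>"] allI impI)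
    fix k assume k: "d * \<rho> \<le> k"
    let ?g = "g * h ^ (\<rho> - 1) * coord_form (chart p) ^ (k - d * \<rho>)"
    have "is_form (d + (\<rho> - 1) * d + (k - d * \<rho>) * 1) ?g"
      by (intro is_form_mult is_form_power is_form_coord *)
    moreover have "d + (\<rho> - 1) * d = d * \<rho>" using \<rho>(1) by (cases \<rho>) auto
    ultimately have "is_form k ?g" using k by simp
    moreover have "V ?g (pt p) = r * ?x ^ k"
    proof -
      have "V ?g (pt p) = r * (V h (pt p) * V h (pt p) ^ (\<rho> - 1)) * ?x ^ (k - d * \<rho>)"
        using *(3,4) f(2) by (simp add: V_simps)
      also have "V h (pt p) * V h (pt p) ^ (\<rho> - 1) = ?x ^ (d * \<rho>)"
        using \<rho>(1) h\<rho> by (cases \<rho>) auto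
      finally show ?thesis using k by (simp add: mult.assoc flip: power_add)
    qed
    ultimately show "\<exists>g. is_form k g \<and> V g (pt p) = r * ?x ^ k" by blast
  qed
qed

lemma residues_as_sections:
  "\<exists>m. \<forall>k\<ge>m. \<forall>r\<in>res p ` {f. regular p f}. \<exists>g. is_form k g \<and> V g (pt p) = r * pt p (chart p) ^ k"
proof -
  have "\<exists>m. \<forall>r\<in>res p ` {f. regular p f}. \<forall>k\<ge>m r. \<exists>g. is_form k g \<and> V g (pt p) = r * pt p (chart p) ^ k"
    using residue_as_section by (intro bchoice) blast
  then obtain m where m: "\<And>r k. r \<in> res p ` {f. regular p f} \<Longrightarrow> m r \<le> k \<Longrightarrow>
      \<exists>g. is_form k g \<and> V g (pt p) = r * pt p (chart p) ^ k" by blast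
  have "m r \<le> (\<Sum>r\<in>res p ` {f. regular p f}. m r)" if "r \<in> res p ` {f. regular p f}" for r
    by (rule member_le_sum) (use that finite_residues in auto)
  then show ?thesis using m order_trans by blast
qed

end

text \<open>Closed points are maximal: if \<open>g\<close> vanishes at \<open>p\<close> but not at
  \<open>q\<close>, some power of \<open>g\<close> agrees at \<open>q\<close> with a power of a coordinate
  that does not vanish at \<open>p\<close>, and the difference of the two vanishes at \<open>q\<close> but not
  at \<open>p\<close>.\<close>

lemma separating_form:
  assumes p: "p \<in> closed_points C" and q: "q \<in> closed_points C" and pq: "p \<noteq> q"
  shows "\<exists>d g. is_form d g \<and> V g (pt q) = 0 \<and> V g (pt p) \<noteq> 0"
proof (rule ccontr)
  assume "\<not> ?thesis"
  then have sub: "V g (pt p) = 0" if "is_form d g" "V g (pt q) = 0" for d g using that by blast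
  have "V g (pt q) = 0" if g: "is_form d g" "V g (pt p) = 0" for d g
  proof (rule ccontr)
    assume ne: "V g (pt q) \<noteq> 0"
    let ?y = "pt q (chart p)"
    have y: "?y \<noteq> 0" using sub[OF is_form_coord[of "chart p"]] pt_chart[OF p] by (auto simp: V_simps)
    have form: "is_form d (coord_form (chart p) ^ d :: ('n, 'k) mpoly)"
      by (rule is_form_coord_power)
    have Vx: "V (coord_form (chart p) ^ d) (pt q) \<noteq> 0" using y by (simp add: V_simps)
    note re = regularI[OF q g(1) form Vx] res_eq[OF q g(1) form Vx]
    have "res q (E g / E (coord_form (chart p) ^ d)) \<noteq> 0" using re(2) ne Vx by simp
    from residue_power_eq_1[OF q re(1) this] obtain \<rho> where
      \<rho>: "1 \<le> \<rho>" "(V g (pt q) / ?y ^ d) ^ \<rho> = 1" unfolding re(2) by (auto simp: V_simps)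
    have f: "is_form (\<rho> * d) (g ^ \<rho> - (coord_form (chart p) ^ d) ^ \<rho>)"
      by (intro is_form_diff is_form_power g form)
    have "V (g ^ \<rho> - (coord_form (chart p) ^ d) ^ \<rho>) (pt q) = 0"
      using \<rho>(2) y by (simp add: V_simps power_divide)
    from sub[OF f this] have "V g (pt p) ^ \<rho> = (pt p (chart p) ^ d) ^ \<rho>" by (simp add: V_simps)
    then show False using g(2) \<rho>(1) pt_chart[OF p] by (simp add: power_0_left)
  qed
  then have "forms_at (pt p) = forms_at (pt q)"
    using sub unfolding forms_at_def forms_def by blast
  then show False using pq pt(2)[OF p] pt(2)[OF q] by simp
qed

text \<open>If the residue field at \<open>p\<close> has at most \<open>B\<close> elements, the suitably
  scaled coordinates of \<open>p\<close> are \<open>0\<close> or roots of unity of order at most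
  \<open>B\<close>.\<close>

lemma finite_small_points: "finite {p\<in>closed_points C. card (res p ` {f. regular p f}) \<le> B}"
proof -
  (* The possible values of a coordinate. *)
  define T where "T = insert 0 (\<Union>\<rho>\<in>{1..B}. {r :: 'k alg_closure. poly (Polynomial.monom 1 \<rho> - 1) r = 0})"
  have T: "finite T" unfolding T_def
  proof (intro finite.insertI finite_UN_I poly_roots_finite)
    fix \<rho> assume "\<rho> \<in> {1..B}"
    then have "degree (Polynomial.monom (1 :: 'k alg_closure) \<rho>) \<noteq> degree (1 :: 'k alg_closure poly)"
      by (simp add: degree_monom_eq)
    then show "Polynomial.monom (1 :: 'k alg_closure) \<rho> - 1 \<noteq> 0" by auto
  qed simp
  have "{p\<in>closed_points C. card (res p ` {f. regular p f}) \<le> B} \<subseteq> forms_at ` (UNIV \<rightarrow> T)"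
  proof clarify
    fix p assume p: "p \<in> closed_points C" and B: "card (res p ` {f. regular p f}) \<le> B"
    let ?x = "\<lambda>i. inverse (pt p (chart p)) * pt p i"
    have "?x i \<in> T" for i
    proof (cases "pt p i = 0")
      case False
      note sec = regular_section[OF p is_form_coord[of i]]
      have x: "res p (E (coord_form i) / gen C (chart p) ^ 1) = ?x i"
        unfolding sec(2) by (simp add: V_simps divide_inverse mult.commute)
      have "?x i \<noteq> 0" using False pt_chart[OF p] by simp
      then obtain \<rho> where "1 \<le> \<rho>" "\<rho> \<le> card (res p ` {f. regular p f})" "?x i ^ \<rho> = 1"
        using residue_power_eq_1[OF p sec(1)] unfolding x by blast
      then have "\<rho> \<in> {1..B}" "poly (Polynomial.monom 1 \<rho> - 1) (?x i) = 0" using B by (auto simp: poly_monom)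
      then show ?thesis unfolding T_def by blast
    qed (simp add: T_def)
    moreover have "forms_at ?x = forms_at (pt p)"
      using mpoly_eval_scale[OF field_embedding_to_ac, of _ _ "inverse (pt p (chart p))" "pt p"] pt_chart[OF p]
      unfolding forms_at_def forms_def by fastforce
    ultimately show "p \<in> forms_at ` (UNIV \<rightarrow> T)" using pt(2)[OF p] by (intro image_eqI[of _ _ ?x]) auto
  qed
  moreover have "finite (UNIV \<rightarrow> T :: ('n \<Rightarrow> 'k alg_closure) set)"
  proof -
    have "(UNIV \<rightarrow> T :: ('n \<Rightarrow> 'k alg_closure) set) = {f. \<forall>x. (x \<in> UNIV \<longrightarrow> f x \<in> T) \<and> (x \<notin> UNIV \<longrightarrow> f x = 0)}"
      by (auto simp: Pi_def)
    then show ?thesis using finite_set_of_finite_funs[of "UNIV :: 'n set" T 0] T by simp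
  qed
  ultimately show ?thesis using finite_subset by blast
qed

text \<open>A function with a zero at \<open>p\<close> is not algebraic over the constants: in a polynomial
  relation for its inverse, multiplied by a power of \<open>f\<close>, every term but the leading coefficient
  vanishes at \<open>p\<close>.\<close>

lemma inverse_of_zero_transcendental:
  assumes p: "p \<in> closed_points C" and f: "f \<noteq> 0" "1 \<le> ord_at C p f"
    and q: "poly (map_poly (const C) q) (inverse f) = 0"
  shows "q = 0"
proof -
  let ?Q = "map_poly (const C) q"
  have lead: "lead_coeff ?Q = const C (lead_coeff q)"
    by (simp add: coeff_map_poly emb_simps degree_map_poly)
  obtain a R where aR: "reflect_poly ?Q = pCons a R" by (rule pCons_cases)
  have "a = lead_coeff ?Q" using arg_cong[OF aR, of "\<lambda>p. poly.coeff p 0"] by simp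
  with aR have R: "reflect_poly ?Q = pCons (lead_coeff ?Q) R" by simp
  have reg_f: "regular p f" using f regular_iff[OF p] by auto
  have "regular p (poly.coeff (reflect_poly ?Q) i)" for i
    by (auto simp: coeff_reflect_poly coeff_map_poly emb_simps regular_const[OF p] regular_0[OF p])
  then have "regular p (poly.coeff R i)" for i
    unfolding coeff_pCons_Suc[of a R i, symmetric] aR[symmetric] .
  then have regR: "regular p (poly R f)"
  proof (induction R)
    case (pCons a R)
    have a: "regular p a" and R: "\<And>i. regular p (poly.coeff R i)"
      using pCons.prems[of 0] pCons.prems[of "Suc _"] by auto
    have "regular p (a - (0 - f * poly R f))"
      by (rule regular_diff(1)[OF p a regular_diff(1)[OF p regular_0(1)[OF p]
            regular_mult(1)[OF p reg_f pCons.IH[OF R]]]])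
    then show ?case by simp
  qed (simp add: regular_0[OF p])
  have "poly (reflect_poly ?Q) f = 0" using poly_reflect_poly_nz[OF f(1), of ?Q] q by simp
  then have "const C (lead_coeff q) = 0 - f * poly R f" unfolding R poly_pCons lead
    by (simp add: eq_neg_iff_add_eq_0)
  then have "to_ac (lead_coeff q) = res p (0 - f * poly R f)" using regular_const(2)[OF p] by metis
  also have "\<dots> = 0 - res p f * res p (poly R f)"
    using regular_diff(2)[OF p regular_0(1)[OF p] regular_mult(1)[OF p reg_f regR]]
      regular_mult(2)[OF p reg_f regR] regular_0(2)[OF p] by simp
  also have "\<dots> = 0" using res_eq_0_iff[OF p reg_f] f by simp
  finally show "q = 0" by simp
qed

text \<open>If \<open>f\<close> had a zero, its inverse \<open>y\<close> would be transcendental over the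
  constants, so \<open>y \<mapsto> 0\<close> would define a place of the polynomials in \<open>y\<close>.
  Extended to the quotients of coordinates it has a centre \<open>x\<close>, which lies on the curve because
  the curve is a closed subset of projective space. The function \<open>f\<close> is regular at
  \<open>x\<close> by hypothesis, which contradicts \<open>f * y = 1\<close>.\<close>

lemma no_zero_without_pole:
  assumes f: "f \<noteq> 0" "\<forall>p\<in>closed_points C. 0 \<le> ord_at C p f" and p: "p \<in> closed_points C"
  shows "ord_at C p f = 0"
proof (rule ccontr)
  assume "ord_at C p f \<noteq> 0"
  moreover have "0 \<le> ord_at C p f" using f(2) p by blast
  ultimately have pos: "1 \<le> ord_at C p f" by linarith
  define y where "y = inverse f"
  define G where "G = {(poly (map_poly (const C) q) y, to_ac (poly.coeff q 0)) | q. True}"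
  have GI: "(poly (map_poly (const C) q) y, to_ac (poly.coeff q 0)) \<in> G" for q unfolding G_def by blast
  note hom = map_poly_embedding[OF emb]
  have G: "place_graph G" unfolding place_graph_def
  proof (intro conjI allI impI)
    show "(1, 1) \<in> G" using GI[of 1] by (simp add: emb_simps)
    fix a \<alpha> b \<beta> assume "(a, \<alpha>) \<in> G" "(b, \<beta>) \<in> G"
    then obtain q r where *: "a = poly (map_poly (const C) q) y" "\<alpha> = to_ac (poly.coeff q 0)"
      "b = poly (map_poly (const C) r) y" "\<beta> = to_ac (poly.coeff r 0)" unfolding G_def by blast
    have "map_poly (const C) (q - r) + map_poly (const C) r = map_poly (const C) q"
      using hom(1)[of "q - r" r] by simp
    then have "map_poly (const C) (q - r) = map_poly (const C) q - map_poly (const C) r" by (simp add: eq_diff_eq)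
    then show "(a - b, \<alpha> - \<beta>) \<in> G" using GI[of "q - r"] * by simp
    show "(a * b, \<alpha> * \<beta>) \<in> G" using GI[of "q * r"] * by (simp add: hom coeff_mult)
  next
    fix \<beta> assume "(0, \<beta>) \<in> G"
    then obtain q where q: "poly (map_poly (const C) q) y = 0" "\<beta> = to_ac (poly.coeff q 0)" unfolding G_def by auto
    then have "q = 0" using inverse_of_zero_transcendental[OF p f(1) pos] unfolding y_def by blast
    then show "\<beta> = 0" using q(2) by simp
  qed
  have "gen C \<noteq> (\<lambda>_. 0)" using gen_i0 by auto
  from place_center[OF G this] obtain G' i x where G': "place_graph G'" "G \<subseteq> G'" "gen C i \<noteq> 0" "x i = 1"
    "\<And>j. (gen C j / gen C i, x j) \<in> G'" by blast
  note GD = place_graphD[OF G'(1)]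
  have const: "(const C c, to_ac c) \<in> G'" for c
    using GI[of "[:c:]"] G'(2) by (auto simp: map_poly_pCons emb_simps)
  have y0: "(y, 0) \<in> G'" using GI[of "[:0, 1:]"] G'(2) by (auto simp: map_poly_pCons emb_simps)
  have ev: "(E g / gen C i ^ d, V g x) \<in> G'" if "is_form d g" for d g
  proof -
    have "(mpoly_eval (const C) g (\<lambda>j. gen C j / gen C i), V g x) \<in> G'"
      by (rule place_graph_mpoly_eval[OF G'(1) const G'(5)])
    moreover have "mpoly_eval (const C) g (\<lambda>j. gen C j / gen C i) = E g / gen C i ^ d"
      using mpoly_eval_scale[OF emb that, of "inverse (gen C i)" "gen C"]
      by (simp add: divide_inverse mult.commute power_inverse)
    ultimately show ?thesis by simp
  qed
  have "x \<in> locus C"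
  proof (rule in_locusI)
    show "x \<noteq> (\<lambda>_. 0)" using G'(4) by auto
    show "V g x = 0" if "is_form d g" "E g = 0" for d g using ev[OF that(1)] that(2) GD(6) by simp
  qed
  then have "forms_at x \<in> closed_points C" by (simp add: closed_points_def)
  then have "f \<in> local_ring C (forms_at x)" using f regular_iff local_ring_eq by blast
  then obtain d g h where gh: "f = E g / E h" "is_form d g" "is_form d h" "h \<notin> forms_at x"
    unfolding local_ring_def by blast
  then have hx: "V h x \<noteq> 0" using formsI[of d h] by (auto simp: forms_at_def)
  have "E h \<noteq> 0" using gh(1) f(1) by auto
  then have Eg: "E g = f * E h" using gh(1) by simp
  have "y * (E g / gen C i ^ d) = E h / gen C i ^ d"
    using f(1) unfolding y_def Eg by simp
  then have "(E h / gen C i ^ d, 0) \<in> G'" using GD(5)[OF y0 ev[OF gh(2)]] by (simp only: mult_zero_left)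
  then have "(E h / gen C i ^ d - E h / gen C i ^ d, V h x - 0) \<in> G'" by (rule GD(3)[OF ev[OF gh(3)]])
  then show False using GD(6) hx by simp
qed

definition par :: "('n, 'k) mpoly set \<Rightarrow> 'f" where
  "par p = (SOME t. t \<noteq> 0 \<and> ord_at C p t = 1)"

lemma par: "p \<in> closed_points C \<Longrightarrow> par p \<noteq> 0 \<and> ord_at C p (par p) = 1"
  unfolding par_def ord_at_def by (rule someI_ex) (rule dvr_uniformizer[OF dvr])

definition sections :: "nat \<Rightarrow> 'f set" where
  "sections u = {E g / gen C i0 ^ u | g. is_form u g}"

definition triv :: "('n, 'k) mpoly set \<Rightarrow> 'f" where
  "triv p = gen C i0 / gen C (chart p)"

lemma triv:
  assumes p: "p \<in> closed_points C" shows "triv p \<noteq> 0" "0 \<le> ord_at C p (triv p)"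
proof -
  show 0: "triv p \<noteq> 0" using gen_i0 gen_chart[OF p] by (simp add: triv_def)
  have "regular p (triv p)"
    using regular_section(1)[OF p is_form_coord[of i0]] by (simp add: triv_def E_simps)
  then show "0 \<le> ord_at C p (triv p)" using regular_iff[OF p, of "triv p"] 0 by simp
qed

lemma section_triv: "p \<in> closed_points C \<Longrightarrow> E g / gen C i0 ^ u * triv p ^ u = E g / gen C (chart p) ^ u"
  using gen_i0 by (simp add: triv_def power_divide)

lemma ord_mult: "p \<in> closed_points C \<Longrightarrow> f \<noteq> 0 \<Longrightarrow> g \<noteq> 0 \<Longrightarrow> ord_at C p (f * g) = ord_at C p f + ord_at C p g"
  unfolding ord_at_def by (rule dvr_mult[OF dvr])

lemma ord_power: "p \<in> closed_points C \<Longrightarrow> f \<noteq> 0 \<Longrightarrow> ord_at C p (f ^ n) = int n * ord_at C p f"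
proof (induction n)
  case 0
  then show ?case using ord_mult[of p 1 1] by simp
qed (simp add: ord_mult algebra_simps)

lemma section_ord_nonneg:
  assumes p: "p \<in> closed_points C" and g: "is_form u g" "E g \<noteq> 0"
  shows "0 \<le> ord_at C p (E g / gen C (chart p) ^ u)"
  using regular_section(1)[OF p g(1)] regular_iff[OF p] g(2) gen_chart[OF p] by auto

lemma section_order_pos:
  assumes p: "p \<in> closed_points C" and g: "is_form u g" "E g \<noteq> 0" "V g (pt p) = 0"
  shows "1 \<le> ord_at C p (E g / gen C (chart p) ^ u)"
  using regular_section[OF p g(1)] res_eq_0_iff[OF p] g(2,3) gen_chart[OF p] by auto

text \<open>The element wanted is a product of three forms: one with the same leading term at \<open>p\<close>
  as a power of the local parameter, one that vanishes on the rest of the divisor but not at \<open>p\<close>,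
  and one that corrects the value at \<open>p\<close>. The last is available in every large degree and absorbs
  the difference to the degree \<open>u\<close>.\<close>

lemma sections_surjective:
  assumes p: "p \<in> closed_points C" and M: "set_mset M \<subseteq> closed_points C"
  shows "\<exists>u0. \<forall>u\<ge>u0. \<forall>r\<in>res p ` {f. f = 0 \<or> 0 \<le> ord_at C p f}. \<exists>f\<in>sections u.
    (\<forall>p'\<in>closed_points C. f = 0 \<or> int (count M p') \<le> ord_at C p' (f * triv p' ^ u)) \<and>
    res p (f * (triv p ^ u * par p powi (- int (count M p)))) = r"
proof -
  let ?e = "count M p" and ?A = "set_mset M - {p}" and ?x = "pt p (chart p)" and ?y = "gen C (chart p)"
  define sep where "sep q d g \<longleftrightarrow> is_form d g \<and> V g (pt q) = 0 \<and> V g (pt p) \<noteq> 0" for q d g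
  have "\<exists>d g. sep q d g" if q: "q \<in> ?A" for q
  proof -
    have "q \<in> closed_points C" "p \<noteq> q" using q M by auto
    then show ?thesis unfolding sep_def by (rule separating_form[OF p])
  qed
  then obtain \<delta> \<gamma> where sep: "\<And>q. q \<in> ?A \<Longrightarrow> sep q (\<delta> q) (\<gamma> q)" by metis
  have \<gamma>: "is_form (\<delta> q) (\<gamma> q)" "V (\<gamma> q) (pt q) = 0" "V (\<gamma> q) (pt p) \<noteq> 0" if "q \<in> ?A" for q
    using sep[OF that] unfolding sep_def by blast+
  define rest where "rest B = (\<Prod>q\<in>B. \<gamma> q ^ count M q)" for B
  define dr where "dr B = (\<Sum>q\<in>B. count M q * \<delta> q)" for B
  have rest: "is_form (dr B) (rest B)" if "B \<subseteq> ?A" for B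
    unfolding rest_def dr_def by (rule is_form_prod, rule is_form_power) (use that \<gamma>(1) in blast)
  have rest_p: "V (rest ?A) (pt p) \<noteq> 0" unfolding rest_def using \<gamma>(3) by (simp add: V_simps)
  have t: "par p \<noteq> 0" "ord_at C p (par p) = 1" using par[OF p] by auto
  have "regular p (par p ^ ?e)" using t regular_iff[OF p] by (simp add: ord_power[OF p])
  then obtain d1 g1 h1 where g1: "is_form d1 g1" "is_form d1 h1" "V h1 (pt p) \<noteq> 0" "par p ^ ?e = E g1 / E h1" "E h1 \<noteq> 0"
    by (rule regularE[OF p])
  obtain m where m: "\<And>k r. m \<le> k \<Longrightarrow> r \<in> res p ` {f. regular p f} \<Longrightarrow> \<exists>g. is_form k g \<and> V g (pt p) = r * ?x ^ k"
    using residues_as_sections[OF p] by blast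
  (* The factors of the section that do not vanish at p; their residue is divided out below. *)
  define w where "w = (E h1 / ?y ^ d1) * (E (rest ?A) / ?y ^ dr ?A)"
  note s1 = regular_section[OF p g1(2)] and s2 = regular_section[OF p rest[OF subset_refl]]
  have w: "regular p w" "res p w \<noteq> 0"
    unfolding w_def regular_mult(2)[OF p s1(1) s2(1)] s1(2) s2(2)
    using regular_mult(1)[OF p s1(1) s2(1)] g1(3) rest_p pt_chart[OF p] by simp_all
  note wi = regular_inverse[OF p w]
  show ?thesis
  proof (intro exI[of _ "d1 + dr ?A + m"] allI impI ballI)
    fix u r assume u: "d1 + dr ?A + m \<le> u" and r: "r \<in> res p ` {f. f = 0 \<or> 0 \<le> ord_at C p f}"
    define k where "k = u - d1 - dr ?A"
    have k: "m \<le> k" "u = d1 + (dr ?A + k)" using u unfolding k_def by auto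
    obtain f where f: "regular p f" "r = res p f" using r regular_iff[OF p] by blast
    have "r / res p w \<in> res p ` {f. regular p f}"
      using regular_mult[OF p f(1) wi(2)] unfolding f(2) divide_inverse wi(3)[symmetric]
      by (intro image_eqI[of _ _ "f * inverse w"]) auto
    then obtain g3 where g3: "is_form k g3" "V g3 (pt p) = r / res p w * ?x ^ k" using m[OF k(1)] by blast
    define g where "g = g1 * (rest ?A * g3)"
    have form: "is_form u g" unfolding g_def k(2) by (intro is_form_mult g1(1) rest subset_refl g3(1))
    show "\<exists>f\<in>sections u. (\<forall>p'\<in>closed_points C. f = 0 \<or> int (count M p') \<le> ord_at C p' (f * triv p' ^ u)) \<and>
      res p (f * (triv p ^ u * par p powi (- int ?e))) = r"
    proof (intro bexI[of _ "E g / gen C i0 ^ u"] conjI ballI)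
      show "E g / gen C i0 ^ u \<in> sections u" unfolding sections_def using form by blast
      have gy: "E g / ?y ^ u = par p ^ ?e * (w * (E g3 / ?y ^ k))"
      proof -
        have "E g1 = par p ^ ?e * E h1" using g1(4,5) by simp
        then show ?thesis unfolding g_def w_def k(2) by (simp add: E_simps power_add mult_ac)
      qed
      have "E g / gen C i0 ^ u * (triv p ^ u * par p powi (- int ?e)) = E g / ?y ^ u * par p powi (- int ?e)"
        using section_triv[OF p, of g u] by (simp add: mult.assoc[symmetric])
      also have "\<dots> = w * (E g3 / ?y ^ k)" unfolding gy using t(1) by (simp add: power_int_minus)
      finally show "res p (E g / gen C i0 ^ u * (triv p ^ u * par p powi (- int ?e))) = r"
        using regular_mult(2)[OF p w(1) regular_section(1)[OF p g3(1)]] regular_section(2)[OF p g3(1)] g3(2) w(2) pt_chart[OF p]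
        by simp
      fix p' assume p': "p' \<in> closed_points C"
      show "E g / gen C i0 ^ u = 0 \<or> int (count M p') \<le> ord_at C p' (E g / gen C i0 ^ u * triv p' ^ u)"
      proof (rule disjCI)
        assume "\<not> int (count M p') \<le> ord_at C p' (E g / gen C i0 ^ u * triv p' ^ u)"
        then have neg: "\<not> int (count M p') \<le> ord_at C p' (E g / gen C (chart p') ^ u)"
          unfolding section_triv[OF p'] .
        show "E g / gen C i0 ^ u = 0"
        proof (rule ccontr)
          assume "E g / gen C i0 ^ u \<noteq> 0"
          then have Eg: "E g \<noteq> 0" by auto
          consider "p' \<notin># M" | "p' = p" | "p' \<in> ?A" by blast
          then show False
          proof cases
            case 1
            then show False using section_ord_nonneg[OF p' form Eg] neg by (simp add: not_in_iff)
          next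
            case 2
            have "E g / ?y ^ u \<noteq> 0" using Eg gen_chart[OF p] by simp
            then have nz: "par p ^ ?e \<noteq> 0" "w * (E g3 / ?y ^ k) \<noteq> 0" using t(1) unfolding gy by simp_all
            have "regular p (w * (E g3 / ?y ^ k))"
              by (rule regular_mult(1)[OF p w(1) regular_section(1)[OF p g3(1)]])
            then have "0 \<le> ord_at C p (w * (E g3 / ?y ^ k))" using regular_iff[OF p] nz(2) by blast
            then have "int ?e \<le> ord_at C p (E g / ?y ^ u)"
              unfolding gy ord_mult[OF p nz] using ord_power[OF p t(1)] t(2) by simp
            then show False using neg 2 by simp
          next
            case 3
            let ?B = "?A - {p'}" and ?c = "count M p'"
            have split: "rest ?A = \<gamma> p' ^ ?c * rest ?B" "dr ?A = ?c * \<delta> p' + dr ?B"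
              unfolding rest_def dr_def using 3 by (simp_all add: prod.remove sum.remove)
            define h where "h = g1 * (rest ?B * g3)"
            have gh: "g = \<gamma> p' ^ ?c * h" unfolding g_def h_def split(1) by (simp add: mult_ac)
            have uh: "u = ?c * \<delta> p' + (d1 + (dr ?B + k))" unfolding k(2) split(2) by simp
            have fh: "is_form (d1 + (dr ?B + k)) h"
              unfolding h_def by (intro is_form_mult g1(1) g3(1) rest) auto
            have "?c \<noteq> 0" using 3 by auto
            then have E\<gamma>: "E (\<gamma> p') \<noteq> 0" and Eh: "E h \<noteq> 0"
              using Eg unfolding gh by (auto simp: E_simps)
            let ?a = "E (\<gamma> p') / gen C (chart p') ^ \<delta> p'" and ?b = "E h / gen C (chart p') ^ (d1 + (dr ?B + k))"
            have eq: "E g / gen C (chart p') ^ u = ?a ^ ?c * ?b"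
              unfolding gh uh by (simp add: E_simps power_add power_mult power_divide mult.commute flip: power_mult)
            have ab: "?a \<noteq> 0" "?b \<noteq> 0" using E\<gamma> Eh gen_chart[OF p'] by auto
            have "1 \<le> ord_at C p' ?a" using section_order_pos[OF p' \<gamma>(1)[OF 3] E\<gamma> \<gamma>(2)[OF 3]] .
            then have "int ?c * 1 \<le> int ?c * ord_at C p' ?a" by (rule mult_left_mono) simp
            moreover have "0 \<le> ord_at C p' ?b" by (rule section_ord_nonneg[OF p' fh Eh])
            moreover have "ord_at C p' (?a ^ ?c * ?b) = int ?c * ord_at C p' ?a + ord_at C p' ?b"
              using ord_mult[OF p' _ ab(2), of "?a ^ ?c"] ord_power[OF p' ab(1)] ab(1) by simp
            ultimately show False using neg unfolding eq by linarith
          qed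
        qed
      qed
    qed
  qed
qed

lemma sections_growth: "\<exists>K. \<forall>u. finite (sections u) \<and> card (sections u) \<le> K ^ Suc u"
proof -
  obtain B where B: "transcendence_basis (const C) B" "card B = 1"
    using smooth by (auto simp: smooth_projective_curve_def)
  then obtain b where "B = {b}" using card_1_singletonE by blast
  then obtain K where K: "\<And>u. finite {E g | g. is_form u g}" "\<And>u. card {E g | g. is_form u g} \<le> K ^ Suc u"
    using form_values_growth[OF emb, of b "gen C"] B(1) by blast
  have image: "sections u = (\<lambda>f. f / gen C i0 ^ u) ` {E g | g. is_form u g}" for u
    unfolding sections_def by auto
  show ?thesis
  proof (intro exI[of _ K] allI conjI)
    fix u
    show "finite (sections u)" unfolding image[of u] by (rule finite_imageI[OF K(1)])
    show "card (sections u) \<le> K ^ Suc u"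
      unfolding image[of u] by (rule order_trans[OF card_image_le[OF K(1)] K(2)])
  qed
qed

definition growth :: nat where
  "growth = (SOME K. \<forall>u. finite (sections u) \<and> card (sections u) \<le> K ^ Suc u)"

sublocale projective_curve_places "closed_points C" "ord_at C" res par sections triv growth
proof
  have gr: "\<forall>u. finite (sections u) \<and> card (sections u) \<le> growth ^ Suc u"
    unfolding growth_def by (rule someI_ex[OF sections_growth])
  then show "finite (sections u)" "card (sections u) \<le> growth ^ Suc u" for u by auto
  have reg: "{f. f = 0 \<or> 0 \<le> ord_at C p f} = {f. regular p f}" if "p \<in> closed_points C" for p
    using regular_iff[OF that] by blast
  show "finite {p \<in> closed_points C. card (res p ` {f. f = 0 \<or> 0 \<le> ord_at C p f}) \<le> B}" for B
    using finite_small_points[of B] reg by (simp cong: conj_cong)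
  show "0 \<in> sections u" for u
  proof -
    have "(0::'f) = E 0 / gen C i0 ^ u" by (simp add: mpoly_eval_def)
    then show ?thesis unfolding sections_def using is_form_zero by blast
  qed
  show "f - g \<in> sections u" if fg: "f \<in> sections u" "g \<in> sections u" for f g u
  proof -
    obtain a b where "f = E a / gen C i0 ^ u" "is_form u a" "g = E b / gen C i0 ^ u" "is_form u b"
      using fg unfolding sections_def by blast
    then have "f - g = E (a - b) / gen C i0 ^ u" "is_form u (a - b)"
      by (auto simp: E_simps diff_divide_distrib intro: is_form_diff)
    then show ?thesis unfolding sections_def by blast
  qed
  show "sections u \<subseteq> sections (Suc u)" for u
  proof
    fix f assume "f \<in> sections u"
    then obtain g where g: "is_form u g" "f = E g / gen C i0 ^ u" unfolding sections_def by blast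
    have "is_form (u + 1) (g * coord_form i0)" by (rule is_form_mult[OF g(1) is_form_coord])
    moreover have "f = E (g * coord_form i0) / gen C i0 ^ Suc u" using g(2) gen_i0 by (simp add: E_simps)
    ultimately show "f \<in> sections (Suc u)" unfolding sections_def by auto
  qed
  show "0 \<le> ord_at C p f + int u * ord_at C p (triv p)"
    if f: "f \<in> sections u" "f \<noteq> 0" and p: "p \<in> closed_points C" for f u p
  proof -
    obtain g where g: "is_form u g" "f = E g / gen C i0 ^ u" using f unfolding sections_def by blast
    have "0 \<le> ord_at C p (E g / gen C (chart p) ^ u)" by (rule section_ord_nonneg[OF p g(1)]) (use f g in auto)
    then have "0 \<le> ord_at C p (f * triv p ^ u)" using section_triv[OF p, of g u] g(2) by simp
    then show ?thesis using ord_mult[OF p f(2)] ord_power[OF p] triv[OF p] by simp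
  qed
  show "\<exists>d. \<exists>g\<in>sections d. \<exists>h\<in>sections d. h \<noteq> 0 \<and> f = g / h" for f
  proof -
    obtain d g h where "is_form d g" "is_form d h" "E h \<noteq> 0" "f = E g / E h" using E_fraction by blast
    then have "E g / gen C i0 ^ d \<in> sections d" "E h / gen C i0 ^ d \<in> sections d" "E h / gen C i0 ^ d \<noteq> 0"
      "f = (E g / gen C i0 ^ d) / (E h / gen C i0 ^ d)" using gen_i0 by (auto simp: sections_def)
    then show ?thesis by blast
  qed
  show "res p (f - g) = res p f - res p g" if "p \<in> closed_points C" "f = 0 \<or> 0 \<le> ord_at C p f"
    "g = 0 \<or> 0 \<le> ord_at C p g" for p f g
    using that regular_diff(2) regular_iff by blast
  show "(res p f = 0) = (f = 0 \<or> 1 \<le> ord_at C p f)" if "p \<in> closed_points C" "f = 0 \<or> 0 \<le> ord_at C p f" for p f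
    using that res_eq_0_iff regular_iff by blast
  show "finite (res p ` {f. f = 0 \<or> 0 \<le> ord_at C p f})" if "p \<in> closed_points C" for p
    unfolding reg[OF that] by (rule finite_residues[OF that])
  show "min (ord_at C p f) (ord_at C p g) \<le> ord_at C p (f - g)"
    if "p \<in> closed_points C" "f \<noteq> 0" "g \<noteq> 0" "f \<noteq> g" for p f g
    unfolding ord_at_def by (rule dvr_diff[OF dvr]) (use that in auto)
qed (fact ord_mult no_zero_without_pole sections_surjective | simp add: par triv)+

end

section \<open>Basepoints, gaps and thresholds\<close>

text \<open>Two proper subgroups never cover a group, so some \<open>x\<close> avoids \<open>A\<close> and
  \<open>B\<close>. If \<open>x\<close> lies in \<open>W\<close>, no element \<open>w + c x\<close> of the
  line through \<open>w\<close> lies in \<open>W\<close>, while \<open>A\<close> and \<open>B\<close> contain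
  at most one element of it each; three scalars suffice.\<close>

lemma avoid_three_subspaces:
  fixes h :: "'k::{field,finite} \<Rightarrow> 'f::field"
  assumes h: "field_embedding h" and card: "3 \<le> card (UNIV :: 'k set)"
    and sub: "\<And>U x y. U \<in> {V, A, B, W} \<Longrightarrow> x \<in> U \<Longrightarrow> y \<in> U \<Longrightarrow> x - y \<in> U"
      "\<And>U c x. U \<in> {V, A, B, W} \<Longrightarrow> x \<in> U \<Longrightarrow> h c * x \<in> U"
    and a: "a \<in> V" "a \<notin> A" and b: "b \<in> V" "b \<notin> B" and w: "w \<in> V" "w \<notin> W"
  shows "\<exists>f\<in>V. f \<notin> A \<and> f \<notin> B \<and> f \<notin> W"
proof -
  note hD = field_embeddingD[OF h]
  have add: "x + y \<in> U" if "U \<in> {V, A, B, W}" "x \<in> U" "y \<in> U" for U x y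
    using sub(1)[OF that(1,2) sub(2)[OF that(1,3), of "-1"]] by (simp add: hD)
  have cancel: "x \<in> U" if U: "U \<in> {V, A, B, W}" and xy: "x + y \<in> U" "y \<in> U" for U x y
    using sub(1)[OF U xy] by simp
  obtain x where x: "x \<in> V" "x \<notin> A" "x \<notin> B"
  proof (cases "a \<in> B \<and> b \<in> A")
    case True
    then have "a + b \<notin> A" "a + b \<notin> B" using a b cancel[of A a b] cancel[of B b a] by (auto simp: add.commute)
    then show ?thesis using that[of "a + b"] add[of V a b] a b by blast
  qed (use a b that in blast)
  show ?thesis
  proof (cases "x \<in> W")
    case False
    then show ?thesis using x by blast
  next
    case True
    have one: "c = d" if U: "U \<in> {A, B}" and cd: "w + h c * x \<in> U" "w + h d * x \<in> U" for U c d
    proof (rule ccontr)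
      assume "c \<noteq> d"
      have "(w + h c * x) - (w + h d * x) \<in> U" using sub(1)[OF _ cd] U by blast
      then have "h (c - d) * x \<in> U" by (simp add: hD left_diff_distrib)
      then have "h (inverse (c - d)) * (h (c - d) * x) \<in> U" using sub(2)[of U] U by blast
      moreover have "h (inverse (c - d)) * (h (c - d) * x) = h (inverse (c - d) * (c - d)) * x"
        by (simp only: hD(4) mult.assoc)
      moreover have "h (inverse (c - d) * (c - d)) = 1" using \<open>c \<noteq> d\<close> hD(2) by simp
      ultimately have "x \<in> U" by simp
      then show False using U x by blast
    qed
    have le1: "card {c. w + h c * x \<in> U} \<le> 1" if "U \<in> {A, B}" for U
      unfolding card_le_Suc0_iff_eq[OF finite, folded One_nat_def] using one[OF that] by blast
    have "card ({c. w + h c * x \<in> A} \<union> {c. w + h c * x \<in> B}) \<le> 2"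
      using card_Un_le[of "{c. w + h c * x \<in> A}" "{c. w + h c * x \<in> B}"] le1[of A] le1[of B] by simp
    then have "{c. w + h c * x \<in> A} \<union> {c. w + h c * x \<in> B} \<noteq> UNIV" using card by auto
    then obtain c where c: "w + h c * x \<notin> A" "w + h c * x \<notin> B" by blast
    have "h c * x \<in> W" "h c * x \<in> V" using sub(2) True x(1) by blast+
    then have "w + h c * x \<in> V" "w + h c * x \<notin> W" using add[of V] cancel[of W w] w by blast+
    then show ?thesis using c by blast
  qed
qed

context smooth_curve begin

lemma ord_const: "p \<in> closed_points C \<Longrightarrow> c \<noteq> 0 \<Longrightarrow> ord_at C p (const C c) = 0"
proof -
  assume p: "p \<in> closed_points C" and c: "c \<noteq> 0"
  have "const C c \<noteq> 0" using c by (simp add: emb_simps)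
  moreover have "res p (const C c) \<noteq> 0" using regular_const(2)[OF p] c by simp
  ultimately show ?thesis
    using regular_const(1)[OF p, of c] regular_iff[OF p] res_eq_0_iff[OF p, of "const C c"] by auto
qed

lemma RR_scale: "f \<in> RR D \<Longrightarrow> const C c * f \<in> RR D"
proof (cases "c = 0")
  case False
  assume f: "f \<in> RR D"
  have "ord_ge p (- D p) (f * const C c)" if "p \<in> closed_points C" for p
    using f False that ord_ge_mult[of p "const C c"] ord_const[of p c] by (simp add: RR_def emb_simps)
  then show ?thesis unfolding RR_def by (simp add: mult.commute)
qed (simp add: emb_simps)

lemma RR_space_eq: "RR_space C A = RR (lookup A)"
  unfolding RR_space_def RR_def ord_ge_def by auto

lemma no_basepoint_iff:
  assumes S: "S \<in> closed_points C"
  shows "\<not> has_basepoint_at C D S \<longleftrightarrow> (\<exists>f\<in>RR_space C D. f \<notin> RR_space C (D - frag_of S))"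
proof -
  have "RR_space C (D - frag_of S) \<subseteq> RR_space C D"
    unfolding RR_space_eq by (rule RR_mono) (simp add: lookup_minus)
  then show ?thesis unfolding has_basepoint_at_def by blast
qed

text \<open>Subtracting \<open>S\<close> raises the smallest order allowed at \<open>S\<close> by one and
  changes no other condition.\<close>

lemma exact_order_iff:
  assumes S: "S \<in> closed_points C"
  shows "f \<in> RR_space C D \<and> f \<notin> RR_space C (D - frag_of S) \<longleftrightarrow>
    f \<noteq> 0 \<and> f \<in> RR_space C D \<and> ord_at C S f = - lookup D S"
proof (cases "f = 0 \<or> f \<notin> RR_space C D")
  case False
  then have ord: "- lookup D p \<le> ord_at C p f" if "p \<in> closed_points C" for p
    using that by (auto simp: RR_space_def)
  have "f \<in> RR_space C (D - frag_of S) \<longleftrightarrow> ord_at C S f \<noteq> - lookup D S"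
  proof
    assume "f \<in> RR_space C (D - frag_of S)"
    then show "ord_at C S f \<noteq> - lookup D S"
      using False S by (auto simp: RR_space_def lookup_minus)
  next
    assume "ord_at C S f \<noteq> - lookup D S"
    then have "- lookup (D - frag_of S) p \<le> ord_at C p f" if "p \<in> closed_points C" for p
      using ord[OF that] by (auto simp: lookup_minus)
    then show "f \<in> RR_space C (D - frag_of S)" using False by (simp add: RR_space_def)
  qed
  then show ?thesis using False by blast
qed (auto simp: RR_space_eq)

lemma no_basepoint_iff_exact_order:
  "S \<in> closed_points C \<Longrightarrow> \<not> has_basepoint_at C D S \<longleftrightarrow>
    (\<exists>f. f \<noteq> 0 \<and> f \<in> RR_space C D \<and> ord_at C S f = - lookup D S)"
  using no_basepoint_iff exact_order_iff by blast

lemma int_threshold: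
  fixes N :: "int \<Rightarrow> bool"
  assumes up: "\<And>j j'. N j \<Longrightarrow> j \<le> j' \<Longrightarrow> N j'" and ex: "N j1" and low: "\<And>j. j \<le> j0 \<Longrightarrow> \<not> N j"
  shows "\<exists>s. \<forall>j. N j \<longleftrightarrow> s \<le> j"
proof -
  have "j0 < j1"
  proof (rule ccontr)
    assume "\<not> j0 < j1"
    then show False using low[of j1] ex by simp
  qed
  then have "N (j0 + int (nat (j1 - j0)))" using ex by simp
  then have N: "N (j0 + int (LEAST n. N (j0 + int n)))" by (rule LeastI)
  define n where "n = (LEAST n. N (j0 + int n))"
  have "\<not> N (j0 + int n - 1)"
  proof (cases n)
    case 0
    then show ?thesis using low by simp
  next
    case (Suc m)
    then have "\<not> N (j0 + int m)" using not_less_Least[of m "\<lambda>n. N (j0 + int n)"] unfolding n_def by simp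
    then show ?thesis using Suc by simp
  qed
  then have "N j \<longleftrightarrow> j0 + int n \<le> j" for j
    using up[of j "j0 + int n - 1"] up[of "j0 + int n" j] N unfolding n_def by fastforce
  then show ?thesis by blast
qed

text \<open>The absence of a basepoint at \<open>S\<close> is monotone in \<open>j\<close>, because enlarging
  the divisor at \<open>S'\<close> does not affect the order required at \<open>S\<close>. A divisor lies in
  \<open>\<Delta>(S,S')\<close> exactly at the threshold, so \<open>sigma\<close> is the threshold.\<close>

lemma sigma_le_iff:
  assumes B: "B \<in> divisors C" and S: "S \<in> closed_points C" "S' \<in> closed_points C" "S \<noteq> S'"
  shows "sigma C B S S' i \<le> j \<longleftrightarrow>
    \<not> has_basepoint_at C (B + frag_cmul i (frag_of S) + frag_cmul j (frag_of S')) S"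
proof -
  define D where "D j = B + frag_cmul i (frag_of S) + frag_cmul j (frag_of S')" for j
  define N where "N j \<longleftrightarrow> \<not> has_basepoint_at C (D j) S" for j
  have D_eq: "lookup (D j) = (\<lambda>p. lookup (D 0) p + (if p = S' then j else 0))" for j
    unfolding D_def by (auto simp: lookup_add)
  have fin: "finite {p\<in>closed_points C. lookup (D 0) p \<noteq> 0}"
    by (rule finite_subset[OF _ finite_keys[of "D 0"]]) (auto simp: in_keys_iff)
  have N_iff: "N j \<longleftrightarrow> (\<exists>f. f \<noteq> 0 \<and> f \<in> RR (lookup (D j)) \<and> ord_at C S f = - lookup (D 0) S)" for j
    unfolding N_def no_basepoint_iff_exact_order[OF S(1)] RR_space_eq using D_eq[of j] S(3) by simp
  have up: "N j'" if "N j" "j \<le> j'" for j j'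
  proof -
    have "RR (lookup (D j)) \<subseteq> RR (lookup (D j'))"
      unfolding D_eq[of j] D_eq[of j'] by (rule RR_mono) (use that in simp)
    then show ?thesis using that(1) unfolding N_iff by blast
  qed
  obtain f j1 where f: "f \<in> RR (\<lambda>p. lookup (D 0) p + (if p = S' then j1 else 0))" "f \<noteq> 0"
    "ord_at C S f = - lookup (D 0) S"
    by (rule exact_pole_order[OF S fin])
  have N1: "N j1" unfolding N_iff D_eq[of j1] using f by blast
  obtain j0 where j0: "\<And>j. j \<le> j0 \<Longrightarrow> RR (\<lambda>p. lookup (D 0) p + (if p = S' then j else 0)) = {0}"
    using RR_eventually_zero[OF S(2) fin] by blast
  have low: "\<not> N j" if "j \<le> j0" for j unfolding N_iff D_eq[of j] j0[OF that] by blast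
  have "\<exists>s. \<forall>j. N j \<longleftrightarrow> s \<le> j" by (rule int_threshold[of N j1 j0]) (fact up, fact N1, fact low)
  then obtain s where s: "\<And>j. N j \<longleftrightarrow> s \<le> j" by blast
  have D_div: "D j \<in> divisors C" for j
  proof -
    have "keys (D j) \<subseteq> keys B \<union> {S, S'}"
      unfolding D_def by (auto simp: in_keys_iff lookup_add split: if_splits)
    then show ?thesis using B S by (auto simp: divisors_def)
  qed
  have e1: "D j - frag_of S' = D (j - 1)" for j
    unfolding D_def by (rule poly_mapping_eqI) (simp add: lookup_add lookup_minus)
  have e2: "D j - frag_of S - frag_of S' = D (j - 1) - frag_of S" for j
    unfolding D_def by (rule poly_mapping_eqI) (simp add: lookup_add lookup_minus)
  have "D j \<in> Delta C S S' \<longleftrightarrow> N j \<and> \<not> N (j - 1)" for j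
    unfolding Delta_def N_def has_basepoint_at_def mem_Collect_eq e1 e2 using D_div by blast
  then have "D j \<in> Delta C S S' \<longleftrightarrow> j = s" for j using s by auto
  then have "sigma C B S S' i = s" unfolding sigma_def D_def by simp
  then show ?thesis using s[of j] unfolding N_def D_def by simp
qed

text \<open>At a point where \<open>D\<close> has coefficient \<open>0\<close> the function with pole divisor
  \<open>D\<close> may vanish, and the constant \<open>1\<close> takes over as the witness that there is no
  basepoint.\<close>

lemma semigroup_iff:
  assumes card: "3 \<le> card (UNIV :: 'k set)"
    and pts: "P \<in> closed_points C" "Q \<in> closed_points C" "R \<in> closed_points C"
    and distinct: "P \<noteq> Q" "Q \<noteq> R" "P \<noteq> R"
    and D: "D = frag_cmul (int a) (frag_of P) + frag_cmul (int b) (frag_of Q) + frag_cmul (int c) (frag_of R)"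
  shows "(a, b, c) \<in> weierstrass_semigroup C P Q R \<longleftrightarrow>
    \<not> has_basepoint_at C D P \<and> \<not> has_basepoint_at C D Q \<and> \<not> has_basepoint_at C D R"
proof -
  have look: "lookup D P = int a" "lookup D Q = int b" "lookup D R = int c"
    "\<And>p. p \<noteq> P \<Longrightarrow> p \<noteq> Q \<Longrightarrow> p \<noteq> R \<Longrightarrow> lookup D p = 0"
    using distinct unfolding D by (auto simp: lookup_add)
  have D0: "0 \<le> lookup D p" for p
    using look by (cases "p = P"; cases "p = Q"; cases "p = R") auto
  have D_div: "D \<in> divisors C"
  proof -
    have "keys D \<subseteq> {P, Q, R}" using look(4) unfolding in_keys_iff subset_iff by blast
    then show ?thesis using pts by (auto simp: divisors_def)
  qed
  show ?thesis
  proof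
    assume "(a, b, c) \<in> weierstrass_semigroup C P Q R"
    then obtain f where f: "f \<noteq> 0" "is_pole_divisor C f D" unfolding weierstrass_semigroup_def D by auto
    then have pole: "lookup D p = max 0 (- ord_at C p f)" if "p \<in> closed_points C" for p
      using that by (auto simp: is_pole_divisor_def)
    have f_in: "f \<in> RR_space C D" using pole by (auto simp: RR_space_def)
    have one_in: "1 \<in> RR_space C D" using D0 v_1 by (auto simp: RR_space_def)
    have "\<not> has_basepoint_at C D S" if S: "S \<in> closed_points C" for S
    proof (cases "lookup D S = 0")
      case True
      have "ord_at C S 1 = - lookup D S" using v_1[OF S] True by simp
      then show ?thesis unfolding no_basepoint_iff_exact_order[OF S] using one_in one_neq_zero by blast
    next
      case False
      then have "ord_at C S f = - lookup D S" using pole[OF S] by (simp add: max_def split: if_splits)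
      then show ?thesis unfolding no_basepoint_iff_exact_order[OF S] using f_in f(1) by blast
    qed
    then show "\<not> has_basepoint_at C D P \<and> \<not> has_basepoint_at C D Q \<and> \<not> has_basepoint_at C D R"
      using pts by blast
  next
    assume nb: "\<not> has_basepoint_at C D P \<and> \<not> has_basepoint_at C D Q \<and> \<not> has_basepoint_at C D R"
    have sub: "x - y \<in> RR_space C A" "const C c * x \<in> RR_space C A" if "x \<in> RR_space C A" "y \<in> RR_space C A" for A x y c
      using that RR_diff RR_scale unfolding RR_space_eq by auto
    obtain fP fQ fR where fs: "fP \<in> RR_space C D" "fP \<notin> RR_space C (D - frag_of P)"
      "fQ \<in> RR_space C D" "fQ \<notin> RR_space C (D - frag_of Q)"
      "fR \<in> RR_space C D" "fR \<notin> RR_space C (D - frag_of R)"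
      using nb no_basepoint_iff pts by metis
    have "\<exists>f\<in>RR_space C D. f \<notin> RR_space C (D - frag_of P) \<and> f \<notin> RR_space C (D - frag_of Q) \<and> f \<notin> RR_space C (D - frag_of R)"
      by (rule avoid_three_subspaces[OF emb card _ _ fs]) (use sub in auto)
    then obtain f where f: "f \<in> RR_space C D" "f \<notin> RR_space C (D - frag_of P)"
      "f \<notin> RR_space C (D - frag_of Q)" "f \<notin> RR_space C (D - frag_of R)" by blast
    have ex: "f \<noteq> 0" "ord_at C P f = - int a" "ord_at C Q f = - int b" "ord_at C R f = - int c"
      using f pts look exact_order_iff[of P f D] exact_order_iff[of Q f D] exact_order_iff[of R f D] by auto
    have "lookup D p = max 0 (- ord_at C p f)" if p: "p \<in> closed_points C" for p
    proof -
      have "- lookup D p \<le> ord_at C p f" using f(1) ex(1) p by (auto simp: RR_space_def)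
      then show ?thesis using ex look by (cases "p = P"; cases "p = Q"; cases "p = R") auto
    qed
    then have "is_pole_divisor C f D" using D_div by (simp add: is_pole_divisor_def)
    then show "(a, b, c) \<in> weierstrass_semigroup C P Q R"
      using ex(1) unfolding weierstrass_semigroup_def D by blast
  qed
qed

end

theorem corollary9:
  fixes C :: "('k::{field,finite}, 'f::field, 'n::finite) variety"
    and P Q R :: "('n, 'k) mpoly set"
    and a b c :: nat
    and D :: "('n, 'k) divisor"
  assumes "card (UNIV :: 'k set) > 3"
    and "smooth_projective_curve C"
    and "P \<in> rational_points C" "Q \<in> rational_points C" "R \<in> rational_points C"
    and "P \<noteq> Q" "Q \<noteq> R" "P \<noteq> R"
    and "D = frag_cmul (int a) (frag_of P) + frag_cmul (int b) (frag_of Q)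
                + frag_cmul (int c) (frag_of R)"
  shows "((a, b, c) \<in> weierstrass_gaps C P Q R \<longleftrightarrow>
            has_basepoint_at C D P \<or> has_basepoint_at C D Q \<or> has_basepoint_at C D R) \<and>
         (has_basepoint_at C D P \<or> has_basepoint_at C D Q \<or> has_basepoint_at C D R \<longleftrightarrow>
            sigma C (frag_cmul (int c) (frag_of R)) P Q (int a) > int b \<or>
            sigma C (frag_cmul (int a) (frag_of P)) Q R (int b) > int c \<or>
            sigma C (frag_cmul (int b) (frag_of Q)) R P (int c) > int a)"
proof -
  interpret smooth_curve C by unfold_locales (rule assms(2))
  have pts: "P \<in> closed_points C" "Q \<in> closed_points C" "R \<in> closed_points C"
    using assms(3-5) by (auto simp: rational_points_def closed_points_def)
  have "3 \<le> card (UNIV :: 'k set)" using assms(1) by simp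
  then have "(a, b, c) \<in> weierstrass_gaps C P Q R \<longleftrightarrow>
      has_basepoint_at C D P \<or> has_basepoint_at C D Q \<or> has_basepoint_at C D R"
    unfolding weierstrass_gaps_def using semigroup_iff[OF _ pts assms(6-9)] by blast
  moreover have "int j < sigma C (frag_cmul (int k) (frag_of T)) S S' (int i) \<longleftrightarrow> has_basepoint_at C D S"
    if "S \<in> closed_points C" "S' \<in> closed_points C" "T \<in> closed_points C" "S \<noteq> S'"
      "D = frag_cmul (int k) (frag_of T) + frag_cmul (int i) (frag_of S) + frag_cmul (int j) (frag_of S')"
    for S S' T i j k
  proof -
    have "frag_cmul (int k) (frag_of T) \<in> divisors C"
      using that(3) by (auto simp: divisors_def in_keys_iff split: if_splits)
    from sigma_le_iff[OF this that(1,2,4), of "int i" "int j"] show ?thesis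
      unfolding that(5) by linarith
  qed
  from this[OF pts(1,2,3) assms(6), of c a b] this[OF pts(2,3,1) assms(7), of a b c]
    this[OF pts(3,1,2) assms(8)[symmetric], of b c a]
  have "int b < sigma C (frag_cmul (int c) (frag_of R)) P Q (int a) \<longleftrightarrow> has_basepoint_at C D P"
    "int c < sigma C (frag_cmul (int a) (frag_of P)) Q R (int b) \<longleftrightarrow> has_basepoint_at C D Q"
    "int a < sigma C (frag_cmul (int b) (frag_of Q)) R P (int c) \<longleftrightarrow> has_basepoint_at C D R"
    using assms(9) by (simp_all add: add_ac)
  ultimately show ?thesis by blast
qed

end
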